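(* Let $d\ge 1$, $\delta,K\in(0,\infty)$, $\alpha\in(0,1)$. There is a constant $N=N(\delta,\alpha,d,K)$, depending only on $\delta,\alpha,d,K$, such that the following holds for every $T\in[-\infty,\infty)$, all coefficients $a^{ij},b^i,c$ satisfying (A) with $\delta,K,\alpha$, and every function $f$ satisfying (B) with constants $F_0,F_\alpha$. (i) If $u\in\mathcal C^{2+\alpha}(T)$ satisfies $u_t+Lu=f$ in $(T,\infty)\times\mathbb R^d$, then for all finite $t\ge T$ $$\|u(t,\cdot)\|_{2+\alpha}\le N(F_0+F_\alpha).$$ (ii) If $f$ and the coefficients of $L$ are independent of $t$, then, with the same $N$, for any $u\in C^{2+\alpha}$ satisfying $Lu=f$ in $\mathbb R^d$, $$\|u\|_{2+\alpha}\le N(F_0+F_\alpha).$$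
   Context: $\mathbb R^{d+1}=\{(t,x):t\in\mathbb R,\ x\in\mathbb R^d\}$; $\mathbb R^{d+1}_T=[T,\infty)\times\mathbb R^d$ if $T\in(-\infty,\infty)$, and $\mathbb R^{d+1}_{-\infty}=\mathbb R^{d+1}$. Summation over repeated indices is understood. Operator: $Lu=a^{ij}(t,x)u_{x^ix^j}+b^i(t,x)u_{x^i}-c(t,x)u$. (A) Assumptions on the coefficients (real functions on $\mathbb R^{d+1}$): the matrix $(a^{ij}(t,x))$ is symmetric, $K I\ge (a^{ij}(t,x))\ge\delta I$ and $c(t,x)\ge\delta$ for all $(t,x)\in\mathbb R^{d+1}$; $a^{ij},b^i,c$ are measurable; $b(t,0)$ and $c(t,0)$ are locally bounded in $t$; and $|a^{ij}(t,x)-a^{ij}(t,y)|+|b^i(t,x)-b^i(t,y)|+|c(t,x)-c(t,y)|\le K|x-y|^\alpha$ for all $t\in\mathbb R$, $i,j=1,\dots,d$, and $x,y\in\mathbb R^d$ with $|x-y|\le 1$. (The functions $b$ and $c$ may be unbounded.) (B) Assumptions on $f$: $f$ is measurable on $\mathbb R^{d+1}$, and there are constants $F_0,F_\alpha$ with $|f(t,x)|\le F_0\,c(t,x)$ and $|f(t,x)-f(t,y)|\le F_\alpha|x-y|^\alpha$ whenever $t\in\mathbb R$, $x,y\in\mathbb R^d$, $|x-y|\le1$. Norms: $\|g\|_0=\sup_{\mathbb R^d}|g|$, $[g]_\alpha=\sup_{x\ne y}|g(x)-g(y)|/|x-y|^\alpha$, $\|u\|_{2+\alpha}=\|u\|_0+\|Du\|_0+\|D^2u\|_0+[D^2u]_\alpha$,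 where $Du$, $D^2u$ are the gradient and Hessian in $x$. $C^{2+\alpha}=C^{2+\alpha}(\mathbb R^d)$ is the space of real functions on $\mathbb R^d$ with $\|u\|_{2+\alpha}<\infty$. $\mathcal C^{2+\alpha}(T)$ is the set of functions $u$ on $\mathbb R^{d+1}_T$ such that: $u$ is continuous on $\mathbb R^{d+1}_T$; for each finite $t\ge T$, $u(t,\cdot)\in C^{2+\alpha}$, and $\|u(t,\cdot)\|_{2+\alpha}$ is bounded in $t$; and there is a measurable function $g$ on $\mathbb R^{d+1}_T$ such that for every $\zeta\in C_0^\infty(\mathbb R^{d+1})$ the function $\zeta g$ is bounded and $\alpha$-Hölder continuous in $x$ with constant independent of $t$, and $u(t,x)-u(s,x)=\int_s^t g(r,x)\,dr$ for all $x\in\mathbb R^d$ and finite $s,t$ with $T\le s<t$. One writes $u_t=g$. For $u\in\mathcal C^{2+\alpha}(T)$, "$u_t+Lu=f$ in $(T,\infty)\times\mathbb R^d$" means: for every $x\in\mathbb R^d$ and all finite $t>s\ge T$, $u(t,x)-u(s,x)=\int_s^t f(r,x)\,dr-\int_s^t Lu(r,x)\,dr$. *)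

theory Defs
  imports "HOL-Analysis.Analysis"
begin

text \<open>
  Space is \<open>real ^ 'n\<close>, so that the dimension is \<open>CARD('n) \<ge> 1\<close>. Functions of \<open>(t, x)\<close> are curried;
  topology and measurability refer to their uncurried form on \<open>real \<times> (real ^ 'n)\<close>.
  "Measurable" is Lebesgue measurable.
\<close>

definition grad :: "(real ^ 'n \<Rightarrow> real) \<Rightarrow> real ^ 'n \<Rightarrow> real ^ 'n" where
  "grad v x = (\<chi> i. frechet_derivative v (at x) (axis i 1))"

text \<open>The entry \<open>hess v x $ i $ j\<close> is \<open>v\<^bsub>x\<^sup>ix\<^sup>j\<^esub>(x)\<close>; the norm of a matrix is the Frobenius norm.\<close>

definition hess :: "(real ^ 'n \<Rightarrow> real) \<Rightarrow> real ^ 'n \<Rightarrow> real ^ 'n ^ 'n" where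
  "hess v x = jacobian (grad v) (at x)"

definition sup_norm :: "(real ^ 'n \<Rightarrow> 'b::real_normed_vector) \<Rightarrow> ereal" where
  "sup_norm g = (SUP x. ereal (norm (g x)))"

definition holder_seminorm :: "real \<Rightarrow> (real ^ 'n \<Rightarrow> 'b::real_normed_vector) \<Rightarrow> ereal" where
  "holder_seminorm \<alpha> g =
     (SUP (x, y) \<in> {(x, y). x \<noteq> y}. ereal (norm (g x - g y) / norm (x - y) powr \<alpha>))"

definition norm_2\<alpha> :: "real \<Rightarrow> (real ^ 'n \<Rightarrow> real) \<Rightarrow> ereal" where
  "norm_2\<alpha> \<alpha> v =
     sup_norm v + sup_norm (grad v) + sup_norm (hess v) + holder_seminorm \<alpha> (hess v)"

text \<open>
  The derivatives in \<open>norm_2\<alpha>\<close> are arbitrary where they do not exist, so their existence is a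
  separate requirement; continuity of the Hessian follows from its finite Hoelder seminorm.
\<close>

definition C_2\<alpha> :: "real \<Rightarrow> (real ^ 'n \<Rightarrow> real) set" where
  "C_2\<alpha> \<alpha> = {v. (\<forall>x. v differentiable (at x)) \<and> (\<forall>x. grad v differentiable (at x)) \<and>
                norm_2\<alpha> \<alpha> v < \<infinity>}"

definition elliptic_op ::
  "(real \<Rightarrow> real ^ 'n \<Rightarrow> real ^ 'n ^ 'n) \<Rightarrow> (real \<Rightarrow> real ^ 'n \<Rightarrow> real ^ 'n) \<Rightarrow>
   (real \<Rightarrow> real ^ 'n \<Rightarrow> real) \<Rightarrow> real \<Rightarrow> (real ^ 'n \<Rightarrow> real) \<Rightarrow> real ^ 'n \<Rightarrow> real" where
  "elliptic_op a b c t v x =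
     (\<Sum>i\<in>UNIV. \<Sum>j\<in>UNIV. a t x $ i $ j * hess v x $ i $ j)
     + (\<Sum>i\<in>UNIV. b t x $ i * grad v x $ i) - c t x * v x"

definition coeff_assms ::
  "real \<Rightarrow> real \<Rightarrow> real \<Rightarrow> (real \<Rightarrow> real ^ 'n \<Rightarrow> real ^ 'n ^ 'n) \<Rightarrow>
   (real \<Rightarrow> real ^ 'n \<Rightarrow> real ^ 'n) \<Rightarrow> (real \<Rightarrow> real ^ 'n \<Rightarrow> real) \<Rightarrow> bool" where
  "coeff_assms \<delta> K \<alpha> a b c \<longleftrightarrow>
     (\<forall>t x. transpose (a t x) = a t x) \<and>
     (\<forall>t x \<xi>. \<delta> * (\<xi> \<bullet> \<xi>) \<le> \<xi> \<bullet> (a t x *v \<xi>) \<and> \<xi> \<bullet> (a t x *v \<xi>) \<le> K * (\<xi> \<bullet> \<xi>)) \<and>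
     (\<forall>t x. \<delta> \<le> c t x) \<and>
     (\<forall>i j. (\<lambda>(t, x). a t x $ i $ j) \<in> borel_measurable lebesgue) \<and>
     (\<forall>i. (\<lambda>(t, x). b t x $ i) \<in> borel_measurable lebesgue) \<and>
     (\<lambda>(t, x). c t x) \<in> borel_measurable lebesgue \<and>
     (\<forall>S. compact S \<longrightarrow> bounded ((\<lambda>t. b t 0) ` S) \<and> bounded ((\<lambda>t. c t 0) ` S)) \<and>
     (\<forall>t i j x y. norm (x - y) \<le> 1 \<longrightarrow>
        \<bar>a t x $ i $ j - a t y $ i $ j\<bar> + \<bar>b t x $ i - b t y $ i\<bar> + \<bar>c t x - c t y\<bar>
          \<le> K * norm (x - y) powr \<alpha>)"

definition rhs_assms ::
  "real \<Rightarrow> (real \<Rightarrow> real ^ 'n \<Rightarrow> real) \<Rightarrow> real \<Rightarrow> real \<Rightarrow> (real \<Rightarrow> real ^ 'n \<Rightarrow> real) \<Rightarrow> bool" where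
  "rhs_assms \<alpha> c F\<^sub>0 F\<^sub>\<alpha> f \<longleftrightarrow>
     (\<lambda>(t, x). f t x) \<in> borel_measurable lebesgue \<and>
     (\<forall>t x. \<bar>f t x\<bar> \<le> F\<^sub>0 * c t x) \<and>
     (\<forall>t x y. norm (x - y) \<le> 1 \<longrightarrow> \<bar>f t x - f t y\<bar> \<le> F\<^sub>\<alpha> * norm (x - y) powr \<alpha>)"

definition time_space :: "ereal \<Rightarrow> (real \<times> (real ^ 'n)) set" where
  "time_space T = {(t, x). T \<le> ereal t}"

fun k_times_cont_diff :: "nat \<Rightarrow> ('a::euclidean_space \<Rightarrow> real) \<Rightarrow> bool" where
  "k_times_cont_diff 0 \<zeta> \<longleftrightarrow> continuous_on UNIV \<zeta>"
| "k_times_cont_diff (Suc k) \<zeta> \<longleftrightarrow>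
     (\<forall>z. \<zeta> differentiable (at z)) \<and>
     (\<forall>e\<in>Basis. k_times_cont_diff k (\<lambda>z. frechet_derivative \<zeta> (at z) e))"

definition test_functions :: "('a::euclidean_space \<Rightarrow> real) set" where
  "test_functions = {\<zeta>. (\<forall>k. k_times_cont_diff k \<zeta>) \<and> compact (closure {z. \<zeta> z \<noteq> 0})}"

text \<open>\<open>is_time_deriv \<alpha> T u g\<close> means that \<open>g\<close> serves as \<open>u\<^sub>t\<close> in the definition of the class below.\<close>

definition is_time_deriv ::
  "real \<Rightarrow> ereal \<Rightarrow> (real \<Rightarrow> real ^ 'n \<Rightarrow> real) \<Rightarrow> (real \<Rightarrow> real ^ 'n \<Rightarrow> real) \<Rightarrow> bool" where
  "is_time_deriv \<alpha> T u g \<longleftrightarrow>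
     (\<lambda>(t, x). g t x) \<in> borel_measurable (lebesgue_on (time_space T)) \<and>
     (\<forall>\<zeta>\<in>test_functions. \<exists>C. \<forall>t. T \<le> ereal t \<longrightarrow>
        (\<forall>x. \<bar>\<zeta> (t, x) * g t x\<bar> \<le> C) \<and>
        (\<forall>x y. \<bar>\<zeta> (t, x) * g t x - \<zeta> (t, y) * g t y\<bar> \<le> C * norm (x - y) powr \<alpha>)) \<and>
     (\<forall>x s t. T \<le> ereal s \<and> s < t \<longrightarrow>
        u t x - u s x = set_lebesgue_integral lebesgue {s..t} (\<lambda>r. g r x))"

definition parabolic_class :: "real \<Rightarrow> ereal \<Rightarrow> (real \<Rightarrow> real ^ 'n \<Rightarrow> real) set" where
  "parabolic_class \<alpha> T =
     {u. continuous_on (time_space T) (\<lambda>(t, x). u t x) \<and>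
         (\<forall>t. T \<le> ereal t \<longrightarrow> u t \<in> C_2\<alpha> \<alpha>) \<and>
         (\<exists>M::real. \<forall>t. T \<le> ereal t \<longrightarrow> norm_2\<alpha> \<alpha> (u t) \<le> ereal M) \<and>
         (\<exists>g. is_time_deriv \<alpha> T u g)}"

definition solves_parabolic ::
  "ereal \<Rightarrow> (real \<Rightarrow> real ^ 'n \<Rightarrow> real ^ 'n ^ 'n) \<Rightarrow> (real \<Rightarrow> real ^ 'n \<Rightarrow> real ^ 'n) \<Rightarrow>
   (real \<Rightarrow> real ^ 'n \<Rightarrow> real) \<Rightarrow> (real \<Rightarrow> real ^ 'n \<Rightarrow> real) \<Rightarrow> (real \<Rightarrow> real ^ 'n \<Rightarrow> real) \<Rightarrow> bool" where
  "solves_parabolic T a b c f u \<longleftrightarrow>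
     (\<forall>x s t. T \<le> ereal s \<and> s < t \<longrightarrow>
        u t x - u s x =
          set_lebesgue_integral lebesgue {s..t} (\<lambda>r. f r x)
          - set_lebesgue_integral lebesgue {s..t} (\<lambda>r. elliptic_op a b c r (u r) x))"

definition time_independent :: "(real \<Rightarrow> 'a) \<Rightarrow> bool" where
  "time_independent h \<longleftrightarrow> (\<forall>s t. h s = h t)"

end

theory Submission
  imports Defs
begin

text \<open>
  The estimate follows from the maximum principle alone, applied to triple differences of the
  solution.

  For steps \<open>h\<^sub>1, h\<^sub>2, h\<^sub>3\<close> let \<open>W(t, x, h\<^sub>1, h\<^sub>2, h\<^sub>3)\<close> be the alternating sum of \<open>u(t, \<cdot>)\<close> over the
  eight points \<open>x \<plusminus> h\<^sub>1 \<plusminus> h\<^sub>2 \<plusminus> h\<^sub>3\<close>.  It vanishes with each step, and its second derivatives in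
  \<open>x\<close> and in any of the steps coincide.  Part of the diffusion may therefore be read as diffusion in
  the step variables.  The function \<open>(|h\<^sub>1| |h\<^sub>2| |h\<^sub>3|)\<^bsup>(2+\<alpha>)/3\<^esup>\<close> is concave along each step, its
  second derivative in the direction of the smallest step is at most \<open>- c min |h\<^sub>i|\<^sup>\<alpha>\<close>, and this is
  the size of the triple difference of an \<open>\<alpha>\<close>-Hoelder continuous right-hand side.  So a multiple of it
  is an upper barrier for \<open>W\<close>.  Equal steps of length \<open>s\<close> give a third difference of order
  \<open>s\<^bsup>2+\<alpha>\<^esup>\<close>, which amounts to Hoelder continuity of the second derivatives.

  Growing coefficients do no harm, because the argument takes place at a maximum point of \<open>W\<close> minus
  the barrier and the coefficients may be frozen at exactly this point.  The barrier does not depend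
  on \<open>x\<close>, so that the drift, however large, multiplies a vanishing gradient, and the zeroth order
  term has a favourable sign.  What remains are oscillations of the coefficients over distances of
  at most \<open>3 \<rho>\<close>, where \<open>\<rho>\<close> bounds the steps: they cost a constant times the lower norms
  plus \<open>\<rho>\<^sup>\<alpha>\<close> times the Hoelder seminorm of the Hessian (\<open>frozen_rhs_holder\<close>).  For small \<open>\<rho>\<close> the
  latter is absorbed, interpolation removes the first and second derivatives, and the maximum
  principle bounds \<open>|u|\<close> by \<open>F\<^sub>0\<close>.

  The maximum principle itself (\<open>comparison_principle\<close>) has to cope with coefficients that are
  merely measurable in time, with unbounded space, and with the absence of data at a final time.  The
  key steps after it are \<open>operator_at_maximum_ordered\<close>, \<open>triple_difference_bound\<close>,
  \<open>hess_holder_from_triple_differences\<close> and \<open>absorbed_bounds\<close>.  The elliptic estimate is the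
  parabolic one for a solution that is constant in time, with \<open>T = - \<infinity>\<close>.
\<close>

section \<open>Matrices\<close>

lemma abs_component_le: "\<bar>A $ i $ j\<bar> \<le> norm (A :: real ^ 'n ^ 'm)"
  by (rule order_trans[OF component_le_norm_cart Finite_Cartesian_Product.norm_nth_le])

lemma abs_bilinear_le:
  fixes A :: "real ^ 'n ^ 'n"
  shows "\<bar>\<xi> \<bullet> (A *v \<eta>)\<bar> \<le> real CARD('n) ^ 2 * norm A * norm \<xi> * norm \<eta>"
proof -
  have "\<bar>\<xi> \<bullet> (A *v \<eta>)\<bar> = \<bar>\<Sum>i\<in>UNIV. \<Sum>j\<in>UNIV. \<xi> $ i * (A $ i $ j * \<eta> $ j)\<bar>"
    by (simp add: inner_vec_def matrix_vector_mult_def sum_distrib_left)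
  also have "\<dots> \<le> (\<Sum>i::'n\<in>UNIV. \<Sum>j::'n\<in>UNIV. norm A * norm \<xi> * norm \<eta>)"
  proof (intro order_trans[OF sum_abs] sum_mono)
    fix i j
    have "\<bar>\<xi> $ i * (A $ i $ j * \<eta> $ j)\<bar> = \<bar>A $ i $ j\<bar> * \<bar>\<xi> $ i\<bar> * \<bar>\<eta> $ j\<bar>" by (simp add: abs_mult)
    also have "\<dots> \<le> norm A * norm \<xi> * norm \<eta>"
      by (intro mult_mono abs_component_le component_le_norm_cart mult_nonneg_nonneg) auto
    finally show "\<bar>\<xi> $ i * (A $ i $ j * \<eta> $ j)\<bar> \<le> norm A * norm \<xi> * norm \<eta>" .
  qed
  finally show ?thesis by (simp add: power2_eq_square)
qed

lemma norm_matrix_le_entries: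
  fixes A :: "real ^ 'n ^ 'n"
  assumes "\<And>i j. \<bar>A $ i $ j\<bar> \<le> B"
  shows "norm A \<le> real CARD('n) ^ 2 * B"
proof -
  have "norm A \<le> (\<Sum>i\<in>UNIV. norm (A $ i))" unfolding norm_vec_def by (rule L2_set_le_sum) simp
  also have "\<dots> \<le> (\<Sum>i\<in>(UNIV::'n set). \<Sum>j\<in>(UNIV::'n set). \<bar>A $ i $ j\<bar>)" by (intro sum_mono norm_le_l1_cart)
  also have "\<dots> \<le> (\<Sum>i\<in>(UNIV::'n set). \<Sum>j\<in>(UNIV::'n set). B)" by (intro sum_mono assms)
  finally show ?thesis by (simp add: power2_eq_square)
qed

lemma norm_vector_le_entries:
  fixes A :: "real ^ 'n"
  assumes "\<And>i. \<bar>A $ i\<bar> \<le> B"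
  shows "norm A \<le> real CARD('n) * B"
proof -
  have "norm A \<le> (\<Sum>i\<in>UNIV. \<bar>A $ i\<bar>)" by (rule norm_le_l1_cart)
  also have "\<dots> \<le> (\<Sum>i\<in>(UNIV::'n set). B)" by (intro sum_mono assms)
  finally show ?thesis by simp
qed

lemma axis_quadratic_entry: "axis i 1 \<bullet> (A *v axis j 1) = (A :: real ^ 'n ^ 'n) $ i $ j"
  by (simp add: matrix_vector_mul_component inner_axis' inner_axis)

text \<open>The Cholesky factorisation of a positive semidefinite matrix, by induction on the set of
  indices that carry non-zero rows: a Schur complement removes one index at a time.\<close>

lemma psd_sum_of_squares_aux:
  fixes A :: "real ^ 'n ^ 'n"
  assumes "finite S" "\<And>i j. A $ i $ j = A $ j $ i" "\<And>\<xi>. 0 \<le> \<xi> \<bullet> (A *v \<xi>)"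
    "\<And>i j. i \<notin> S \<Longrightarrow> A $ i $ j = 0"
  shows "\<exists>V. \<forall>i j. A $ i $ j = (\<Sum>k\<in>S. V k $ i * V k $ j)"
  using assms
proof (induction S arbitrary: A rule: finite_induct)
  case empty
  then show ?case by auto
next
  case (insert k S)
  note sym = insert.prems(1) and psd = insert.prems(2) and supp = insert.prems(3)
  have quad: "\<xi> \<bullet> (A *v \<xi>) = (\<Sum>i\<in>UNIV. \<Sum>j\<in>UNIV. \<xi> $ i * A $ i $ j * \<xi> $ j)" for \<xi>
    unfolding inner_vec_def matrix_vector_mult_def by (simp add: sum_distrib_left mult.assoc)
  have kk: "axis k 1 \<bullet> (A *v axis k 1) = A $ k $ k"
    by (simp add: matrix_vector_mul_component inner_axis' inner_axis)
  have shift: "(\<xi> + s *\<^sub>R axis k 1) \<bullet> (A *v (\<xi> + s *\<^sub>R axis k 1)) =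
      \<xi> \<bullet> (A *v \<xi>) + 2 * s * ((A $ k) \<bullet> \<xi>) + s\<^sup>2 * A $ k $ k" for \<xi> s
  proof -
    have "transpose A = A" using sym by (simp add: transpose_def vec_eq_iff)
    then have "\<xi> \<bullet> (A *v axis k 1) = axis k 1 \<bullet> (A *v \<xi>)"
      by (metis dot_lmul_matrix inner_commute transpose_matrix_vector)
    moreover have "axis k 1 \<bullet> (A *v \<xi>) = A $ k \<bullet> \<xi>"
      by (simp add: inner_axis' matrix_vector_mul_component)
    ultimately show ?thesis using kk
      by (simp add: matrix_vector_right_distrib matrix_vector_mult_scaleR inner_add_left inner_add_right
        power2_eq_square algebra_simps)
  qed
  show ?case
  proof (cases "A $ k $ k = 0")
    case True
    \<comment> \<open>Otherwise the quadratic form would be linear and unbounded below in the direction of the axis.\<close>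
    have "A $ k \<bullet> \<xi> = 0" for \<xi>
    proof (rule ccontr)
      assume ne: "A $ k \<bullet> \<xi> \<noteq> 0"
      define s where "s = - (\<xi> \<bullet> (A *v \<xi>) + 1) / (2 * (A $ k \<bullet> \<xi>))"
      have "0 \<le> \<xi> \<bullet> (A *v \<xi>) + 2 * s * ((A $ k) \<bullet> \<xi>)"
        using psd[of "\<xi> + s *\<^sub>R axis k 1"] shift[of \<xi> s] True by simp
      also have "\<dots> = -1" using ne by (simp add: s_def field_simps)
      finally show False by simp
    qed
    then have "A $ k = 0" by (metis inner_eq_zero_iff)
    then have "\<And>i j. i \<notin> S \<Longrightarrow> A $ i $ j = 0" using supp by (metis insert_iff zero_index)
    from insert.IH[OF sym psd this] obtain V where V: "\<And>i j. A $ i $ j = (\<Sum>k\<in>S. V k $ i * V k $ j)"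
      by auto
    have "A $ i $ j = (\<Sum>k'\<in>insert k S. (V(k := 0)) k' $ i * (V(k := 0)) k' $ j)" for i j
      using insert.hyps V by (auto intro!: sum.cong)
    then show ?thesis by blast
  next
    case False
    then have pos: "A $ k $ k > 0" using psd[of "axis k 1"] kk by simp
    define w where "w = (1 / sqrt (A $ k $ k)) *\<^sub>R A $ k"
    define A' :: "real ^ 'n ^ 'n" where "A' = (\<chi> i j. A $ i $ j - w $ i * w $ j)"
    have ww: "w $ i * w $ j = A $ k $ i * A $ k $ j / A $ k $ k" for i j
      using pos by (simp add: w_def)
    have "A' $ i $ j = A' $ j $ i" for i j using sym by (simp add: A'_def)
    moreover have "0 \<le> \<xi> \<bullet> (A' *v \<xi>)" for \<xi>
    proof -
      \<comment> \<open>The minimum of the quadratic form of \<open>A\<close> on the line through \<open>\<xi>\<close> along the axis.\<close>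
      define s where "s = - (A $ k \<bullet> \<xi>) / A $ k $ k"
      have "\<xi> \<bullet> (A' *v \<xi>) = (\<Sum>i\<in>UNIV. \<Sum>j\<in>UNIV. \<xi> $ i * A $ i $ j * \<xi> $ j)
          - (\<Sum>i\<in>UNIV. \<Sum>j\<in>UNIV. (A $ k $ i * \<xi> $ i) * (A $ k $ j * \<xi> $ j)) / A $ k $ k"
        by (simp add: inner_vec_def matrix_vector_mult_def sum_distrib_left A'_def ww algebra_simps
            sum_subtractf sum_divide_distrib)
      also have "\<dots> = \<xi> \<bullet> (A *v \<xi>) - (A $ k \<bullet> \<xi>)\<^sup>2 / A $ k $ k"
        unfolding quad by (simp add: inner_vec_def power2_eq_square sum_product)
      also have "\<dots> = (\<xi> + s *\<^sub>R axis k 1) \<bullet> (A *v (\<xi> + s *\<^sub>R axis k 1))"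
        using pos unfolding shift by (simp add: s_def power2_eq_square field_simps)
      finally show ?thesis using psd by simp
    qed
    moreover have "A' $ i $ j = 0" if "i \<notin> S" for i j
    proof (cases "i = k")
      case True
      then show ?thesis using pos by (simp add: A'_def ww)
    next
      case False
      then have "A $ i $ j = 0" "A $ i $ k = 0" using supp that by auto
      then have "A $ k $ i = 0" using sym by metis
      then show ?thesis using \<open>A $ i $ j = 0\<close> by (simp add: A'_def ww)
    qed
    ultimately obtain V where V: "\<And>i j. A' $ i $ j = (\<Sum>k\<in>S. V k $ i * V k $ j)"
      using insert.IH[of A'] by blast
    have "A $ i $ j = (\<Sum>k'\<in>insert k S. (V(k := w)) k' $ i * (V(k := w)) k' $ j)" for i j
    proof -
      have "(\<Sum>k'\<in>S. (V(k := w)) k' $ i * (V(k := w)) k' $ j) = A' $ i $ j"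
        unfolding V using insert.hyps by (auto intro!: sum.cong)
      then show ?thesis using insert.hyps by (simp add: A'_def)
    qed
    then show ?thesis by blast
  qed
qed

lemma psd_sum_of_squares:
  fixes A :: "real ^ 'n ^ 'n"
  assumes "transpose A = A" "\<And>\<xi>. 0 \<le> \<xi> \<bullet> (A *v \<xi>)"
  obtains V :: "'n \<Rightarrow> real ^ 'n" where "\<And>i j. A $ i $ j = (\<Sum>k\<in>UNIV. V k $ i * V k $ j)"
proof -
  have "A $ i $ j = A $ j $ i" for i j
    using arg_cong[OF assms(1), of "\<lambda>M. M $ i $ j"] by (simp add: transpose_def)
  from psd_sum_of_squares_aux[OF _ this assms(2), of UNIV] that show thesis by auto
qed

lemma trace_sum_of_squares:
  fixes A M :: "real ^ 'n ^ 'n"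
  assumes V: "\<And>i j. A $ i $ j = (\<Sum>k\<in>UNIV. V k $ i * V k $ j)"
  shows "(\<Sum>i\<in>UNIV. \<Sum>j\<in>UNIV. A $ i $ j * M $ i $ j) = (\<Sum>k\<in>(UNIV::'n set). V k \<bullet> (M *v V k))"
proof -
  have "(\<Sum>i\<in>UNIV. \<Sum>j\<in>UNIV. A $ i $ j * M $ i $ j)
      = (\<Sum>i\<in>UNIV. \<Sum>j\<in>UNIV. \<Sum>k\<in>(UNIV::'n set). V k $ i * (M $ i $ j * V k $ j))"
    unfolding V by (simp add: sum_distrib_right sum_distrib_left mult_ac)
  also have "\<dots> = (\<Sum>i\<in>UNIV. \<Sum>k\<in>(UNIV::'n set). \<Sum>j\<in>UNIV. V k $ i * (M $ i $ j * V k $ j))"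
    by (intro sum.cong refl sum.swap)
  also have "\<dots> = (\<Sum>k\<in>(UNIV::'n set). \<Sum>i\<in>UNIV. \<Sum>j\<in>UNIV. V k $ i * (M $ i $ j * V k $ j))"
    by (rule sum.swap)
  finally show ?thesis by (simp add: inner_vec_def matrix_vector_mult_def sum_distrib_left)
qed

text \<open>Written as a sum of squares, \<open>A\<close> turns the trace of the product into a sum of values of the
  quadratic form of \<open>M\<close>, which is bounded one direction at a time.\<close>

lemma trace_upper_bound:
  fixes A M :: "real ^ 'n ^ 'n"
  assumes sym: "transpose A = A" and psd: "\<And>\<xi>. 0 \<le> \<xi> \<bullet> (A *v \<xi>)" and diag: "\<And>i. A $ i $ i \<le> K"
    and M: "\<And>\<xi>. \<xi> \<bullet> (M *v \<xi>) \<le> \<epsilon> * (\<xi> \<bullet> \<xi>)" and \<epsilon>: "0 \<le> \<epsilon>"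
  shows "(\<Sum>i\<in>UNIV. \<Sum>j\<in>UNIV. A $ i $ j * M $ i $ j) \<le> \<epsilon> * (real CARD('n) * K)"
proof -
  obtain V :: "'n \<Rightarrow> real ^ 'n" where V: "\<And>i j. A $ i $ j = (\<Sum>k\<in>UNIV. V k $ i * V k $ j)"
    using psd_sum_of_squares[OF sym psd] by blast
  have "(\<Sum>i\<in>UNIV. \<Sum>j\<in>UNIV. A $ i $ j * M $ i $ j) = (\<Sum>k\<in>(UNIV::'n set). V k \<bullet> (M *v V k))"
    by (rule trace_sum_of_squares[OF V])
  also have "\<dots> \<le> (\<Sum>k\<in>(UNIV::'n set). \<epsilon> * (V k \<bullet> V k))" by (intro sum_mono M)
  also have "\<dots> = \<epsilon> * (\<Sum>k\<in>(UNIV::'n set). \<Sum>i\<in>UNIV. V k $ i * V k $ i)"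
    by (simp add: inner_vec_def sum_distrib_left)
  also have "(\<Sum>k\<in>(UNIV::'n set). \<Sum>i\<in>UNIV. V k $ i * V k $ i) = (\<Sum>i\<in>UNIV. A $ i $ i)"
    unfolding V by (rule sum.swap)
  also have "\<epsilon> * \<dots> \<le> \<epsilon> * (\<Sum>i\<in>(UNIV::'n set). K)" by (intro mult_left_mono sum_mono diag \<epsilon>)
  finally show ?thesis by simp
qed

section \<open>Derivatives along lines\<close>

lemma second_derivative_test_max:
  fixes \<phi> :: "real \<Rightarrow> real"
  assumes r: "r > 0" and d1: "\<And>\<tau>. \<bar>\<tau>\<bar> < r \<Longrightarrow> (\<phi> has_real_derivative \<phi>' \<tau>) (at \<tau>)"
    and d2: "(\<phi>' has_real_derivative l) (at 0)"
    and max: "eventually (\<lambda>\<tau>. \<phi> \<tau> \<le> \<phi> 0) (at 0)"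
  shows "\<phi>' 0 = 0" "l \<le> 0"
proof -
  obtain e where e: "e > 0" "\<And>\<tau>. \<bar>\<tau>\<bar> < e \<Longrightarrow> \<phi> \<tau> \<le> \<phi> 0"
    using max unfolding eventually_at dist_real_def by (metis UNIV_I diff_zero order_refl)
  have zero: "\<phi>' 0 = 0"
    by (rule DERIV_local_max[OF d1[of 0] e(1)]) (use r e(2) in auto)
  show "\<phi>' 0 = 0" by fact
  show "l \<le> 0"
  proof (rule ccontr)
    assume "\<not> l \<le> 0"
    then have "l > 0" by simp
    from DERIV_pos_inc_right[OF d2 this] obtain d where d: "d > 0"
      "\<And>h. 0 < h \<Longrightarrow> h < d \<Longrightarrow> \<phi>' 0 < \<phi>' (0 + h)" by auto
    define s where "s = min d (min e r) / 2"
    have s: "0 < s" "s < d" "s < e" "s < r" using d e r by (auto simp: s_def)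
    obtain z where z: "z > 0" "z < s" "\<phi> s - \<phi> 0 = (s - 0) * \<phi>' z"
      using MVT2[of 0 s \<phi> \<phi>'] s d1 by auto
    have "\<phi>' z > 0" using d(2)[of z] z s zero by auto
    then have "\<phi> s - \<phi> 0 > 0" using z s by simp
    then show False using e(2)[of s] s by simp
  qed
qed

definition twice_diff :: "(real ^ 'n \<Rightarrow> real) \<Rightarrow> bool" where
  "twice_diff v \<longleftrightarrow> (\<forall>x. v differentiable (at x)) \<and> (\<forall>x. grad v differentiable (at x))"

lemma line_derivative:
  fixes v :: "real ^ 'n \<Rightarrow> real"
  assumes "twice_diff v"
  shows "((\<lambda>\<tau>. v (y + \<tau> *\<^sub>R \<xi>)) has_real_derivative (\<xi> \<bullet> grad v (y + \<tau> *\<^sub>R \<xi>))) (at \<tau>)"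
proof -
  let ?x = "y + \<tau> *\<^sub>R \<xi>"
  let ?D = "frechet_derivative v (at ?x)"
  have D: "(v has_derivative ?D) (at ?x)"
    using assms unfolding twice_diff_def frechet_derivative_works by blast
  have lin: "linear ?D" using D has_derivative_linear by blast
  have eq: "?D \<xi> = \<xi> \<bullet> grad v ?x"
  proof -
    have "?D \<xi> = ?D (\<Sum>i\<in>UNIV. \<xi> $ i *\<^sub>R axis i 1)"
      using basis_expansion[of \<xi>] by (simp add: scalar_mult_eq_scaleR)
    also have "\<dots> = (\<Sum>i\<in>UNIV. \<xi> $ i * ?D (axis i 1))"
      by (simp add: linear_sum[OF lin] linear_cmul[OF lin])
    finally show ?thesis by (simp add: grad_def inner_vec_def)
  qed
  have "((\<lambda>\<tau>. y + \<tau> *\<^sub>R \<xi>) has_derivative (\<lambda>h. h *\<^sub>R \<xi>)) (at \<tau>)"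
    by (auto intro!: derivative_eq_intros)
  from has_derivative_compose[OF this D]
  have "((\<lambda>\<tau>. v (y + \<tau> *\<^sub>R \<xi>)) has_derivative (\<lambda>h. ?D (h *\<^sub>R \<xi>))) (at \<tau>)" .
  also have "(\<lambda>h. ?D (h *\<^sub>R \<xi>)) = (*) (\<xi> \<bullet> grad v ?x)"
    using eq by (auto simp: linear_cmul[OF lin] mult.commute)
  finally show ?thesis by (simp add: has_field_derivative_def)
qed

lemma line_derivative_grad:
  fixes v :: "real ^ 'n \<Rightarrow> real"
  assumes "twice_diff v"
  shows "((\<lambda>\<tau>. \<eta> \<bullet> grad v (y + \<tau> *\<^sub>R \<xi>)) has_real_derivative (\<eta> \<bullet> (hess v (y + \<tau> *\<^sub>R \<xi>) *v \<xi>))) (at \<tau>)"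
proof -
  let ?x = "y + \<tau> *\<^sub>R \<xi>"
  have D: "(grad v has_derivative (\<lambda>h. hess v ?x *v h)) (at ?x)"
    using assms unfolding twice_diff_def hess_def jacobian_works[symmetric] by blast
  have "((\<lambda>\<tau>. y + \<tau> *\<^sub>R \<xi>) has_derivative (\<lambda>h. h *\<^sub>R \<xi>)) (at \<tau>)"
    by (auto intro!: derivative_eq_intros)
  from has_derivative_compose[OF this D]
  have "((\<lambda>\<tau>. grad v (y + \<tau> *\<^sub>R \<xi>)) has_derivative (\<lambda>h. hess v ?x *v (h *\<^sub>R \<xi>))) (at \<tau>)" .
  from has_derivative_inner_right[OF this, of \<eta>]
  have "((\<lambda>\<tau>. \<eta> \<bullet> grad v (y + \<tau> *\<^sub>R \<xi>)) has_derivative (\<lambda>h. \<eta> \<bullet> (hess v ?x *v (h *\<^sub>R \<xi>)))) (at \<tau>)" .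
  also have "(\<lambda>h. \<eta> \<bullet> (hess v ?x *v (h *\<^sub>R \<xi>))) = (*) (\<eta> \<bullet> (hess v ?x *v \<xi>))"
    by (auto simp: matrix_vector_mult_scaleR mult.commute)
  finally show ?thesis by (simp add: has_field_derivative_def)
qed

lemma mean_value_line:
  fixes v :: "real ^ 'n \<Rightarrow> real"
  assumes "twice_diff v"
  obtains \<theta> where "0 < \<theta>" "\<theta> < 1" "v (y + \<xi>) - v y = \<xi> \<bullet> grad v (y + \<theta> *\<^sub>R \<xi>)"
  using MVT2[of 0 1 "\<lambda>\<tau>. v (y + \<tau> *\<^sub>R \<xi>)" "\<lambda>\<tau>. \<xi> \<bullet> grad v (y + \<tau> *\<^sub>R \<xi>)"]
    line_derivative[OF assms] by auto

lemma mean_value_line_grad: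
  fixes v :: "real ^ 'n \<Rightarrow> real"
  assumes "twice_diff v"
  obtains \<theta> where "0 < \<theta>" "\<theta> < 1"
    "\<eta> \<bullet> grad v (y + \<xi>) - \<eta> \<bullet> grad v y = \<eta> \<bullet> (hess v (y + \<theta> *\<^sub>R \<xi>) *v \<xi>)"
  using MVT2[of 0 1 "\<lambda>\<tau>. \<eta> \<bullet> grad v (y + \<tau> *\<^sub>R \<xi>)" "\<lambda>\<tau>. \<eta> \<bullet> (hess v (y + \<tau> *\<^sub>R \<xi>) *v \<xi>)"]
    line_derivative_grad[OF assms] by auto

text \<open>For steps along two coordinate axes this is an entry of the Hessian at an intermediate point, with
  the derivatives in the order in which the Hessian takes them.\<close>

lemma second_difference_mean_value:
  fixes v :: "real ^ 'n \<Rightarrow> real"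
  assumes v: "twice_diff v"
  obtains \<theta> \<theta>' where "0 < \<theta>" "\<theta> < 1" "0 < \<theta>'" "\<theta>' < 1"
    "v (y + \<xi> + \<eta>) - v (y + \<xi>) - v (y + \<eta>) + v y
      = \<xi> \<bullet> (hess v (y + \<theta> *\<^sub>R \<xi> + \<theta>' *\<^sub>R \<eta>) *v \<eta>)"
proof -
  let ?\<phi> = "\<lambda>\<tau>. v ((y + \<eta>) + \<tau> *\<^sub>R \<xi>) - v (y + \<tau> *\<^sub>R \<xi>)"
  have "(?\<phi> has_real_derivative
      \<xi> \<bullet> grad v ((y + \<eta>) + \<tau> *\<^sub>R \<xi>) - \<xi> \<bullet> grad v (y + \<tau> *\<^sub>R \<xi>)) (at \<tau>)" for \<tau>
    by (intro DERIV_diff line_derivative v)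
  from MVT2[of 0 1, OF _ this] obtain \<theta> where \<theta>: "0 < \<theta>" "\<theta> < 1"
    "?\<phi> 1 - ?\<phi> 0 = \<xi> \<bullet> grad v ((y + \<eta>) + \<theta> *\<^sub>R \<xi>) - \<xi> \<bullet> grad v (y + \<theta> *\<^sub>R \<xi>)" by auto
  obtain \<theta>' where \<theta>': "0 < \<theta>'" "\<theta>' < 1"
    "\<xi> \<bullet> grad v ((y + \<theta> *\<^sub>R \<xi>) + \<eta>) - \<xi> \<bullet> grad v (y + \<theta> *\<^sub>R \<xi>) =
      \<xi> \<bullet> (hess v ((y + \<theta> *\<^sub>R \<xi>) + \<theta>' *\<^sub>R \<eta>) *v \<eta>)"
    using mean_value_line_grad[OF v] by blast
  show thesis
    by (rule that[of \<theta> \<theta>']) (use \<theta> \<theta>' in \<open>auto simp: algebra_simps\<close>)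
qed

section \<open>Symmetric differences\<close>

definition dif :: "'a::real_vector \<Rightarrow> ('a \<Rightarrow> real) \<Rightarrow> 'a \<Rightarrow> real" where
  "dif h g = (\<lambda>x. g (x + h) - g (x - h))"

abbreviation dif3 :: "'a::real_vector \<Rightarrow> 'a \<Rightarrow> 'a \<Rightarrow> ('a \<Rightarrow> real) \<Rightarrow> 'a \<Rightarrow> real" where
  "dif3 h k l g \<equiv> dif h (dif k (dif l g))"

lemma dif_commute: "dif h (dif k g) = dif k (dif h g)"
  by (rule ext) (simp add: dif_def algebra_simps)

lemma dif_zero [simp]: "dif 0 g = (\<lambda>x. 0)"
  by (rule ext) (simp add: dif_def)

lemma dif_const_zero [simp]: "dif h (\<lambda>x. 0) = (\<lambda>x. 0)"
  by (rule ext) (simp add: dif_def)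

lemma dif_uminus: "dif (- h) g = (\<lambda>x. - dif h g x)"
  by (rule ext) (simp add: dif_def)

lemma dif_add: "dif h (\<lambda>x. g x + k x) = (\<lambda>x. dif h g x + dif h k x)"
  and dif_diff: "dif h (\<lambda>x. g x - k x) = (\<lambda>x. dif h g x - dif h k x)"
  and dif_cmult: "dif h (\<lambda>x. r * g x) = (\<lambda>x. r * dif h g x)"
  and dif_sum: "dif h (\<lambda>x. \<Sum>i\<in>I. G i x) = (\<lambda>x. \<Sum>i\<in>I. dif h (G i) x)"
  by (auto simp: dif_def algebra_simps sum_subtractf)

lemmas dif_linear = dif_add dif_diff dif_cmult dif_sum

text \<open>The difference in \<open>h\<close> can be taken first; the other two differences then only add four of its
  values.\<close>

lemma dif3_abs_le:
  assumes "\<And>y. y \<in> {x + k + l, x + k - l, x - k + l, x - k - l} \<Longrightarrow> \<bar>g (y + h) - g (y - h)\<bar> \<le> B"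
  shows "\<bar>dif3 h k l g x\<bar> \<le> 4 * B"
proof -
  have "dif3 h k l g x = dif3 k l h g x" by (simp add: dif_commute)
  also have "\<dots> = dif h g (x + k + l) - dif h g (x + k - l) - (dif h g (x - k + l) - dif h g (x - k - l))"
    by (simp add: dif_def)
  finally show ?thesis
    using assms[of "x + k + l"] assms[of "x + k - l"] assms[of "x - k + l"] assms[of "x - k - l"]
    by (simp add: dif_def)
qed

text \<open>This weak bound, with two of the three steps, suffices where the third step has length \<open>\<rho>\<close>.\<close>

lemma dif3_quadratic_bound:
  fixes v :: "real ^ 'n \<Rightarrow> real"
  assumes v: "twice_diff v" and B: "\<And>x. norm (hess v x) \<le> B"
  shows "\<bar>dif3 h k l v x\<bar> \<le> 8 * real CARD('n) ^ 2 * B * norm h * norm k"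
proof -
  have *: "\<bar>dif h (dif k v) y\<bar> \<le> 4 * real CARD('n) ^ 2 * B * norm h * norm k" for y
  proof -
    obtain \<theta> \<theta>' where "v (y - h - k + 2 *\<^sub>R h + 2 *\<^sub>R k) - v (y - h - k + 2 *\<^sub>R h) - v (y - h - k + 2 *\<^sub>R k) + v (y - h - k)
      = (2 *\<^sub>R h) \<bullet> (hess v (y - h - k + \<theta> *\<^sub>R (2 *\<^sub>R h) + \<theta>' *\<^sub>R (2 *\<^sub>R k)) *v (2 *\<^sub>R k))"
      (is "_ = _ \<bullet> (?A *v _)")
      using second_difference_mean_value[OF v] by blast
    also have "y - h - k + 2 *\<^sub>R h + 2 *\<^sub>R k = y + h + k" by (simp add: scaleR_2)
    also have "y - h - k + 2 *\<^sub>R h = y + h - k" by (simp add: scaleR_2)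
    also have "y - h - k + 2 *\<^sub>R k = y - h + k" by (simp add: scaleR_2)
    finally have "dif h (dif k v) y = (2 *\<^sub>R h) \<bullet> (?A *v (2 *\<^sub>R k))" by (simp add: dif_def)
    also have "\<bar>\<dots>\<bar> \<le> real CARD('n) ^ 2 * norm ?A * norm (2 *\<^sub>R h) * norm (2 *\<^sub>R k)"
      by (rule abs_bilinear_le)
    also have "\<dots> \<le> real CARD('n) ^ 2 * B * norm (2 *\<^sub>R h) * norm (2 *\<^sub>R k)"
      by (intro mult_right_mono mult_left_mono B) auto
    finally show ?thesis by (simp add: algebra_simps)
  qed
  have "dif3 h k l v x = dif l (dif h (dif k v)) x" by (simp add: dif_commute)
  also have "\<dots> = dif h (dif k v) (x + l) - dif h (dif k v) (x - l)" by (simp add: dif_def[of l])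
  finally show ?thesis using *[of "x + l"] *[of "x - l"] by linarith
qed

section \<open>Real bounds for the Hoelder norm\<close>

text \<open>Real bounds for the four parts of the norm, kept apart because the absorption improves them one
  after the other.\<close>

definition C2_bounds :: "real \<Rightarrow> real \<Rightarrow> real \<Rightarrow> real \<Rightarrow> real \<Rightarrow> (real ^ 'n \<Rightarrow> real) \<Rightarrow> bool" where
  "C2_bounds \<alpha> B0 B1 B2 H v \<longleftrightarrow> twice_diff v \<and> (\<forall>x. \<bar>v x\<bar> \<le> B0) \<and> (\<forall>x. norm (grad v x) \<le> B1) \<and>
     (\<forall>x. norm (hess v x) \<le> B2) \<and> (\<forall>x y. norm (hess v x - hess v y) \<le> H * norm (x - y) powr \<alpha>)"

lemma C2_boundsD:
  assumes "C2_bounds \<alpha> B0 B1 B2 H v"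
  shows "twice_diff v" "\<bar>v x\<bar> \<le> B0" "norm (grad v x) \<le> B1" "norm (hess v x) \<le> B2"
    "norm (hess v x - hess v y) \<le> H * norm (x - y) powr \<alpha>"
  using assms unfolding C2_bounds_def by auto

lemma C2_bounds_nonneg:
  assumes "C2_bounds \<alpha> B0 B1 B2 H (v :: real ^ 'n \<Rightarrow> real)"
  shows "0 \<le> B0" "0 \<le> B1" "0 \<le> B2" "0 \<le> H"
proof -
  show "0 \<le> B0" "0 \<le> B1" "0 \<le> B2"
    using C2_boundsD(2-4)[OF assms, of 0] abs_ge_zero norm_ge_zero order_trans by metis+
  obtain w :: "real ^ 'n" where w: "norm w = 1" using vector_choose_size[of 1] by auto
  have "0 \<le> H * norm (w - 0) powr \<alpha>" using C2_boundsD(5)[OF assms, of w 0] norm_ge_zero order_trans by blast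
  then show "0 \<le> H" using w by simp
qed

lemma norm_2\<alpha>_le:
  fixes v :: "real ^ 'n \<Rightarrow> real"
  assumes v: "C2_bounds \<alpha> B0 B1 B2 H v"
  shows "norm_2\<alpha> \<alpha> v \<le> ereal (B0 + B1 + B2 + H)"
proof -
  note bd = C2_boundsD[OF v]
  have "sup_norm v \<le> ereal B0" "sup_norm (grad v) \<le> ereal B1" "sup_norm (hess v) \<le> ereal B2"
    unfolding sup_norm_def using bd by (auto intro!: SUP_least)
  moreover have "holder_seminorm \<alpha> (hess v) \<le> ereal H"
    unfolding holder_seminorm_def
  proof (rule SUP_least, clarify)
    fix x y :: "real ^ 'n" assume "x \<noteq> y"
    then have "norm (x - y) powr \<alpha> > 0" by simp
    then show "ereal (norm (hess v x - hess v y) / norm (x - y) powr \<alpha>) \<le> ereal H"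
      using bd(5)[of x y] by (simp add: pos_divide_le_eq)
  qed
  ultimately have "norm_2\<alpha> \<alpha> v \<le> ereal B0 + ereal B1 + ereal B2 + ereal H"
    unfolding norm_2\<alpha>_def by (intro add_mono)
  then show ?thesis by simp
qed

lemma C2_bounds_from_norm:
  fixes v :: "real ^ 'n \<Rightarrow> real"
  assumes v: "v \<in> C_2\<alpha> \<alpha>" and M: "norm_2\<alpha> \<alpha> v \<le> ereal M"
  shows "C2_bounds \<alpha> M M M M v"
proof -
  have sup0: "0 \<le> sup_norm g" for g :: "real ^ 'n \<Rightarrow> 'b::real_normed_vector"
    unfolding sup_norm_def by (rule SUP_upper2[of 0]) auto
  obtain w :: "real ^ 'n" where w: "norm w = 1" using vector_choose_size[of 1] by auto
  have hol0: "0 \<le> holder_seminorm \<alpha> (hess v)"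
    unfolding holder_seminorm_def by (rule SUP_upper2[of "(w, 0)"]) (use w in auto)
  note n = sup0[of v] sup0[of "grad v"] sup0[of "hess v"] hol0
  have parts: "sup_norm v \<le> ereal M" "sup_norm (grad v) \<le> ereal M" "sup_norm (hess v) \<le> ereal M"
    "holder_seminorm \<alpha> (hess v) \<le> ereal M"
    using M n unfolding norm_2\<alpha>_def
    by (meson add_increasing add_increasing2 order_refl order_trans add_nonneg_nonneg)+
  have le: "norm (g x) \<le> M" if "sup_norm g \<le> ereal M" for g :: "real ^ 'n \<Rightarrow> 'b::real_normed_vector" and x
  proof -
    have "ereal (norm (g x)) \<le> sup_norm g" unfolding sup_norm_def by (rule SUP_upper) simp
    then show ?thesis using that by (metis ereal_less_eq(3) order_trans)
  qed
  have hol: "norm (hess v x - hess v y) \<le> M * norm (x - y) powr \<alpha>" for x y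
  proof (cases "x = y")
    case False
    have "ereal (norm (hess v x - hess v y) / norm (x - y) powr \<alpha>) \<le> holder_seminorm \<alpha> (hess v)"
      unfolding holder_seminorm_def by (rule SUP_upper2[of "(x, y)"]) (use False in auto)
    then have "norm (hess v x - hess v y) / norm (x - y) powr \<alpha> \<le> M"
      using parts(4) by (metis ereal_less_eq(3) order_trans)
    moreover have "norm (x - y) powr \<alpha> > 0" using False by simp
    ultimately show ?thesis by (simp add: pos_divide_le_eq)
  qed simp
  have "twice_diff v" using v by (simp add: C_2\<alpha>_def twice_diff_def)
  then show ?thesis
    unfolding C2_bounds_def using le[OF parts(1)] le[OF parts(2)] le[OF parts(3)] hol by simp
qed

lemma difference_quotient_error:
  fixes v :: "real ^ 'n \<Rightarrow> real"
  assumes v: "C2_bounds \<alpha> B0 B1 B2 H v" and s: "s > 0"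
  shows "\<bar>(v (x + s *\<^sub>R axis i 1) - v x) / s - grad v x $ i\<bar> \<le> real CARD('n) ^ 2 * B2 * s"
proof -
  let ?e = "axis i 1 :: real ^ 'n"
  note bd = C2_boundsD[OF v]
  obtain \<theta> where \<theta>: "0 < \<theta>" "\<theta> < 1" "v (x + s *\<^sub>R ?e) - v x = (s *\<^sub>R ?e) \<bullet> grad v (x + \<theta> *\<^sub>R (s *\<^sub>R ?e))"
    using mean_value_line[OF bd(1)] by blast
  then have quot: "(v (x + s *\<^sub>R ?e) - v x) / s = ?e \<bullet> grad v (x + (\<theta> * s) *\<^sub>R ?e)" using s by simp
  obtain \<theta>' where \<theta>': "?e \<bullet> grad v (x + (\<theta> * s) *\<^sub>R ?e) - ?e \<bullet> grad v x
      = ?e \<bullet> (hess v (x + \<theta>' *\<^sub>R ((\<theta> * s) *\<^sub>R ?e)) *v ((\<theta> * s) *\<^sub>R ?e))" (is "_ = _ \<bullet> (?h *v _)")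
    using mean_value_line_grad[OF bd(1)] by blast
  have "\<bar>?e \<bullet> grad v (x + (\<theta> * s) *\<^sub>R ?e) - ?e \<bullet> grad v x\<bar>
      \<le> real CARD('n) ^ 2 * norm ?h * norm ?e * norm ((\<theta> * s) *\<^sub>R ?e)"
    unfolding \<theta>' by (rule abs_bilinear_le)
  also have "\<dots> \<le> real CARD('n) ^ 2 * B2 * 1 * s"
    using bd(4) C2_bounds_nonneg(3)[OF v] \<theta> s by (intro mult_mono) (auto simp: mult_le_cancel_right1)
  finally show ?thesis unfolding quot by (simp add: inner_axis')
qed

lemma second_difference_quotient_error:
  fixes v :: "real ^ 'n \<Rightarrow> real"
  assumes v: "C2_bounds \<alpha> B0 B1 B2 H v" and \<alpha>: "\<alpha> > 0" and s: "s > 0"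
  shows "\<bar>(v (x + s *\<^sub>R axis i 1 + s *\<^sub>R axis j 1) - v (x + s *\<^sub>R axis i 1) - v (x + s *\<^sub>R axis j 1) + v x) / s\<^sup>2
     - hess v x $ i $ j\<bar> \<le> H * (2 * s) powr \<alpha>"
proof -
  let ?ei = "axis i 1 :: real ^ 'n" and ?ej = "axis j 1 :: real ^ 'n"
  note bd = C2_boundsD[OF v]
  obtain \<theta> \<theta>' where \<theta>: "0 < \<theta>" "\<theta> < 1" "0 < \<theta>'" "\<theta>' < 1"
    "v (x + s *\<^sub>R ?ei + s *\<^sub>R ?ej) - v (x + s *\<^sub>R ?ei) - v (x + s *\<^sub>R ?ej) + v x
       = (s *\<^sub>R ?ei) \<bullet> (hess v (x + \<theta> *\<^sub>R s *\<^sub>R ?ei + \<theta>' *\<^sub>R s *\<^sub>R ?ej) *v (s *\<^sub>R ?ej))"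
    using second_difference_mean_value[OF bd(1)] by blast
  let ?z = "x + \<theta> *\<^sub>R s *\<^sub>R ?ei + \<theta>' *\<^sub>R s *\<^sub>R ?ej"
  have "(v (x + s *\<^sub>R ?ei + s *\<^sub>R ?ej) - v (x + s *\<^sub>R ?ei) - v (x + s *\<^sub>R ?ej) + v x) / s\<^sup>2 = hess v ?z $ i $ j"
    unfolding \<theta>(5) using s
    by (simp add: matrix_vector_mult_scaleR inner_axis' matrix_vector_mul_component inner_axis power2_eq_square)
  then have "\<bar>(v (x + s *\<^sub>R ?ei + s *\<^sub>R ?ej) - v (x + s *\<^sub>R ?ei) - v (x + s *\<^sub>R ?ej) + v x) / s\<^sup>2 - hess v x $ i $ j\<bar>
      = \<bar>(hess v ?z - hess v x) $ i $ j\<bar>" by simp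
  also have "\<dots> \<le> norm (hess v ?z - hess v x)" by (rule abs_component_le)
  also have "\<dots> \<le> H * norm (?z - x) powr \<alpha>" by (rule bd(5))
  also have "\<dots> \<le> H * (2 * s) powr \<alpha>"
  proof (intro mult_left_mono powr_mono2 C2_bounds_nonneg(4)[OF v])
    have "norm (?z - x) \<le> norm (\<theta> *\<^sub>R s *\<^sub>R ?ei) + norm (\<theta>' *\<^sub>R s *\<^sub>R ?ej)"
      using norm_triangle_ineq[of "\<theta> *\<^sub>R s *\<^sub>R ?ei" "\<theta>' *\<^sub>R s *\<^sub>R ?ej"] by (simp add: algebra_simps)
    also have "\<dots> \<le> 1 * s + 1 * s" using \<theta> s by (intro add_mono) (auto intro!: mult_right_mono)
    finally show "norm (?z - x) \<le> 2 * s" by simp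
  qed (use \<alpha> in auto)
  finally show ?thesis .
qed

text \<open>The difference quotients are continuous in the parameter and, by the bounds on higher
  derivatives, converge uniformly to the derivatives.\<close>

lemma derivatives_continuous_in_parameter:
  fixes u :: "real \<Rightarrow> real ^ 'n \<Rightarrow> real"
  assumes b: "\<And>t. t \<in> A \<Longrightarrow> C2_bounds \<alpha> B0 B1 B2 H (u t)" and \<alpha>: "\<alpha> > 0"
    and cont: "\<And>x. continuous_on A (\<lambda>t. u t x)"
  shows "continuous_on A (\<lambda>t. grad (u t) x $ i)" "continuous_on A (\<lambda>t. hess (u t) x $ i $ j)"
proof -
  let ?ei = "axis i 1 :: real ^ 'n" and ?ej = "axis j 1 :: real ^ 'n"
  let ?q = "\<lambda>s t. (u t (x + s *\<^sub>R ?ei) - u t x) / s"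
  show "continuous_on A (\<lambda>t. grad (u t) x $ i)"
  proof (rule uniform_limit_theorem[where F = "at_right (0::real)" and f = ?q])
    show "\<forall>\<^sub>F s in at_right 0. continuous_on A (?q s)"
      using eventually_at_right_less[of "0::real"] by eventually_elim (intro continuous_intros cont; auto)
    let ?C = "real CARD('n) ^ 2 * B2"
    have est: "\<bar>?q s t - grad (u t) x $ i\<bar> \<le> ?C * s" if "t \<in> A" "s > 0" for t s
      by (rule difference_quotient_error[OF b[OF that(1)] that(2)])
    show "uniform_limit A ?q (\<lambda>t. grad (u t) x $ i) (at_right 0)"
    proof (rule uniform_limitI)
      fix e :: real assume "e > 0"
      have "((\<lambda>s. ?C * s) \<longlongrightarrow> ?C * 0) (at_right 0)" by (intro tendsto_intros)
      then have "\<forall>\<^sub>F s in at_right 0. ?C * s < e" by (rule order_tendstoD(2)) (use \<open>e > 0\<close> in simp)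
      then show "\<forall>\<^sub>F s in at_right 0. \<forall>t\<in>A. dist (?q s t) (grad (u t) x $ i) < e"
        using eventually_at_right_less[of "0::real"]
        by eventually_elim (auto simp: dist_real_def dest!: est intro: le_less_trans)
    qed
  qed simp
  let ?Q = "\<lambda>s t. (u t (x + s *\<^sub>R ?ei + s *\<^sub>R ?ej) - u t (x + s *\<^sub>R ?ei) - u t (x + s *\<^sub>R ?ej) + u t x) / s\<^sup>2"
  show "continuous_on A (\<lambda>t. hess (u t) x $ i $ j)"
  proof (rule uniform_limit_theorem[where F = "at_right (0::real)" and f = ?Q])
    show "\<forall>\<^sub>F s in at_right 0. continuous_on A (?Q s)"
      using eventually_at_right_less[of "0::real"] by eventually_elim (intro continuous_intros cont; auto)
    have est: "\<bar>?Q s t - hess (u t) x $ i $ j\<bar> \<le> H * (2 * s) powr \<alpha>" if "t \<in> A" "s > 0" for t s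
      by (rule second_difference_quotient_error[OF b[OF that(1)] \<alpha> that(2)])
    show "uniform_limit A ?Q (\<lambda>t. hess (u t) x $ i $ j) (at_right 0)"
    proof (rule uniform_limitI)
      fix e :: real assume "e > 0"
      have "((\<lambda>s. H * (2 * s) powr \<alpha>) \<longlongrightarrow> H * (2 * 0) powr \<alpha>) (at_right 0)"
      proof (intro tendsto_intros tendsto_powr')
        show "2 * (0::real) \<noteq> 0 \<or> 0 < \<alpha> \<and> (\<forall>\<^sub>F s in at_right 0. 0 \<le> 2 * (s::real))"
          using \<alpha> eventually_at_right_less[of "0::real"] by (auto elim: eventually_mono)
      qed
      then have "\<forall>\<^sub>F s in at_right 0. H * (2 * s) powr \<alpha> < e"
        by (rule order_tendstoD(2)) (use \<open>e > 0\<close> in simp)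
      then show "\<forall>\<^sub>F s in at_right 0. \<forall>t\<in>A. dist (?Q s t) (hess (u t) x $ i $ j) < e"
        using eventually_at_right_less[of "0::real"]
        by eventually_elim (auto simp: dist_real_def dest!: est intro: le_less_trans)
    qed
  qed simp
qed

section \<open>Measurability and growth of the coefficients\<close>

lemma AE_lborel_dense:
  fixes x :: "'a::euclidean_space"
  assumes ae: "AE y in lborel. P y" and e: "e > 0"
  shows "\<exists>y. dist y x < e \<and> P y"
proof (rule ccontr)
  assume "\<not> ?thesis"
  then have sub: "ball x e \<subseteq> {y. \<not> P y}" by (auto simp: dist_commute)
  from ae obtain N where N: "{y \<in> space lborel. \<not> P y} \<subseteq> N" "N \<in> null_sets lborel"
    unfolding eventually_ae_filter by auto
  have "negligible N" using N(2) by (simp add: negligible_iff_null_sets null_sets_completionI)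
  moreover have "ball x e \<subseteq> N" using sub N(1) by auto
  ultimately have "negligible (ball x e)" by (rule negligible_subset)
  then show False using open_not_negligible[of "ball x e"] e by auto
qed

text \<open>By Fubini almost every slice of a Lebesgue measurable function is measurable; continuity in
  the other variable then carries this over to every slice.\<close>

lemma slice_measurable:
  fixes g :: "real \<Rightarrow> 'a::euclidean_space \<Rightarrow> real"
  assumes g: "(\<lambda>(t, x). g t x) \<in> borel_measurable lebesgue"
    and cont: "\<And>t. continuous_on UNIV (g t)"
  shows "(\<lambda>t. g t x) \<in> borel_measurable lebesgue"
proof -
  obtain g' :: "real \<times> 'a \<Rightarrow> real" where g': "g' \<in> borel_measurable lborel"
    and eq: "AE z in lborel. (\<lambda>(t, x). g t x) z = g' z"
    using completion_ex_borel_measurable_real[OF g] by auto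
  obtain N where N: "N \<in> sets lborel" "emeasure lborel N = 0"
      and sub: "{z. (\<lambda>(t, x). g t x) z \<noteq> g' z} \<subseteq> N"
    using eq by (auto elim: AE_E)
  have outside: "g' (t, x) = g t x" if "(t, x) \<notin> N" for t x
    using sub that by (force simp: subset_iff)
  have "AE z in lborel. z \<notin> N" by (rule AE_not_in) (use N in \<open>auto simp: null_sets_def\<close>)
  then have "AE z in (lborel :: real measure) \<Otimes>\<^sub>M (lborel :: 'a measure). z \<notin> N"
    by (subst lborel_prod)
  then have "AE t in lborel. AE x in lborel. (t, x) \<notin> N"
    by (rule lborel_pair.AE_pair)
  moreover have "{z \<in> space (lborel \<Otimes>\<^sub>M lborel). (fst z, snd z) \<notin> N} \<in> sets (lborel \<Otimes>\<^sub>M lborel)"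
    unfolding lborel_prod using sets.compl_sets[OF N(1)] by (simp add: set_diff_eq)
  ultimately have "AE x in lborel. AE t in lborel. (t, x) \<notin> N"
    by (subst (asm) lborel_pair.AE_commute) auto
  then have good: "AE x in lborel. (\<lambda>t. g t x) \<in> borel_measurable lebesgue"
  proof (rule eventually_mono)
    fix x assume "AE t in lborel. (t, x) \<notin> N"
    then have "AE t in lborel. g' (t, x) = g t x" by (rule eventually_mono) (rule outside)
    then have "AE t in lebesgue. g' (t, x) = g t x" by (rule AE_completion)
    moreover have "(\<lambda>t. g' (t, x)) \<in> borel_measurable lebesgue"
    proof (rule measurable_completion)
      have "g' \<in> borel_measurable ((lborel :: real measure) \<Otimes>\<^sub>M (lborel :: 'a measure))"
        using g' by (simp add: lborel_prod)
      then show "(\<lambda>t. g' (t, x)) \<in> borel_measurable lborel"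
        by (rule measurable_compose[rotated]) measurable
    qed
    ultimately show "(\<lambda>t. g t x) \<in> borel_measurable lebesgue"
      by (rule borel_measurable_AE[rotated])
  qed
  have "\<forall>n. \<exists>y. dist y x < 1 / real (Suc n) \<and> (\<lambda>t. g t y) \<in> borel_measurable lebesgue"
    using AE_lborel_dense[OF good] by simp
  then obtain X where X: "\<And>n. dist (X n) x < 1 / real (Suc n)"
      "\<And>n. (\<lambda>t. g t (X n)) \<in> borel_measurable lebesgue"
    unfolding choice_iff by blast
  have "X \<longlonglongrightarrow> x"
  proof (rule metric_LIMSEQ_I)
    fix r :: real assume "r > 0"
    then obtain n where n: "1 / real (Suc n) < r" using nat_approx_posE by blast
    show "\<exists>no. \<forall>n\<ge>no. dist (X n) x < r"
    proof (intro exI allI impI)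
      fix m assume "n \<le> m"
      then have "1 / real (Suc m) \<le> 1 / real (Suc n)" by (simp add: frac_le)
      then show "dist (X m) x < r" using X(1)[of m] n by linarith
    qed
  qed
  show ?thesis
  proof (rule borel_measurable_LIMSEQ_real[OF _ X(2)])
    fix t
    show "(\<lambda>n. g t (X n)) \<longlonglongrightarrow> g t x"
      by (rule isCont_tendsto_compose[OF _ \<open>X \<longlonglongrightarrow> x\<close>])
        (use cont[of t] in \<open>simp add: continuous_on_eq_continuous_at\<close>)
  qed
qed

lemma locally_holder_continuous:
  fixes g :: "'a::real_normed_vector \<Rightarrow> real"
  assumes g: "\<And>x y. norm (x - y) \<le> 1 \<Longrightarrow> \<bar>g x - g y\<bar> \<le> K * norm (x - y) powr \<alpha>" and \<alpha>: "\<alpha> > 0"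
  shows "continuous_on UNIV g"
  unfolding continuous_on_eq_continuous_at[OF open_UNIV]
proof
  fix x :: 'a
  have "((\<lambda>y. K * norm (y - x) powr \<alpha>) \<longlongrightarrow> K * norm (x - x) powr \<alpha>) (at x)"
    by (intro tendsto_intros tendsto_powr') (use \<alpha> in auto)
  then have lim: "((\<lambda>y. K * norm (y - x) powr \<alpha>) \<longlongrightarrow> 0) (at x)" by simp
  have "((\<lambda>y. g y - g x) \<longlongrightarrow> 0) (at x)"
  proof (rule Lim_null_comparison[OF _ lim])
    have "eventually (\<lambda>y. dist y x < 1) (at x)" unfolding eventually_at by (rule exI[of _ 1]) simp
    then show "eventually (\<lambda>y. norm (g y - g x) \<le> K * norm (y - x) powr \<alpha>) (at x)"
      by (rule eventually_mono) (auto simp: dist_norm intro!: g)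
  qed
  then show "isCont g x" unfolding isCont_def by (subst Lim_null)
qed

text \<open>The point \<open>x\<close> is reached from the origin in about \<open>norm x\<close> steps of length at most \<open>1\<close>.\<close>

lemma locally_holder_linear_growth:
  fixes g :: "'a::real_normed_vector \<Rightarrow> real"
  assumes g: "\<And>x y. norm (x - y) \<le> 1 \<Longrightarrow> \<bar>g x - g y\<bar> \<le> K * norm (x - y) powr \<alpha>"
    and K: "K \<ge> 0" and \<alpha>: "\<alpha> > 0"
  shows "\<bar>g x - g 0\<bar> \<le> K * (norm x + 1)"
proof -
  have *: "norm x \<le> real n \<Longrightarrow> \<bar>g x - g 0\<bar> \<le> K * real n" for n x
  proof (induction n arbitrary: x)
    case 0
    then show ?case by simp
  next
    case (Suc n)
    define y where "y = (real n / real (Suc n)) *\<^sub>R x"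
    have "x - y = (1 - real n / real (Suc n)) *\<^sub>R x" by (simp add: y_def scaleR_diff_left)
    also have "1 - real n / real (Suc n) = 1 / real (Suc n)" by (simp add: field_simps)
    finally have "norm (x - y) = norm ((1 / real (Suc n)) *\<^sub>R x)" by (simp only:)
    also have "\<dots> = norm x / real (Suc n)" by simp
    finally have xy: "norm (x - y) \<le> 1" using Suc.prems by (simp add: divide_le_eq)
    have "norm y \<le> real n / real (Suc n) * real (Suc n)"
      unfolding y_def norm_scaleR using Suc.prems by (intro mult_mono) auto
    then have "norm y \<le> real n" by simp
    from Suc.IH[OF this] have "\<bar>g y - g 0\<bar> \<le> K * real n" .
    moreover have "\<bar>g x - g y\<bar> \<le> K * norm (x - y) powr \<alpha>" by (rule g[OF xy])
    moreover have "K * norm (x - y) powr \<alpha> \<le> K * 1"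
      by (intro mult_left_mono powr_le1) (use xy K \<alpha> in auto)
    ultimately show ?case by (simp add: algebra_simps)
  qed
  have "\<bar>g x - g 0\<bar> \<le> K * real (nat \<lceil>norm x\<rceil>)" by (rule *) linarith
  also have "\<dots> \<le> K * (norm x + 1)"
    by (intro mult_left_mono K) (use norm_ge_zero[of x] in linarith)
  finally show ?thesis .
qed

section \<open>The parabolic problem\<close>

locale parabolic_problem =
  fixes \<delta> K \<alpha> :: real and T :: ereal
    and a :: "real \<Rightarrow> real ^ 'n \<Rightarrow> real ^ 'n ^ 'n" and b :: "real \<Rightarrow> real ^ 'n \<Rightarrow> real ^ 'n"
    and c f :: "real \<Rightarrow> real ^ 'n \<Rightarrow> real" and F\<^sub>0 F\<^sub>\<alpha> :: real
    and u :: "real \<Rightarrow> real ^ 'n \<Rightarrow> real" and B0 B1 B2 H :: real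
  assumes \<delta>: "0 < \<delta>" and K: "0 < K" and \<alpha>: "0 < \<alpha>" and \<alpha>1: "\<alpha> < 1"
    and coeff: "coeff_assms \<delta> K \<alpha> a b c" and rhs: "rhs_assms \<alpha> c F\<^sub>0 F\<^sub>\<alpha> f"
    and cont: "continuous_on (time_space T) (\<lambda>(t, x). u t x)"
    and bounds: "\<And>t. T \<le> ereal t \<Longrightarrow> C2_bounds \<alpha> B0 B1 B2 H (u t)"
    and solves: "solves_parabolic T a b c f u"
begin

lemma a_sym: "transpose (a t x) = a t x"
  and a_lower: "\<delta> * (\<xi> \<bullet> \<xi>) \<le> \<xi> \<bullet> (a t x *v \<xi>)"
  and a_upper: "\<xi> \<bullet> (a t x *v \<xi>) \<le> K * (\<xi> \<bullet> \<xi>)"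
  and c_lower: "\<delta> \<le> c t x"
  and a_measurable: "(\<lambda>(t, x). a t x $ i $ j) \<in> borel_measurable lebesgue"
  and b_measurable: "(\<lambda>(t, x). b t x $ i) \<in> borel_measurable lebesgue"
  and c_measurable: "(\<lambda>(t, x). c t x) \<in> borel_measurable lebesgue"
proof -
  note A = coeff[unfolded coeff_assms_def]
  show "transpose (a t x) = a t x" by (rule A[THEN conjunct1, rule_format])
  note A = A[THEN conjunct2]
  show "\<delta> * (\<xi> \<bullet> \<xi>) \<le> \<xi> \<bullet> (a t x *v \<xi>)" by (rule A[THEN conjunct1, rule_format, THEN conjunct1])
  show "\<xi> \<bullet> (a t x *v \<xi>) \<le> K * (\<xi> \<bullet> \<xi>)" by (rule A[THEN conjunct1, rule_format, THEN conjunct2])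
  note A = A[THEN conjunct2]
  show "\<delta> \<le> c t x" by (rule A[THEN conjunct1, rule_format])
  note A = A[THEN conjunct2]
  show "(\<lambda>(t, x). a t x $ i $ j) \<in> borel_measurable lebesgue" by (rule A[THEN conjunct1, rule_format])
  note A = A[THEN conjunct2]
  show "(\<lambda>(t, x). b t x $ i) \<in> borel_measurable lebesgue" by (rule A[THEN conjunct1, rule_format])
  note A = A[THEN conjunct2]
  show "(\<lambda>(t, x). c t x) \<in> borel_measurable lebesgue" by (rule A[THEN conjunct1])
qed

lemma coeff_holder_sum:
  "norm (x - y) \<le> 1 \<Longrightarrow> \<bar>a t x $ i $ j - a t y $ i $ j\<bar> + \<bar>b t x $ i - b t y $ i\<bar> + \<bar>c t x - c t y\<bar>
     \<le> K * norm (x - y) powr \<alpha>"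
  by (rule coeff[unfolded coeff_assms_def, THEN conjunct2, THEN conjunct2, THEN conjunct2, THEN conjunct2,
      THEN conjunct2, THEN conjunct2, THEN conjunct2, rule_format])

lemma a_holder: "norm (x - y) \<le> 1 \<Longrightarrow> \<bar>a t x $ i $ j - a t y $ i $ j\<bar> \<le> K * norm (x - y) powr \<alpha>"
  using coeff_holder_sum[of x y t i j] by linarith

lemma b_holder: "norm (x - y) \<le> 1 \<Longrightarrow> \<bar>b t x $ i - b t y $ i\<bar> \<le> K * norm (x - y) powr \<alpha>"
  using coeff_holder_sum[of x y t i i] by linarith

lemma c_holder: "norm (x - y) \<le> 1 \<Longrightarrow> \<bar>c t x - c t y\<bar> \<le> K * norm (x - y) powr \<alpha>"
  using coeff_holder_sum[of x y t undefined undefined] by linarith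

lemma f_measurable: "(\<lambda>(t, x). f t x) \<in> borel_measurable lebesgue"
  and f_bound: "\<bar>f t x\<bar> \<le> F\<^sub>0 * c t x"
  and f_holder: "norm (x - y) \<le> 1 \<Longrightarrow> \<bar>f t x - f t y\<bar> \<le> F\<^sub>\<alpha> * norm (x - y) powr \<alpha>"
  using rhs unfolding rhs_assms_def by blast+

lemma c_pos: "0 < c t x"
  using c_lower[of t x] \<delta> by linarith

lemma F0_nonneg: "0 \<le> F\<^sub>0"
  using f_bound[of 0 0] c_pos[of 0 0] by (smt (verit) zero_le_mult_iff)

lemma F\<alpha>_nonneg: "0 \<le> F\<^sub>\<alpha>"
proof -
  obtain w :: "real ^ 'n" where w: "norm w = 1" using vector_choose_size[of 1] by auto
  then show ?thesis using f_holder[of w 0 0] by simp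
qed

lemma a_diagonal: "0 \<le> a t x $ i $ i" "a t x $ i $ i \<le> K"
proof -
  have "axis i 1 \<bullet> (a t x *v axis i 1) = a t x $ i $ i"
    by (rule axis_quadratic_entry)
  moreover have "axis i 1 \<bullet> axis i (1::real) = 1" by (simp add: inner_axis)
  ultimately show "0 \<le> a t x $ i $ i" "a t x $ i $ i \<le> K"
    using a_lower[of "axis i 1" t x] a_upper[of "axis i 1" t x] \<delta> by auto
qed

lemma a_entry: "\<bar>a t x $ i $ j\<bar> \<le> K"
proof (cases "i = j")
  case True
  then show ?thesis using a_diagonal[of t x i] by simp
next
  case False
  let ?A = "a t x" and ?w = "axis i 1 + axis j 1 :: real ^ 'n"
  have sym: "?A $ j $ i = ?A $ i $ j" using arg_cong[OF a_sym[of t x], of "\<lambda>M. M $ i $ j"] by (simp add: transpose_def)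
  have "?w \<bullet> (?A *v ?w) = ?A $ i $ i + 2 * ?A $ i $ j + ?A $ j $ j"
    by (simp only: matrix_vector_right_distrib inner_add_left inner_add_right axis_quadratic_entry sym)
  moreover have "?w \<bullet> ?w = 2"
    using False by (simp add: inner_add_left inner_add_right inner_axis_axis)
  ultimately show ?thesis
    using a_lower[of ?w t x] a_upper[of ?w t x] a_diagonal[of t x i] a_diagonal[of t x j] \<delta>
    by (simp add: abs_le_iff)
qed

lemma coefficient_growth:
  obtains C where "C \<ge> 0" "\<And>r x i. r \<in> {s..S} \<Longrightarrow> \<bar>b r x $ i\<bar> \<le> C * (1 + norm x)"
    "\<And>r x. r \<in> {s..S} \<Longrightarrow> \<bar>c r x\<bar> \<le> C * (1 + norm x)"
proof -
  have "bounded ((\<lambda>t. b t 0) ` {s..S})" "bounded ((\<lambda>t. c t 0) ` {s..S})"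
    using coeff unfolding coeff_assms_def by auto
  then obtain Cb Cc where Cb: "\<And>r. r \<in> {s..S} \<Longrightarrow> norm (b r 0) \<le> Cb"
    and Cc: "\<And>r. r \<in> {s..S} \<Longrightarrow> norm (c r 0) \<le> Cc"
    unfolding bounded_iff by (meson imageI)
  define A where "A = \<bar>Cb\<bar> + \<bar>Cc\<bar>"
  have A: "A \<ge> 0" "Cb \<le> A" "Cc \<le> A" by (auto simp: A_def)
  define C where "C = A + K"
  have grow: "\<bar>g x\<bar> \<le> C * (1 + norm x)"
    if g: "\<And>x y. norm (x - y) \<le> 1 \<Longrightarrow> \<bar>g x - g y\<bar> \<le> K * norm (x - y) powr \<alpha>"
      and g0: "\<bar>g 0\<bar> \<le> A" for g :: "real ^ 'n \<Rightarrow> real" and x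
  proof -
    have "\<bar>g x - g 0\<bar> \<le> K * (norm x + 1)" by (rule locally_holder_linear_growth[OF g]) (use K \<alpha> in auto)
    moreover have "0 \<le> A * norm x" using A by simp
    moreover have "C * (1 + norm x) = A + A * norm x + K * (norm x + 1)" by (simp add: C_def algebra_simps)
    ultimately show ?thesis using g0 by linarith
  qed
  show thesis
  proof (rule that[of C])
    show "C \<ge> 0" using K A by (simp add: C_def)
    show "\<bar>b r x $ i\<bar> \<le> C * (1 + norm x)" if "r \<in> {s..S}" for r x i
      by (rule grow[of "\<lambda>x. b r x $ i"], erule b_holder)
        (use Cb[OF that] component_le_norm_cart[of "b r 0" i] A in linarith)
    show "\<bar>c r x\<bar> \<le> C * (1 + norm x)" if "r \<in> {s..S}" for r x
      by (rule grow[of "c r"], erule c_holder) (use Cc[OF that] A in simp)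
  qed
qed

lemma u_continuous_in_time: "continuous_on {t. T \<le> ereal t} (\<lambda>t. u t x)"
proof -
  have "continuous_on {t. T \<le> ereal t} ((\<lambda>(t, x). u t x) \<circ> (\<lambda>t. (t, x)))"
    by (intro continuous_on_compose continuous_intros continuous_on_subset[OF cont])
      (auto simp: time_space_def)
  then show ?thesis by (simp add: o_def)
qed

lemmas grad_continuous_in_time = derivatives_continuous_in_parameter(1)
    [of "{t. T \<le> ereal t}" \<alpha> B0 B1 B2 H u, OF _ \<alpha> u_continuous_in_time, simplified, OF bounds]
  and hess_continuous_in_time = derivatives_continuous_in_parameter(2)
    [of "{t. T \<le> ereal t}" \<alpha> B0 B1 B2 H u, OF _ \<alpha> u_continuous_in_time, simplified, OF bounds]

lemma equation_integrable:
  assumes s: "T \<le> ereal s"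
  shows "integrable (lebesgue_on {s..t}) (\<lambda>r. f r x)"
    and "integrable (lebesgue_on {s..t}) (\<lambda>r. elliptic_op a b c r (u r) x)"
proof -
  let ?M = "lebesgue_on {s..t}"
  have sub: "{s..t} \<subseteq> {t. T \<le> ereal t}"
    by (auto intro: order_trans[OF s])
  interpret finite_measure ?M
    by (rule finite_measureI) (simp add: emeasure_restrict_space emeasure_lborel_Icc_eq)
  have slice: "(\<lambda>r. g r x) \<in> borel_measurable ?M"
    if "(\<lambda>(t, x). g t x) \<in> borel_measurable lebesgue"
      "\<And>t x y. norm (x - y) \<le> 1 \<Longrightarrow> \<bar>g t x - g t y\<bar> \<le> C * norm (x - y) powr \<alpha>"
    for g :: "real \<Rightarrow> real ^ 'n \<Rightarrow> real" and C
    by (intro measurable_restrict_space1 slice_measurable that(1))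
      (rule locally_holder_continuous[OF that(2) \<alpha>])
  have fm: "(\<lambda>r. f r x) \<in> borel_measurable ?M" by (rule slice[OF f_measurable f_holder])
  have am [measurable]: "(\<lambda>r. a r x $ i $ j) \<in> borel_measurable ?M" for i j
    by (rule slice[OF a_measurable a_holder])
  have bm [measurable]: "(\<lambda>r. b r x $ i) \<in> borel_measurable ?M" for i
    by (rule slice[OF b_measurable b_holder])
  have cm [measurable]: "(\<lambda>r. c r x) \<in> borel_measurable ?M"
    by (rule slice[OF c_measurable c_holder])
  have cont_m: "g \<in> borel_measurable ?M" if "continuous_on {t. T \<le> ereal t} g" for g :: "real \<Rightarrow> real"
    by (rule continuous_imp_measurable_on_sets_lebesgue[OF continuous_on_subset[OF that sub]]) simp
  have [measurable]: "(\<lambda>r. u r x) \<in> borel_measurable ?M" by (rule cont_m[OF u_continuous_in_time])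
  have [measurable]: "(\<lambda>r. grad (u r) x $ i) \<in> borel_measurable ?M" for i
    by (rule cont_m[OF grad_continuous_in_time])
  have [measurable]: "(\<lambda>r. hess (u r) x $ i $ j) \<in> borel_measurable ?M" for i j
    by (rule cont_m[OF hess_continuous_in_time])
  obtain C where C: "C \<ge> 0" "\<And>r x i. r \<in> {s..t} \<Longrightarrow> \<bar>b r x $ i\<bar> \<le> C * (1 + norm x)"
    "\<And>r x. r \<in> {s..t} \<Longrightarrow> \<bar>c r x\<bar> \<le> C * (1 + norm x)" using coefficient_growth[of s t] by blast
  let ?C = "C * (1 + norm x)"
  show "integrable ?M (\<lambda>r. f r x)"
  proof (rule integrable_const_bound[OF _ fm])
    show "AE r in ?M. norm (f r x) \<le> F\<^sub>0 * ?C"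
    proof (rule AE_I2)
      fix r assume "r \<in> space ?M"
      then have "c r x \<le> ?C" using C(3)[of r x] by auto
      then have "F\<^sub>0 * c r x \<le> F\<^sub>0 * ?C" by (intro mult_left_mono F0_nonneg)
      then show "norm (f r x) \<le> F\<^sub>0 * ?C" using f_bound[of r x] by simp
    qed
  qed
  show "integrable ?M (\<lambda>r. elliptic_op a b c r (u r) x)"
  proof (rule integrable_const_bound)
    show "(\<lambda>r. elliptic_op a b c r (u r) x) \<in> borel_measurable ?M"
      unfolding elliptic_op_def by measurable
    show "AE r in ?M. norm (elliptic_op a b c r (u r) x)
        \<le> (\<Sum>i\<in>(UNIV::'n set). \<Sum>j\<in>(UNIV::'n set). K * B2) + (\<Sum>i\<in>(UNIV::'n set). ?C * B1) + ?C * B0"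
    proof (rule AE_I2)
      fix r assume "r \<in> space ?M"
      then have r: "r \<in> {s..t}" by simp
      then have "T \<le> ereal r" using sub by auto
      note bd = C2_boundsD[OF bounds[OF this]]
      have "\<bar>\<Sum>i\<in>UNIV. \<Sum>j\<in>UNIV. a r x $ i $ j * hess (u r) x $ i $ j\<bar>
          \<le> (\<Sum>i\<in>(UNIV::'n set). \<Sum>j\<in>(UNIV::'n set). K * B2)"
        unfolding real_norm_def[symmetric]
      proof (intro sum_norm_le)
        fix i j
        show "norm (a r x $ i $ j * hess (u r) x $ i $ j) \<le> K * B2"
          unfolding real_norm_def abs_mult using K
          by (intro mult_mono a_entry order_trans[OF abs_component_le bd(4)]) auto
      qed
      moreover have "\<bar>\<Sum>i\<in>UNIV. b r x $ i * grad (u r) x $ i\<bar> \<le> (\<Sum>i\<in>(UNIV::'n set). ?C * B1)"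
        unfolding real_norm_def[symmetric]
      proof (intro sum_norm_le)
        fix i
        show "norm (b r x $ i * grad (u r) x $ i) \<le> ?C * B1"
          unfolding real_norm_def abs_mult using C(1)
          by (intro mult_mono C(2)[OF r] order_trans[OF component_le_norm_cart bd(3)]) auto
      qed
      moreover have "\<bar>c r x * u r x\<bar> \<le> ?C * B0"
        unfolding abs_mult using C(1) by (intro mult_mono C(3)[OF r] bd(2)) auto
      ultimately show "norm (elliptic_op a b c r (u r) x)
        \<le> (\<Sum>i\<in>(UNIV::'n set). \<Sum>j\<in>(UNIV::'n set). K * B2) + (\<Sum>i\<in>(UNIV::'n set). ?C * B1) + ?C * B0"
        unfolding elliptic_op_def real_norm_def by linarith
    qed
  qed
qed

lemma increment_eq_integral:
  assumes "T \<le> ereal s" "s < t"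
  shows "u t x - u s x = (LINT r|lebesgue_on {s..t}. f r x - elliptic_op a b c r (u r) x)"
proof -
  have "u t x - u s x = set_lebesgue_integral lebesgue {s..t} (\<lambda>r. f r x)
      - set_lebesgue_integral lebesgue {s..t} (\<lambda>r. elliptic_op a b c r (u r) x)"
    using solves assms unfolding solves_parabolic_def by blast
  also have "\<dots> = (LINT r|lebesgue_on {s..t}. f r x) - (LINT r|lebesgue_on {s..t}. elliptic_op a b c r (u r) x)"
    by (simp add: set_lebesgue_integral_def integral_restrict_space)
  also have "\<dots> = (LINT r|lebesgue_on {s..t}. f r x - elliptic_op a b c r (u r) x)"
    by (intro Bochner_Integration.integral_diff[symmetric] equation_integrable assms)
  finally show ?thesis .
qed

text \<open>The coefficients are only measurable in time, so \<open>u\<close> need not have a time derivative at a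
  given moment.  The substitute for the first order condition in time uses that the derivatives of
  \<open>u\<close> in space are continuous in time: the equation with \<open>u\<close> frozen at time \<open>t\<^sub>0\<close>, but with
  coefficients at all later times, controls the increments of \<open>u\<close> to the right of \<open>t\<^sub>0\<close>.\<close>

lemma right_increment_bound:
  fixes sg :: "'k \<Rightarrow> real" and y :: "'k \<Rightarrow> real ^ 'n"
  assumes t0: "T \<le> ereal t0" "t0 < S" and I: "finite I"
    and incr: "\<And>t. t \<in> {t0..S} \<Longrightarrow> (\<Sum>k\<in>I. sg k * (u t (y k) - u t0 (y k))) \<le> \<eta> * (t - t0)"
    and lower: "\<And>r. r \<in> {t0..S} \<Longrightarrow> \<mu> \<le> (\<Sum>k\<in>I. sg k * (f r (y k) - elliptic_op a b c r (u t0) (y k)))"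
  shows "\<mu> \<le> \<eta>"
proof (rule ccontr)
  assume "\<not> \<mu> \<le> \<eta>"
  define e where "e = (\<mu> - \<eta>) / 2"
  have e: "e > 0" using \<open>\<not> \<mu> \<le> \<eta>\<close> by (simp add: e_def)
  have after: "{t0..S} \<subseteq> {t. T \<le> ereal t}" by (auto intro: order_trans[OF t0(1)])
  obtain C where C: "C \<ge> 0" "\<And>r x i. r \<in> {t0..S} \<Longrightarrow> \<bar>b r x $ i\<bar> \<le> C * (1 + norm x)"
    "\<And>r x. r \<in> {t0..S} \<Longrightarrow> \<bar>c r x\<bar> \<le> C * (1 + norm x)" using coefficient_growth[of t0 S] by blast
  \<comment> \<open>\<open>\<psi> r x\<close> dominates the error made by freezing \<open>u\<close> at time \<open>t0\<close>; it is continuous in \<open>r\<close> although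
    the coefficients are not, since these enter only through their bounds.\<close>
  define \<psi> where "\<psi> = (\<lambda>r x. (\<Sum>i\<in>UNIV. \<Sum>j\<in>UNIV. K * \<bar>hess (u r) x $ i $ j - hess (u t0) x $ i $ j\<bar>)
      + (\<Sum>i\<in>UNIV. C * (1 + norm x) * \<bar>grad (u r) x $ i - grad (u t0) x $ i\<bar>)
      + C * (1 + norm x) * \<bar>u r x - u t0 x\<bar>)"
  have diff: "\<bar>elliptic_op a b c r (u r) x - elliptic_op a b c r (u t0) x\<bar> \<le> \<psi> r x" if r: "r \<in> {t0..S}" for r x
  proof -
    have "elliptic_op a b c r (u r) x - elliptic_op a b c r (u t0) x
      = (\<Sum>i\<in>UNIV. \<Sum>j\<in>UNIV. a r x $ i $ j * (hess (u r) x $ i $ j - hess (u t0) x $ i $ j))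
        + (\<Sum>i\<in>UNIV. b r x $ i * (grad (u r) x $ i - grad (u t0) x $ i)) - c r x * (u r x - u t0 x)"
      unfolding elliptic_op_def by (simp add: right_diff_distrib sum_subtractf)
    moreover have "\<bar>\<Sum>i\<in>UNIV. \<Sum>j\<in>UNIV. a r x $ i $ j * (hess (u r) x $ i $ j - hess (u t0) x $ i $ j)\<bar>
        \<le> (\<Sum>i\<in>UNIV. \<Sum>j\<in>UNIV. K * \<bar>hess (u r) x $ i $ j - hess (u t0) x $ i $ j\<bar>)"
      unfolding real_norm_def[symmetric]
      by (intro sum_norm_le) (simp add: abs_mult mult_right_mono a_entry)
    moreover have "\<bar>\<Sum>i\<in>UNIV. b r x $ i * (grad (u r) x $ i - grad (u t0) x $ i)\<bar>
        \<le> (\<Sum>i\<in>UNIV. C * (1 + norm x) * \<bar>grad (u r) x $ i - grad (u t0) x $ i\<bar>)"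
      unfolding real_norm_def[symmetric]
      by (intro sum_norm_le) (simp add: abs_mult mult_right_mono C(2)[OF r])
    moreover have "\<bar>c r x * (u r x - u t0 x)\<bar> \<le> C * (1 + norm x) * \<bar>u r x - u t0 x\<bar>"
      by (simp add: abs_mult mult_right_mono C(3)[OF r])
    ultimately show ?thesis unfolding \<psi>_def by linarith
  qed
  define \<Psi> where "\<Psi> = (\<lambda>r. \<Sum>k\<in>I. \<bar>sg k\<bar> * \<psi> r (y k))"
  have "continuous_on {t. T \<le> ereal t} \<Psi>"
    unfolding \<Psi>_def \<psi>_def
    by (intro continuous_intros u_continuous_in_time grad_continuous_in_time hess_continuous_in_time)
  then have "continuous_on {t0..S} \<Psi>" by (rule continuous_on_subset[OF _ after])
  moreover have "\<Psi> t0 = 0" by (simp add: \<Psi>_def \<psi>_def)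
  moreover have "t0 \<in> {t0..S}" using t0 by simp
  ultimately obtain d where d: "d > 0" "\<And>r. r \<in> {t0..S} \<Longrightarrow> dist r t0 < d \<Longrightarrow> dist (\<Psi> r) 0 < e"
    using e unfolding continuous_on_iff by metis
  define t where "t = min S (t0 + d / 2)"
  have t: "t0 < t" "t \<le> S" "t - t0 < d" using t0 d by (auto simp: t_def min_def)
  define L where "L = (\<lambda>r. \<Sum>k\<in>I. sg k * (f r (y k) - elliptic_op a b c r (u r) (y k)))"
  have L: "\<mu> - e \<le> L r" if r: "r \<in> {t0..t}" for r
  proof -
    have rS: "r \<in> {t0..S}" using r t by auto
    have "\<Psi> r < e" using d(2)[OF rS] r t by (auto simp: dist_real_def)
    have "(\<Sum>k\<in>I. sg k * (f r (y k) - elliptic_op a b c r (u t0) (y k))) - L r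
        = (\<Sum>k\<in>I. sg k * (elliptic_op a b c r (u r) (y k) - elliptic_op a b c r (u t0) (y k)))"
      unfolding L_def sum_subtractf[symmetric] by (simp add: algebra_simps)
    also have "\<dots> \<le> (\<Sum>k\<in>I. \<bar>sg k\<bar> * \<psi> r (y k))"
    proof (rule sum_mono)
      fix k
      have "sg k * (elliptic_op a b c r (u r) (y k) - elliptic_op a b c r (u t0) (y k))
          \<le> \<bar>sg k * (elliptic_op a b c r (u r) (y k) - elliptic_op a b c r (u t0) (y k))\<bar>" by (rule abs_ge_self)
      also have "\<dots> \<le> \<bar>sg k\<bar> * \<psi> r (y k)" unfolding abs_mult by (intro mult_left_mono diff rS) auto
      finally show "sg k * (elliptic_op a b c r (u r) (y k) - elliptic_op a b c r (u t0) (y k)) \<le> \<bar>sg k\<bar> * \<psi> r (y k)" .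
    qed
    finally show ?thesis using \<open>\<Psi> r < e\<close> lower[OF rS] by (simp add: \<Psi>_def)
  qed
  let ?M = "lebesgue_on {t0..t}"
  have int: "integrable ?M (\<lambda>r. f r x - elliptic_op a b c r (u r) x)" for x
    by (intro Bochner_Integration.integrable_diff equation_integrable t0)
  have meas: "measure ?M (space ?M) = t - t0" using t by (simp add: measure_restrict_space)
  interpret finite_measure ?M
    by (rule finite_measureI) (simp add: emeasure_restrict_space emeasure_lborel_Icc_eq)
  have const: "integrable ?M (\<lambda>r. \<mu> - e)" by (rule integrable_const)
  have "(\<mu> - e) * (t - t0) = (LINT r|?M. \<mu> - e)" using meas by simp
  also have "\<dots> \<le> (LINT r|?M. L r)"
    by (rule integral_mono[OF const]) (auto simp: L_def intro!: L[unfolded L_def] int)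
  also have "\<dots> = (\<Sum>k\<in>I. sg k * (u t (y k) - u t0 (y k)))"
    unfolding L_def increment_eq_integral[OF t0(1) t(1)]
    by (subst Bochner_Integration.integral_sum) (auto intro: int)
  also have "\<dots> \<le> \<eta> * (t - t0)" using incr t by simp
  finally have "\<mu> - e \<le> \<eta>" using t by simp
  then show False using e by (simp add: e_def field_simps)
qed

end

section \<open>Conditions at a penalised maximum\<close>

text \<open>Only derivatives along lines are needed at a maximum, and in this form the property passes from
  \<open>V\<close> to its differences without any computation of gradients and Hessians.\<close>

definition line_C2 :: "('a::real_vector \<Rightarrow> real) \<Rightarrow> ('a \<Rightarrow> 'a \<Rightarrow> real) \<Rightarrow> ('a \<Rightarrow> 'a \<Rightarrow> real) \<Rightarrow> bool" where
  "line_C2 V G Q \<longleftrightarrow>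
     (\<forall>y \<xi> \<tau>. ((\<lambda>\<tau>. V (y + \<tau> *\<^sub>R \<xi>)) has_real_derivative G \<xi> (y + \<tau> *\<^sub>R \<xi>)) (at \<tau>)) \<and>
     (\<forall>y \<xi> \<tau>. ((\<lambda>\<tau>. G \<xi> (y + \<tau> *\<^sub>R \<xi>)) has_real_derivative Q \<xi> (y + \<tau> *\<^sub>R \<xi>)) (at \<tau>))"

lemma line_C2D:
  assumes "line_C2 V G Q"
  shows "((\<lambda>\<tau>. V (y + \<tau> *\<^sub>R \<xi>)) has_real_derivative G \<xi> (y + \<tau> *\<^sub>R \<xi>)) (at \<tau>)"
    "((\<lambda>\<tau>. G \<xi> (y + \<tau> *\<^sub>R \<xi>)) has_real_derivative Q \<xi> (y + \<tau> *\<^sub>R \<xi>)) (at \<tau>)"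
  using assms unfolding line_C2_def by auto

lemma line_C2_twice_diff:
  "twice_diff v \<Longrightarrow> line_C2 v (\<lambda>\<xi> y. \<xi> \<bullet> grad v y) (\<lambda>\<xi> y. \<xi> \<bullet> (hess v y *v \<xi>))"
  unfolding line_C2_def using line_derivative line_derivative_grad by blast

lemma line_C2_cmult:
  "line_C2 V G Q \<Longrightarrow> line_C2 (\<lambda>x. r * V x) (\<lambda>\<xi> x. r * G \<xi> x) (\<lambda>\<xi> x. r * Q \<xi> x)"
  unfolding line_C2_def by (auto intro!: DERIV_cmult)

lemma line_C2_dif:
  assumes "line_C2 V G Q"
  shows "line_C2 (dif h V) (\<lambda>\<xi>. dif h (G \<xi>)) (\<lambda>\<xi>. dif h (Q \<xi>))"
proof -
  have shift: "y + \<tau> *\<^sub>R \<xi> + h = (y + h) + \<tau> *\<^sub>R \<xi>" "y + \<tau> *\<^sub>R \<xi> - h = (y - h) + \<tau> *\<^sub>R \<xi>"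
    for y \<xi> :: 'a and \<tau> by auto
  show ?thesis
    unfolding line_C2_def dif_def shift by (auto intro!: DERIV_diff line_C2D[OF assms])
qed

text \<open>The penalty confines maxima to a bounded region, yet its gradient decays like \<open>1 / norm x\<close> and so
  stays bounded after multiplication with a drift of linear growth.\<close>

definition penalty :: "'a::real_inner \<Rightarrow> real" where
  "penalty x = ln (1 + x \<bullet> x)"

lemma penalty_nonneg: "0 \<le> penalty x"
  by (simp add: penalty_def)

text \<open>Along a line through the maximum the penalty is the logarithm of a quadratic polynomial
  \<open>p \<ge> 1\<close>.\<close>

lemma penalised_max_conditions:
  fixes V :: "'a::real_inner \<Rightarrow> real"
  assumes V: "line_C2 V G Q" and \<epsilon>: "\<epsilon> > 0"
    and max: "\<And>x. V x - \<epsilon> * penalty x \<le> V x0 - \<epsilon> * penalty x0"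
  shows "G \<xi> x0 = \<epsilon> * (2 * (x0 \<bullet> \<xi>) / (1 + x0 \<bullet> x0))" "Q \<xi> x0 \<le> 2 * \<epsilon> * (\<xi> \<bullet> \<xi>)"
proof -
  define p where "p = (\<lambda>\<tau>. 1 + x0 \<bullet> x0 + 2 * (x0 \<bullet> \<xi>) * \<tau> + (\<xi> \<bullet> \<xi>) * \<tau>\<^sup>2)"
  define p' where "p' = (\<lambda>\<tau>. 2 * (x0 \<bullet> \<xi>) + 2 * (\<xi> \<bullet> \<xi>) * \<tau>)"
  have p: "1 + (x0 + \<tau> *\<^sub>R \<xi>) \<bullet> (x0 + \<tau> *\<^sub>R \<xi>) = p \<tau>" for \<tau>
    by (simp add: p_def inner_add_left inner_add_right inner_commute power2_eq_square algebra_simps)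
  have pos: "p \<tau> > 0" for \<tau> unfolding p[symmetric] by (simp add: add_pos_nonneg)
  have dp: "(p has_real_derivative p' \<tau>) (at \<tau>)" for \<tau>
    unfolding p_def p'_def by (auto intro!: derivative_eq_intros)
  have dp': "(p' has_real_derivative 2 * (\<xi> \<bullet> \<xi>)) (at \<tau>)" for \<tau>
    unfolding p'_def by (auto intro!: derivative_eq_intros)
  define \<phi> where "\<phi> = (\<lambda>\<tau>. V (x0 + \<tau> *\<^sub>R \<xi>) - \<epsilon> * ln (p \<tau>))"
  define \<phi>' where "\<phi>' = (\<lambda>\<tau>. G \<xi> (x0 + \<tau> *\<^sub>R \<xi>) - \<epsilon> * (p' \<tau> / p \<tau>))"
  define l where "l = Q \<xi> x0 - \<epsilon> * ((2 * (\<xi> \<bullet> \<xi>) * p 0 - p' 0 * p' 0) / (p 0 * p 0))"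
  have d1: "(\<phi> has_real_derivative \<phi>' \<tau>) (at \<tau>)" for \<tau>
    unfolding \<phi>_def \<phi>'_def using pos[of \<tau>]
    by (auto intro!: derivative_eq_intros line_C2D[OF V] dp simp: divide_inverse)
  have dq: "((\<lambda>\<tau>. p' \<tau> / p \<tau>) has_real_derivative (2 * (\<xi> \<bullet> \<xi>) * p 0 - p' 0 * p' 0) / (p 0 * p 0)) (at 0)"
    by (rule DERIV_divide[OF dp' dp]) (use pos[of 0] in simp)
  have d2: "(\<phi>' has_real_derivative l) (at 0)"
    unfolding \<phi>'_def l_def
    using DERIV_diff[OF line_C2D(2)[OF V, of \<xi> x0 0] DERIV_cmult[OF dq, of \<epsilon>]] by simp
  have "eventually (\<lambda>\<tau>. \<phi> \<tau> \<le> \<phi> 0) (at 0)"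
    using max[of "x0 + \<tau> *\<^sub>R \<xi>" for \<tau>] p[of 0] by (simp add: \<phi>_def penalty_def p)
  note test = second_derivative_test_max[OF zero_less_one d1 d2 this]
  show "G \<xi> x0 = \<epsilon> * (2 * (x0 \<bullet> \<xi>) / (1 + x0 \<bullet> x0))"
    using test(1) by (simp add: \<phi>'_def p_def p'_def)
  have p1: "p 0 \<ge> 1" by (simp add: p_def)
  have "(2 * (\<xi> \<bullet> \<xi>) * p 0 - p' 0 * p' 0) / (p 0 * p 0) \<le> (2 * (\<xi> \<bullet> \<xi>) * p 0) / (p 0 * p 0)"
    using p1 by (intro divide_right_mono) auto
  also have "\<dots> = 2 * (\<xi> \<bullet> \<xi>) / p 0" using p1 by simp
  also have "\<dots> \<le> 2 * (\<xi> \<bullet> \<xi>) / 1" using p1 by (intro divide_left_mono) auto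
  finally have "\<epsilon> * ((2 * (\<xi> \<bullet> \<xi>) * p 0 - p' 0 * p' 0) / (p 0 * p 0)) \<le> \<epsilon> * (2 * (\<xi> \<bullet> \<xi>))"
    using \<epsilon> by (intro mult_left_mono) auto
  then show "Q \<xi> x0 \<le> 2 * \<epsilon> * (\<xi> \<bullet> \<xi>)" using test(2) by (simp add: l_def)
qed

lemma penalised_drift_bound:
  fixes g w x :: "real ^ 'n"
  assumes g: "\<And>\<xi>. \<xi> \<bullet> g = \<epsilon> * (2 * (x \<bullet> \<xi>) / (1 + x \<bullet> x))" and \<epsilon>: "\<epsilon> \<ge> 0"
    and w: "\<And>i. \<bar>w $ i\<bar> \<le> C * (1 + norm x)" and C: "C \<ge> 0"
  shows "(\<Sum>i\<in>UNIV. w $ i * g $ i) \<le> \<epsilon> * (4 * real CARD('n) * C)"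
proof -
  have "x \<bullet> w \<le> norm x * norm w" by (rule norm_cauchy_schwarz)
  also have "\<dots> \<le> norm x * (real CARD('n) * (C * (1 + norm x)))"
    by (intro mult_left_mono norm_vector_le_entries w) auto
  also have "\<dots> = (real CARD('n) * C) * (norm x + norm x ^ 2)" by (simp add: power2_eq_square algebra_simps)
  also have "\<dots> \<le> (real CARD('n) * C) * (2 * (1 + norm x ^ 2))"
  proof (intro mult_left_mono)
    have arith: "2 * r \<le> q + 1 \<Longrightarrow> 0 \<le> q \<Longrightarrow> r + q \<le> 2 * (1 + q)" for r q :: real by simp
    have "0 \<le> (norm x - 1)\<^sup>2" by simp
    then have "2 * norm x \<le> norm x ^ 2 + 1" by (simp add: power2_diff)
    then show "norm x + norm x ^ 2 \<le> 2 * (1 + norm x ^ 2)"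
      using arith[of "norm x" "norm x ^ 2"] by simp
  qed (use C in auto)
  also have "norm x ^ 2 = x \<bullet> x" by (simp add: power2_norm_eq_inner)
  finally have "2 * (x \<bullet> w) \<le> (4 * real CARD('n) * C) * (1 + x \<bullet> x)" by (simp add: algebra_simps)
  moreover have "1 + x \<bullet> x > 0" by (simp add: add_pos_nonneg)
  ultimately have "2 * (x \<bullet> w) / (1 + x \<bullet> x) \<le> 4 * real CARD('n) * C" by (simp add: pos_divide_le_eq)
  then have "w \<bullet> g \<le> \<epsilon> * (4 * real CARD('n) * C)" unfolding g by (intro mult_left_mono \<epsilon>)
  then show ?thesis by (simp add: inner_vec_def)
qed

section \<open>The comparison principle\<close>

context parabolic_problem
begin

text \<open>The maximum principle for a signed sum \<open>U\<close> of translates of \<open>u\<close> and a comparison function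
  \<open>\<Phi>\<close> of the remaining variables \<open>h\<close>.  The hypothesis asks for the differential inequality only at
  maxima in \<open>(x, h)\<close> of the penalised difference, with \<open>u\<close> taken at the time \<open>t\<close> of the maximum and the
  coefficients at any time \<open>r\<close> of the interval.

  There are no data at the far end of the time interval.  Instead a linear term in time brings the
  difference below zero at the end \<open>S\<close> of a long interval.  Its slope \<open>\<eta>\<close> is small, whereas at a
  maximum with \<open>U - \<Phi> > 0\<close> the zeroth order term makes \<open>U - \<Phi>\<close> increase at least at the rate
  \<open>\<delta> (U - \<Phi>)\<close>, up to the penalty.\<close>

theorem comparison_principle:
  fixes I :: "'k set" and sg :: "'k \<Rightarrow> real" and off :: "'k \<Rightarrow> 'h::topological_space \<Rightarrow> real ^ 'n" and \<Phi> :: "'h \<Rightarrow> real"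
  defines "U \<equiv> \<lambda>t x h. \<Sum>k\<in>I. sg k * u t (x + off k h)"
  assumes I: "finite I" and Hc: "compact Hc"
    and off: "\<And>k. k \<in> I \<Longrightarrow> continuous_on Hc (off k)" and \<Phi>: "continuous_on Hc \<Phi>"
    and key: "\<And>s S. T \<le> ereal s \<Longrightarrow> s < S \<Longrightarrow> \<exists>C\<ge>0. \<forall>\<epsilon>>0. \<forall>t\<in>{s..S}. \<forall>r\<in>{s..S}. \<forall>x0. \<forall>h0\<in>Hc.
        0 < U t x0 h0 - \<Phi> h0 \<longrightarrow>
        (\<forall>x. \<forall>h\<in>Hc. U t x h - \<Phi> h - \<epsilon> * penalty x \<le> U t x0 h0 - \<Phi> h0 - \<epsilon> * penalty x0) \<longrightarrow>
        \<delta> * (U t x0 h0 - \<Phi> h0) - \<epsilon> * C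
          \<le> (\<Sum>k\<in>I. sg k * (f r (x0 + off k h0) - elliptic_op a b c r (u t) (x0 + off k h0)))"
    and s: "T \<le> ereal s" and h: "h \<in> Hc"
  shows "U s x h \<le> \<Phi> h"
proof (rule ccontr)
  assume contra: "\<not> ?thesis"
  define m where "m = U s x h - \<Phi> h"
  have m: "m > 0" using contra by (simp add: m_def)
  have "bounded (\<Phi> ` Hc)" by (intro compact_imp_bounded compact_continuous_image \<Phi> Hc)
  then obtain P where P: "\<And>h. h \<in> Hc \<Longrightarrow> \<bar>\<Phi> h\<bar> \<le> P" unfolding bounded_iff by (metis imageI real_norm_def)
  define B where "B = (\<Sum>k\<in>I. \<bar>sg k\<bar> * B0) + P"
  have UB: "U t x h - \<Phi> h \<le> B" if "T \<le> ereal t" "h \<in> Hc" for t x h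
  proof -
    have "U t x h \<le> (\<Sum>k\<in>I. \<bar>sg k\<bar> * B0)"
      unfolding U_def
    proof (rule sum_mono)
      fix k
      have "sg k * u t (x + off k h) \<le> \<bar>sg k\<bar> * \<bar>u t (x + off k h)\<bar>" by (metis abs_ge_self abs_mult)
      also have "\<dots> \<le> \<bar>sg k\<bar> * B0" by (intro mult_left_mono C2_boundsD(2)[OF bounds[OF that(1)]]) auto
      finally show "sg k * u t (x + off k h) \<le> \<bar>sg k\<bar> * B0" .
    qed
    then show ?thesis using P[OF that(2)] by (simp add: B_def)
  qed
  have mB: "m \<le> B" unfolding m_def by (rule UB[OF s h])
  \<comment> \<open>The interval is so long that the slope \<open>\<eta>\<close>, which takes the bound \<open>B\<close> down to \<open>0\<close>, is a quarter
    of the rate \<open>\<delta> * m\<close>; below, \<open>\<epsilon>\<close> is chosen so that the penalty costs at most another quarter.\<close>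
  define S where "S = s + 4 * B / (\<delta> * m)"
  have S: "s < S" using m mB \<delta> by (simp add: S_def)
  define \<eta> where "\<eta> = B / (S - s)"
  have \<eta>: "\<eta> = \<delta> * m / 4" "\<eta> > 0" using m mB \<delta> by (auto simp: \<eta>_def S_def)
  obtain C where C: "C \<ge> 0" and keyC: "\<And>\<epsilon> t r x0 h0. \<epsilon> > 0 \<Longrightarrow> t \<in> {s..S} \<Longrightarrow> r \<in> {s..S} \<Longrightarrow> h0 \<in> Hc \<Longrightarrow>
        0 < U t x0 h0 - \<Phi> h0 \<Longrightarrow>
        (\<And>x h. h \<in> Hc \<Longrightarrow> U t x h - \<Phi> h - \<epsilon> * penalty x \<le> U t x0 h0 - \<Phi> h0 - \<epsilon> * penalty x0) \<Longrightarrow>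
        \<delta> * (U t x0 h0 - \<Phi> h0) - \<epsilon> * C
          \<le> (\<Sum>k\<in>I. sg k * (f r (x0 + off k h0) - elliptic_op a b c r (u t) (x0 + off k h0)))"
  proof -
    obtain C where "C \<ge> 0" and C: "\<forall>\<epsilon>>0. \<forall>t\<in>{s..S}. \<forall>r\<in>{s..S}. \<forall>x0. \<forall>h0\<in>Hc.
        0 < U t x0 h0 - \<Phi> h0 \<longrightarrow>
        (\<forall>x. \<forall>h\<in>Hc. U t x h - \<Phi> h - \<epsilon> * penalty x \<le> U t x0 h0 - \<Phi> h0 - \<epsilon> * penalty x0) \<longrightarrow>
        \<delta> * (U t x0 h0 - \<Phi> h0) - \<epsilon> * C
          \<le> (\<Sum>k\<in>I. sg k * (f r (x0 + off k h0) - elliptic_op a b c r (u t) (x0 + off k h0)))"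
      using key[OF s S] by (elim exE conjE)
    show thesis
      by (rule that[of C], fact, rule C[rule_format]) assumption+
  qed
  define D where "D = C + \<delta> * penalty x + 1"
  have D: "D > 0" using C \<delta> penalty_nonneg[of x] by (simp add: D_def add_nonneg_pos)
  define \<epsilon> where "\<epsilon> = \<delta> * m / (4 * D)"
  have \<epsilon>: "\<epsilon> > 0" using D m \<delta> by (simp add: \<epsilon>_def)
  have \<epsilon>D: "\<epsilon> * C + \<delta> * (\<epsilon> * penalty x) + \<epsilon> = \<delta> * m / 4"
  proof -
    have "\<epsilon> * C + \<delta> * (\<epsilon> * penalty x) + \<epsilon> = \<epsilon> * D" by (simp add: D_def algebra_simps)
    then show ?thesis using D by (simp add: \<epsilon>_def)
  qed
  have "\<delta> * (\<epsilon> * penalty x) < \<delta> * m"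
  proof -
    have "\<delta> * (\<epsilon> * penalty x) \<le> \<delta> * m / 4 - \<epsilon>" using \<epsilon>D C \<epsilon> by (smt (verit) mult_nonneg_nonneg)
    then show ?thesis using \<epsilon> m \<delta> mult_pos_pos[OF \<delta> m] by linarith
  qed
  then have start: "m - \<epsilon> * penalty x > 0" using \<delta> by simp
  define R where "R = max (norm x) (exp (B / \<epsilon>))"
  have far: "B < \<epsilon> * penalty y" if "norm y \<ge> R" for y :: "real ^ 'n"
  proof -
    have R1: "exp (B / \<epsilon>) \<le> norm y" using that by (simp add: R_def)
    have "norm y < 1 + norm y ^ 2"
    proof -
      have "0 \<le> (norm y - 1)\<^sup>2" by simp
      then have "2 * norm y \<le> 1 + norm y ^ 2" by (simp add: power2_diff)
      then show ?thesis using zero_le_power2[of "norm y"] by linarith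
    qed
    then have "exp (B / \<epsilon>) < 1 + y \<bullet> y" using R1 by (simp add: power2_norm_eq_inner)
    moreover have "1 + y \<bullet> y > 0" by (simp add: add_pos_nonneg)
    ultimately have "B / \<epsilon> < penalty y" unfolding penalty_def by (metis exp_less_cancel_iff exp_ln)
    then show ?thesis using \<epsilon> by (simp add: divide_less_eq mult.commute)
  qed
  define w where "w = (\<lambda>t x h. U t x h - \<Phi> h - \<epsilon> * penalty x - \<eta> * (t - s))"
  let ?K = "{s..S} \<times> cball (0::real ^ 'n) R \<times> Hc"
  have after: "T \<le> ereal t" if "t \<in> {s..S}" for t using that by (auto intro: order_trans[OF s])
  have contw: "continuous_on ?K (\<lambda>z. w (fst z) (fst (snd z)) (snd (snd z)))"
  proof -
    have "continuous_on ?K (\<lambda>z. u (fst z) (fst (snd z) + off k (snd (snd z))))" if "k \<in> I" for k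
    proof -
      have o: "continuous_on ?K (\<lambda>z. off k (snd (snd z)))"
        by (rule continuous_on_compose2[OF off[OF that]]) (auto intro!: continuous_intros)
      have "continuous_on ?K (\<lambda>z. (\<lambda>(t, x). u t x) (fst z, fst (snd z) + off k (snd (snd z))))"
        by (rule continuous_on_compose2[OF cont]) (auto intro!: continuous_intros o after simp: time_space_def)
      then show ?thesis by simp
    qed
    moreover have "continuous_on ?K (\<lambda>z. \<Phi> (snd (snd z)))"
      by (rule continuous_on_compose2[OF \<Phi>]) (auto intro!: continuous_intros)
    moreover have "continuous_on ?K (\<lambda>z. penalty (fst (snd z)))"
    proof -
      have "1 + y \<bullet> y \<noteq> 0" for y :: "real ^ 'n"
        using inner_ge_zero[of y] by linarith
      then show ?thesis unfolding penalty_def by (intro continuous_intros) auto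
    qed
    ultimately show ?thesis unfolding w_def U_def by (intro continuous_intros)
  qed
  have K0: "(s, x, h) \<in> ?K" using S h by (simp add: R_def)
  have "compact ?K" by (intro compact_Times Hc compact_Icc compact_cball)
  from continuous_attains_sup[OF this _ contw] K0 obtain z where z: "z \<in> ?K"
    and zmax: "\<And>z'. z' \<in> ?K \<Longrightarrow> w (fst z') (fst (snd z')) (snd (snd z')) \<le> w (fst z) (fst (snd z)) (snd (snd z))"
    by blast
  obtain t0 x0 h0 where z_eq: "z = (t0, x0, h0)" by (metis surj_pair)
  have t0: "t0 \<in> {s..S}" and h0: "h0 \<in> Hc" using z by (auto simp: z_eq)
  have wmax: "w t x' h' \<le> w t0 x0 h0" if "t \<in> {s..S}" "norm x' \<le> R" "h' \<in> Hc" for t x' h'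
    using zmax[of "(t, x', h')"] that by (simp add: z_eq)
  have "w s x h > 0" using start by (simp add: w_def m_def)
  then have wpos: "w t0 x0 h0 > 0" and wge: "w s x h \<le> w t0 x0 h0"
    using wmax[of s x h] S h by (auto simp: R_def)
  have "t0 \<noteq> S"
  proof
    assume "t0 = S"
    then have "\<eta> * (t0 - s) = B" using S by (simp add: \<eta>_def)
    then show False
      using wpos UB[OF after[OF t0] h0, of x0] \<epsilon> penalty_nonneg[of x0] by (smt (verit) w_def mult_nonneg_nonneg)
  qed
  then have t0S: "t0 < S" using t0 by auto
  have \<eta>t: "\<eta> * (t0 - s) \<ge> 0" using \<eta> t0 by simp
  have \<epsilon>x0: "\<epsilon> * penalty x0 \<ge> 0" using \<epsilon> penalty_nonneg[of x0] by simp
  have glob: "U t0 x' h' - \<Phi> h' - \<epsilon> * penalty x' \<le> U t0 x0 h0 - \<Phi> h0 - \<epsilon> * penalty x0" if "h' \<in> Hc" for x' h'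
  proof (cases "norm x' \<le> R")
    case True
    then show ?thesis using wmax[OF t0 True that] by (simp add: w_def)
  next
    case False
    then have "B < \<epsilon> * penalty x'" by (intro far) simp
    then show ?thesis using UB[OF after[OF t0] that, of x'] wpos \<eta>t by (simp add: w_def)
  qed
  have val: "U t0 x0 h0 - \<Phi> h0 \<ge> m - \<epsilon> * penalty x"
    using wge \<eta>t \<epsilon>x0 by (simp add: w_def m_def)
  have "\<delta> * (U t0 x0 h0 - \<Phi> h0) - \<epsilon> * C \<le> \<eta>"
  proof (rule right_increment_bound[where sg = sg and y = "\<lambda>k. x0 + off k h0", OF after[OF t0] t0S I])
    fix t assume t: "t \<in> {t0..S}"
    then have ts: "t \<in> {s..S}" using t0 by auto
    have "w t x0 h0 \<le> w t0 x0 h0" by (rule wmax[OF ts _ h0]) (use z in \<open>simp add: z_eq\<close>)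
    then have "U t x0 h0 - U t0 x0 h0 \<le> \<eta> * (t - t0)" by (simp add: w_def algebra_simps)
    then show "(\<Sum>k\<in>I. sg k * (u t (x0 + off k h0) - u t0 (x0 + off k h0))) \<le> \<eta> * (t - t0)"
      by (simp add: U_def right_diff_distrib sum_subtractf)
  next
    fix r assume "r \<in> {t0..S}"
    then have "r \<in> {s..S}" using t0 by auto
    then show "\<delta> * (U t0 x0 h0 - \<Phi> h0) - \<epsilon> * C
          \<le> (\<Sum>k\<in>I. sg k * (f r (x0 + off k h0) - elliptic_op a b c r (u t0) (x0 + off k h0)))"
      by (rule keyC[OF \<epsilon> t0 _ h0 _ glob]) (use val start in auto)
  qed
  moreover have "\<delta> * (m - \<epsilon> * penalty x) \<le> \<delta> * (U t0 x0 h0 - \<Phi> h0)"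
    using val \<delta> by (intro mult_left_mono) auto
  ultimately have "\<delta> * m \<le> \<eta> + (\<epsilon> * C + \<delta> * (\<epsilon> * penalty x))" by (simp add: algebra_simps)
  then have "\<delta> * m \<le> \<delta> * m / 4 + \<delta> * m / 4" using \<epsilon>D \<eta>(1) \<epsilon> by linarith
  then show False using m \<delta> mult_pos_pos[OF \<delta> m] by linarith
qed

text \<open>The constant \<open>F\<^sub>0\<close> is a supersolution, because \<open>|f| \<le> F\<^sub>0 c\<close>.\<close>

theorem sup_bound:
  assumes s: "T \<le> ereal s"
  shows "\<bar>u s x\<bar> \<le> F\<^sub>0"
proof -
  have main: "\<sigma> * u s x \<le> F\<^sub>0" if \<sigma>: "\<sigma> = 1 \<or> \<sigma> = - 1" for \<sigma> :: real
  proof -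
    \<comment> \<open>One translate with sign \<open>\<sigma>\<close>; the variable \<open>h\<close> is a dummy that only takes the value \<open>0\<close>.\<close>
    have "(\<Sum>k\<in>{()}. \<sigma> * u s (x + 0)) \<le> F\<^sub>0"
    proof (rule comparison_principle[where sg = "\<lambda>_. \<sigma>" and I = "{()}" and off = "\<lambda>_ _. 0" and Hc = "{0::real}"
          and \<Phi> = "\<lambda>_. F\<^sub>0" and h = 0])
      fix s S assume sS: "T \<le> ereal s" "s < S"
      obtain C where C: "C \<ge> 0" "\<And>r x i. r \<in> {s..S} \<Longrightarrow> \<bar>b r x $ i\<bar> \<le> C * (1 + norm x)"
        by (rule coefficient_growth[of s S]) (rule that)
      let ?C = "2 * (real CARD('n) * K) + 4 * real CARD('n) * C"
      have "\<delta> * (\<sigma> * u t x0 - F\<^sub>0) - \<epsilon> * ?C \<le> \<sigma> * (f r x0 - elliptic_op a b c r (u t) x0)"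
        if \<epsilon>: "\<epsilon> > 0" and t: "t \<in> {s..S}" and r: "r \<in> {s..S}" and pos: "0 < \<sigma> * u t x0 - F\<^sub>0"
          and max: "\<forall>x. \<sigma> * u t x - F\<^sub>0 - \<epsilon> * penalty x \<le> \<sigma> * u t x0 - F\<^sub>0 - \<epsilon> * penalty x0" for \<epsilon> t r x0
      proof -
        have "T \<le> ereal t" using t by (auto intro: order_trans[OF sS(1)])
        note bd = C2_boundsD[OF bounds[OF this]]
        have max': "\<sigma> * u t x - \<epsilon> * penalty x \<le> \<sigma> * u t x0 - \<epsilon> * penalty x0" for x
          using max[rule_format, of x] by simp
        note cond = penalised_max_conditions[OF line_C2_cmult[OF line_C2_twice_diff[OF bd(1)]] \<epsilon>, of \<sigma>, OF max']
        let ?M = "\<sigma> *\<^sub>R hess (u t) x0" and ?g = "\<sigma> *\<^sub>R grad (u t) x0"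
        have "(\<Sum>i\<in>UNIV. \<Sum>j\<in>UNIV. a r x0 $ i $ j * ?M $ i $ j) \<le> (2 * \<epsilon>) * (real CARD('n) * K)"
        proof (rule trace_upper_bound[OF a_sym])
          show "0 \<le> \<xi> \<bullet> (a r x0 *v \<xi>)" for \<xi>
            using a_lower[of \<xi> r x0] \<delta> by (smt (verit) inner_ge_zero mult_nonneg_nonneg)
          show "\<xi> \<bullet> (?M *v \<xi>) \<le> 2 * \<epsilon> * (\<xi> \<bullet> \<xi>)" for \<xi>
            using cond(2)[of \<xi>] by (simp add: scaleR_matrix_vector_assoc[symmetric])
        qed (use \<epsilon> a_diagonal in auto)
        moreover have "(\<Sum>i\<in>UNIV. b r x0 $ i * ?g $ i) \<le> \<epsilon> * (4 * real CARD('n) * C)"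
        proof (rule penalised_drift_bound[OF _ _ _ C(1)])
          show "\<xi> \<bullet> ?g = \<epsilon> * (2 * (x0 \<bullet> \<xi>) / (1 + x0 \<bullet> x0))" for \<xi>
            using cond(1)[of \<xi>] by simp
        qed (use \<epsilon> C(2)[OF r] in auto)
        moreover have "\<sigma> * f r x0 \<ge> - (F\<^sub>0 * c r x0)" using f_bound[of r x0] \<sigma> by auto
        moreover have "\<delta> * (\<sigma> * u t x0 - F\<^sub>0) \<le> c r x0 * (\<sigma> * u t x0 - F\<^sub>0)"
          using pos by (intro mult_right_mono c_lower) auto
        moreover have "\<sigma> * elliptic_op a b c r (u t) x0 =
            (\<Sum>i\<in>UNIV. \<Sum>j\<in>UNIV. a r x0 $ i $ j * ?M $ i $ j) + (\<Sum>i\<in>UNIV. b r x0 $ i * ?g $ i)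
             - c r x0 * (\<sigma> * u t x0)"
          by (simp add: elliptic_op_def algebra_simps sum_distrib_left)
        ultimately show ?thesis by (simp add: algebra_simps)
      qed
      then show "\<exists>C\<ge>0. \<forall>\<epsilon>>0. \<forall>t\<in>{s..S}. \<forall>r\<in>{s..S}. \<forall>x0. \<forall>h0\<in>{0::real}.
          0 < (\<Sum>k\<in>{()}. \<sigma> * u t (x0 + 0)) - F\<^sub>0 \<longrightarrow>
          (\<forall>x. \<forall>h\<in>{0::real}. (\<Sum>k\<in>{()}. \<sigma> * u t (x + 0)) - F\<^sub>0 - \<epsilon> * penalty x
              \<le> (\<Sum>k\<in>{()}. \<sigma> * u t (x0 + 0)) - F\<^sub>0 - \<epsilon> * penalty x0) \<longrightarrow>
          \<delta> * ((\<Sum>k\<in>{()}. \<sigma> * u t (x0 + 0)) - F\<^sub>0) - \<epsilon> * C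
            \<le> (\<Sum>k\<in>{()}. \<sigma> * (f r (x0 + 0) - elliptic_op a b c r (u t) (x0 + 0)))"
        using C(1) K by (intro exI[of _ ?C]) auto
    qed (use s in auto)
    then show ?thesis by simp
  qed
  show ?thesis using main[of 1] main[of "- 1"] by auto
qed

end

section \<open>Triple differences of solutions\<close>

lemma dif3_linear:
  "dif3 h k l (\<lambda>x. g x + g' x) x = dif3 h k l g x + dif3 h k l g' x"
  "dif3 h k l (\<lambda>x. g x - g' x) x = dif3 h k l g x - dif3 h k l g' x"
  "dif3 h k l (\<lambda>x. r * g x) x = r * dif3 h k l g x"
  "dif3 h k l (\<lambda>x. \<Sum>i\<in>I. G i x) x = (\<Sum>i\<in>I. dif3 h k l (G i) x)"
  by (simp_all add: dif_linear)

text \<open>With \<open>\<gamma> = (2 + \<alpha>) / 3\<close> the first term is homogeneous of degree \<open>2 + \<alpha>\<close> and concave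
  in each argument; it absorbs the right-hand side.  The second term serves the boundary of the
  range of steps: with \<open>N\<close> proportional to \<open>B2 / \<rho>\<close> it dominates the triple difference as soon as one
  argument reaches \<open>\<rho>\<close>, and being linear in each argument it does not enter second derivatives.\<close>

definition barrier :: "real \<Rightarrow> real \<Rightarrow> real \<Rightarrow> real \<Rightarrow> real \<Rightarrow> real \<Rightarrow> real" where
  "barrier \<gamma> M N r\<^sub>1 r\<^sub>2 r\<^sub>3 = M * (r\<^sub>1 powr \<gamma> * r\<^sub>2 powr \<gamma> * r\<^sub>3 powr \<gamma>) + N * (r\<^sub>1 * r\<^sub>2 * r\<^sub>3)"

lemma barrier_commute:
  "barrier \<gamma> M N r\<^sub>1 r\<^sub>2 r\<^sub>3 = barrier \<gamma> M N r\<^sub>2 r\<^sub>1 r\<^sub>3"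
  "barrier \<gamma> M N r\<^sub>1 r\<^sub>2 r\<^sub>3 = barrier \<gamma> M N r\<^sub>3 r\<^sub>2 r\<^sub>1"
  by (simp_all add: barrier_def mult_ac)

lemma barrier_nonneg:
  "M \<ge> 0 \<Longrightarrow> N \<ge> 0 \<Longrightarrow> r\<^sub>1 \<ge> 0 \<Longrightarrow> r\<^sub>2 \<ge> 0 \<Longrightarrow> r\<^sub>3 \<ge> 0 \<Longrightarrow> barrier \<gamma> M N r\<^sub>1 r\<^sub>2 r\<^sub>3 \<ge> 0"
  by (simp add: barrier_def)

text \<open>Changing the length of the step \<open>h\<close> moves the two points \<open>x + h\<close> and \<open>x - h\<close> in opposite directions.
  Second derivatives do not see this sign, so the second derivative in the length of the step is
  again a difference.\<close>

lemma second_derivative_in_step: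
  fixes \<psi> :: "'a::real_inner \<Rightarrow> real"
  assumes \<psi>: "line_C2 \<psi> G Q" and Q: "\<And>\<xi> y. Q (- \<xi>) y = Q \<xi> y" and h: "h \<noteq> 0"
    and max: "\<And>h'. norm h' \<le> \<rho> \<Longrightarrow>
      dif h' \<psi> x - barrier \<gamma> M N (norm h') r\<^sub>2 r\<^sub>3 \<le> dif h \<psi> x - barrier \<gamma> M N (norm h) r\<^sub>2 r\<^sub>3"
    and \<rho>: "norm h < \<rho>"
  shows "dif h (Q (h /\<^sub>R norm h)) x
    \<le> M * (\<gamma> * (\<gamma> - 1) * norm h powr (\<gamma> - 2) * (r\<^sub>2 powr \<gamma> * r\<^sub>3 powr \<gamma>))"
proof -
  define r where "r = norm h"
  have r: "r > 0" using h by (simp add: r_def)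
  define e where "e = h /\<^sub>R norm h"
  have ne: "norm e = 1" using h by (simp add: e_def)
  have he: "h + \<tau> *\<^sub>R e = (r + \<tau>) *\<^sub>R e" for \<tau>
  proof -
    have "h = r *\<^sub>R e" using h by (simp add: e_def r_def)
    then show ?thesis by (metis scaleR_add_left)
  qed
  define P where "P = M * (r\<^sub>2 powr \<gamma> * r\<^sub>3 powr \<gamma>)"
  define \<phi> where "\<phi> = (\<lambda>\<tau>. \<psi> ((x + h) + \<tau> *\<^sub>R e) - \<psi> ((x - h) + \<tau> *\<^sub>R (- e))
      - (P * (r + \<tau>) powr \<gamma> + N * r\<^sub>2 * r\<^sub>3 * (r + \<tau>)))"
  define \<phi>' where "\<phi>' = (\<lambda>\<tau>. G e ((x + h) + \<tau> *\<^sub>R e) - G (- e) ((x - h) + \<tau> *\<^sub>R (- e))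
      - (P * (\<gamma> * (r + \<tau>) powr (\<gamma> - 1)) + N * r\<^sub>2 * r\<^sub>3))"
  have pw: "((\<lambda>\<tau>. (r + \<tau>) powr p) has_real_derivative p * (r + \<tau>) powr (p - 1)) (at \<tau>)" if "\<bar>\<tau>\<bar> < r" for \<tau> p
    using that by (auto intro!: derivative_eq_intros simp: powr_diff)
  have d1: "(\<phi> has_real_derivative \<phi>' \<tau>) (at \<tau>)" if "\<bar>\<tau>\<bar> < r" for \<tau>
    unfolding \<phi>_def \<phi>'_def
    by (intro DERIV_diff DERIV_add DERIV_cmult line_C2D[OF \<psi>] pw that)
      (auto intro!: derivative_eq_intros)
  have d2: "(\<phi>' has_real_derivative (Q e (x + h) - Q (- e) (x - h)
      - (P * (\<gamma> * ((\<gamma> - 1) * r powr (\<gamma> - 2)))))) (at 0)"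
  proof -
    have "(\<phi>' has_real_derivative (Q e ((x + h) + 0 *\<^sub>R e) - Q (- e) ((x - h) + 0 *\<^sub>R (- e))
      - (P * (\<gamma> * ((\<gamma> - 1) * (r + 0) powr (\<gamma> - 1 - 1))) + 0))) (at 0)"
      unfolding \<phi>'_def
      by (intro DERIV_diff DERIV_add DERIV_cmult DERIV_const line_C2D[OF \<psi>] pw) (use r in auto)
    then show ?thesis by simp
  qed
  have \<phi>_eq: "\<phi> \<tau> = dif (h + \<tau> *\<^sub>R e) \<psi> x - barrier \<gamma> M N (norm (h + \<tau> *\<^sub>R e)) r\<^sub>2 r\<^sub>3" if "\<bar>\<tau>\<bar> < r" for \<tau>
  proof -
    have "norm (h + \<tau> *\<^sub>R e) = r + \<tau>" unfolding he using that ne by simp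
    then show ?thesis by (simp add: \<phi>_def dif_def barrier_def P_def algebra_simps)
  qed
  have "eventually (\<lambda>\<tau>. \<phi> \<tau> \<le> \<phi> 0) (at 0)"
    unfolding eventually_at
  proof (intro exI[of _ "min r (\<rho> - r)"] conjI ballI impI)
    show "0 < min r (\<rho> - r)" using r \<rho> by (simp add: r_def)
    fix \<tau> :: real assume "\<tau> \<noteq> 0 \<and> dist \<tau> 0 < min r (\<rho> - r)"
    then have \<tau>: "\<bar>\<tau>\<bar> < r" "\<bar>\<tau>\<bar> < \<rho> - r" by (auto simp: dist_real_def)
    have "norm (h + \<tau> *\<^sub>R e) \<le> \<rho>" unfolding he using \<tau> ne by simp
    from max[OF this] show "\<phi> \<tau> \<le> \<phi> 0" using \<phi>_eq[OF \<tau>(1)] \<phi>_eq[of 0] r by simp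
  qed
  from second_derivative_test_max(2)[OF r d1 d2 this]
  have "dif h (Q e) x \<le> M * (\<gamma> * (\<gamma> - 1) * r powr (\<gamma> - 2) * (r\<^sub>2 powr \<gamma> * r\<^sub>3 powr \<gamma>))"
    by (simp add: Q dif_def P_def algebra_simps)
  then show ?thesis by (simp only: e_def r_def)
qed

text \<open>The exponents add up: \<open>(\<gamma> - 2) + \<gamma> + \<gamma> = \<alpha>\<close>.\<close>

lemma smallest_step_power:
  fixes r\<^sub>1 r\<^sub>2 r\<^sub>3 :: real
  assumes "0 < r\<^sub>1" "r\<^sub>1 \<le> r\<^sub>2" "r\<^sub>1 \<le> r\<^sub>3" and \<gamma>: "\<gamma> = (2 + \<alpha>) / 3" "0 < \<alpha>"
  shows "r\<^sub>1 powr \<alpha> \<le> r\<^sub>1 powr (\<gamma> - 2) * (r\<^sub>2 powr \<gamma> * r\<^sub>3 powr \<gamma>)"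
proof -
  have "r\<^sub>1 powr \<alpha> = r\<^sub>1 powr (\<gamma> - 2) * (r\<^sub>1 powr \<gamma> * r\<^sub>1 powr \<gamma>)"
  proof -
    have "\<alpha> = (\<gamma> - 2) + (\<gamma> + \<gamma>)" using \<gamma> by simp
    then show ?thesis by (simp only: powr_add)
  qed
  also have "\<dots> \<le> r\<^sub>1 powr (\<gamma> - 2) * (r\<^sub>2 powr \<gamma> * r\<^sub>3 powr \<gamma>)"
    using assms by (intro mult_left_mono mult_mono powr_mono2) auto
  finally show ?thesis .
qed

lemma product_difference_bound:
  fixes p p' q q' :: real
  assumes "\<bar>p - p'\<bar> \<le> A" "\<bar>q\<bar> \<le> B" "\<bar>p'\<bar> \<le> C" "\<bar>q - q'\<bar> \<le> D"
  shows "\<bar>p * q - p' * q'\<bar> \<le> A * B + C * D"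
proof -
  have "p * q - p' * q' = (p - p') * q + p' * (q - q')" by (simp add: algebra_simps)
  also have "\<bar>\<dots>\<bar> \<le> \<bar>p - p'\<bar> * \<bar>q\<bar> + \<bar>p'\<bar> * \<bar>q - q'\<bar>"
    using abs_triangle_ineq by (metis abs_mult)
  also have "\<dots> \<le> A * B + C * D" using assms by (intro add_mono mult_mono) auto
  finally show ?thesis .
qed

context parabolic_problem
begin

text \<open>The right-hand side that remains when the coefficients at time \<open>r\<close> are frozen at \<open>x0\<close> and applied
  to \<open>u\<close> at time \<open>t\<close>.\<close>

definition frozen_rhs :: "real \<Rightarrow> real \<Rightarrow> real ^ 'n \<Rightarrow> real ^ 'n \<Rightarrow> real" where
  "frozen_rhs t r x0 y = f r y
     - (\<Sum>i\<in>UNIV. \<Sum>j\<in>UNIV. (a r y $ i $ j - a r x0 $ i $ j) * hess (u t) y $ i $ j)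
     - (\<Sum>i\<in>UNIV. (b r y $ i - b r x0 $ i) * grad (u t) y $ i)
     + (c r y - c r x0) * u t y"

text \<open>A Hoelder constant of \<open>frozen_rhs\<close> in the ball of radius \<open>3 \<rho>\<close> around \<open>x0\<close>.  The seminorm \<open>H\<close> of
  the Hessian carries the small factor \<open>(3 \<rho>)\<^sup>\<alpha>\<close>, since there it is multiplied with the
  oscillation of the leading coefficients.\<close>

definition frozen_holder :: "real \<Rightarrow> real" where
  "frozen_holder \<rho> = F\<^sub>\<alpha> + real CARD('n) ^ 2 * (K * B2 + K * (3 * \<rho>) powr \<alpha> * H)
     + real CARD('n) * (K * B1 + K * (real CARD('n) ^ 2 * B2)) + (K * B0 + K * B1)"

lemma frozen_rhs_holder:
  assumes t: "T \<le> ereal t" and \<rho>: "0 < \<rho>" "\<rho> \<le> 1 / 3"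
    and y: "norm (y - x0) \<le> 3 * \<rho>" and y': "norm (y' - x0) \<le> 3 * \<rho>" and yy': "norm (y - y') \<le> 1"
  shows "\<bar>frozen_rhs t r x0 y - frozen_rhs t r x0 y'\<bar> \<le> frozen_holder \<rho> * norm (y - y') powr \<alpha>"
proof -
  note bd = C2_boundsD[OF bounds[OF t]] and nonneg = C2_bounds_nonneg[OF bounds[OF t]]
  let ?n = "norm (y - y') powr \<alpha>"
  have n1: "norm (y - y') \<le> ?n"
  proof -
    have "norm (y - y') powr 1 \<le> ?n" using yy' \<alpha>1 by (intro powr_mono') auto
    then show ?thesis by simp
  qed
  have y'1: "norm (y' - x0) \<le> 1" using y' \<rho> by simp
  have small: "norm (y' - x0) powr \<alpha> \<le> (3 * \<rho>) powr \<alpha>" using y' \<alpha> by (intro powr_mono2) auto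
  have one: "(3 * \<rho>) powr \<alpha> \<le> 1" using \<rho> \<alpha> by (intro powr_le1) auto
  have Ksmall: "K * norm (y' - x0) powr \<alpha> \<le> K * (3 * \<rho>) powr \<alpha>" "K * norm (y' - x0) powr \<alpha> \<le> K"
    using small one K by (auto intro: mult_left_mono)
  have hess: "\<bar>(\<Sum>i\<in>UNIV. \<Sum>j\<in>UNIV. (a r y $ i $ j - a r x0 $ i $ j) * hess (u t) y $ i $ j)
      - (\<Sum>i\<in>UNIV. \<Sum>j\<in>UNIV. (a r y' $ i $ j - a r x0 $ i $ j) * hess (u t) y' $ i $ j)\<bar>
      \<le> (\<Sum>i\<in>(UNIV::'n set). \<Sum>j\<in>(UNIV::'n set). (K * ?n) * B2 + (K * (3 * \<rho>) powr \<alpha>) * (H * ?n))"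
    unfolding sum_subtractf[symmetric] real_norm_def[symmetric]
  proof (intro sum_norm_le)
    fix i j
    show "norm ((a r y $ i $ j - a r x0 $ i $ j) * hess (u t) y $ i $ j
        - (a r y' $ i $ j - a r x0 $ i $ j) * hess (u t) y' $ i $ j)
      \<le> (K * ?n) * B2 + (K * (3 * \<rho>) powr \<alpha>) * (H * ?n)"
      unfolding real_norm_def
    proof (rule product_difference_bound)
      show "\<bar>a r y $ i $ j - a r x0 $ i $ j - (a r y' $ i $ j - a r x0 $ i $ j)\<bar> \<le> K * ?n"
        using a_holder[OF yy', of r i j] by simp
      show "\<bar>hess (u t) y $ i $ j\<bar> \<le> B2" by (rule order_trans[OF abs_component_le bd(4)])
      show "\<bar>a r y' $ i $ j - a r x0 $ i $ j\<bar> \<le> K * (3 * \<rho>) powr \<alpha>"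
        using a_holder[OF y'1, of r i j] Ksmall by linarith
      show "\<bar>hess (u t) y $ i $ j - hess (u t) y' $ i $ j\<bar> \<le> H * ?n"
        using abs_component_le[of "hess (u t) y - hess (u t) y'" i j] bd(5)[of y y'] by simp
    qed
  qed
  have grad: "\<bar>(\<Sum>i\<in>UNIV. (b r y $ i - b r x0 $ i) * grad (u t) y $ i)
      - (\<Sum>i\<in>UNIV. (b r y' $ i - b r x0 $ i) * grad (u t) y' $ i)\<bar>
      \<le> (\<Sum>i\<in>(UNIV::'n set). (K * ?n) * B1 + K * (real CARD('n) ^ 2 * B2 * ?n))"
    unfolding sum_subtractf[symmetric] real_norm_def[symmetric]
  proof (intro sum_norm_le)
    fix i
    show "norm ((b r y $ i - b r x0 $ i) * grad (u t) y $ i - (b r y' $ i - b r x0 $ i) * grad (u t) y' $ i)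
      \<le> (K * ?n) * B1 + K * (real CARD('n) ^ 2 * B2 * ?n)"
      unfolding real_norm_def
    proof (rule product_difference_bound)
      show "\<bar>b r y $ i - b r x0 $ i - (b r y' $ i - b r x0 $ i)\<bar> \<le> K * ?n"
        using b_holder[OF yy', of r i] by simp
      show "\<bar>grad (u t) y $ i\<bar> \<le> B1" by (rule order_trans[OF component_le_norm_cart bd(3)])
      show "\<bar>b r y' $ i - b r x0 $ i\<bar> \<le> K" using b_holder[OF y'1, of r i] Ksmall by linarith
      obtain \<theta> where "axis i 1 \<bullet> grad (u t) (y' + (y - y')) - axis i 1 \<bullet> grad (u t) y'
          = axis i 1 \<bullet> (hess (u t) (y' + \<theta> *\<^sub>R (y - y')) *v (y - y'))" (is "_ = _ \<bullet> (?h *v _)")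
        using mean_value_line_grad[OF bd(1)] by blast
      then have "\<bar>grad (u t) y $ i - grad (u t) y' $ i\<bar> = \<bar>axis i 1 \<bullet> (?h *v (y - y'))\<bar>"
        by (simp add: inner_axis')
      also have "\<dots> \<le> real CARD('n) ^ 2 * norm ?h * norm (axis i 1 :: real ^ 'n) * norm (y - y')"
        by (rule abs_bilinear_le)
      also have "\<dots> \<le> real CARD('n) ^ 2 * B2 * 1 * ?n"
        using bd(4) nonneg n1 by (intro mult_mono) auto
      finally show "\<bar>grad (u t) y $ i - grad (u t) y' $ i\<bar> \<le> real CARD('n) ^ 2 * B2 * ?n" by simp
    qed
  qed
  have zeroth: "\<bar>(c r y - c r x0) * u t y - (c r y' - c r x0) * u t y'\<bar> \<le> (K * ?n) * B0 + K * (B1 * ?n)"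
  proof (rule product_difference_bound)
    show "\<bar>c r y - c r x0 - (c r y' - c r x0)\<bar> \<le> K * ?n" using c_holder[OF yy', of r] by simp
    show "\<bar>c r y' - c r x0\<bar> \<le> K" using c_holder[OF y'1, of r] Ksmall by linarith
    obtain \<theta> where "u t (y' + (y - y')) - u t y' = (y - y') \<bullet> grad (u t) (y' + \<theta> *\<^sub>R (y - y'))" (is "_ = _ \<bullet> ?g")
      using mean_value_line[OF bd(1)] by blast
    then have "\<bar>u t y - u t y'\<bar> = \<bar>(y - y') \<bullet> ?g\<bar>" by simp
    also have "\<dots> \<le> norm (y - y') * norm ?g" by (rule Cauchy_Schwarz_ineq2)
    also have "\<dots> \<le> ?n * B1" using bd(3) n1 by (intro mult_mono) auto
    finally show "\<bar>u t y - u t y'\<bar> \<le> B1 * ?n" by (simp add: mult.commute)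
  qed (rule bd(2))
  have "\<bar>frozen_rhs t r x0 y - frozen_rhs t r x0 y'\<bar> \<le> F\<^sub>\<alpha> * ?n
     + (\<Sum>i\<in>(UNIV::'n set). \<Sum>j\<in>(UNIV::'n set). (K * ?n) * B2 + (K * (3 * \<rho>) powr \<alpha>) * (H * ?n))
     + (\<Sum>i\<in>(UNIV::'n set). (K * ?n) * B1 + K * (real CARD('n) ^ 2 * B2 * ?n))
     + ((K * ?n) * B0 + K * (B1 * ?n))"
    using f_holder[OF yy', of r] hess grad zeroth unfolding frozen_rhs_def by linarith
  also have "\<dots> = frozen_holder \<rho> * ?n"
    unfolding frozen_holder_def by (simp add: power2_eq_square algebra_simps)
  finally show ?thesis .
qed

lemma frozen_holder_nonneg: "T \<le> ereal t \<Longrightarrow> 0 \<le> frozen_holder \<rho>"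
  using C2_bounds_nonneg[OF bounds[of t]] F\<alpha>_nonneg K unfolding frozen_holder_def
  by (intro add_nonneg_nonneg mult_nonneg_nonneg) auto

text \<open>The heart of the matter.  At a maximum of the triple difference minus the barrier, the drift frozen
  at \<open>x0\<close> meets a gradient that vanishes up to the penalty, and the zeroth order term has the good sign.
  By ellipticity the diffusion matrix is \<open>\<delta> e e\<^sup>T\<close> plus a positive semidefinite matrix, where \<open>e\<close> is the
  direction of the smallest step \<open>h1\<close>.  The second derivative along \<open>e\<close> in \<open>x\<close> equals the one in the length
  of \<open>h1\<close>.  There the concavity of the barrier contributes at least \<open>norm h1\<close> to the power \<open>\<alpha>\<close>, up to a
  factor, and the triple difference of the frozen right-hand side at most that.\<close>

lemma operator_at_maximum_ordered:
  assumes t: "T \<le> ereal t" and \<rho>: "0 < \<rho>" "\<rho> \<le> 1 / 3" and \<gamma>: "\<gamma> = (2 + \<alpha>) / 3"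
    and M: "M \<ge> 0" "8 * frozen_holder \<rho> \<le> \<delta> * (M * (\<gamma> * (1 - \<gamma>)))" and N: "N \<ge> 0"
    and h: "h1 \<noteq> 0" "norm h1 \<le> norm h2" "norm h1 \<le> norm h3" "norm h1 < \<rho>" "norm h2 < \<rho>" "norm h3 < \<rho>"
    and \<epsilon>: "\<epsilon> > 0" and C: "C \<ge> 0" "\<And>x i. \<bar>b r x $ i\<bar> \<le> C * (1 + norm x)"
    and pos: "0 < dif3 h1 h2 h3 (u t) x0 - barrier \<gamma> M N (norm h1) (norm h2) (norm h3)"
    and maxx: "\<And>x. dif3 h1 h2 h3 (u t) x - \<epsilon> * penalty x \<le> dif3 h1 h2 h3 (u t) x0 - \<epsilon> * penalty x0"
    and maxh: "\<And>h'. norm h' \<le> \<rho> \<Longrightarrow>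
      dif3 h' h2 h3 (u t) x0 - barrier \<gamma> M N (norm h') (norm h2) (norm h3)
        \<le> dif3 h1 h2 h3 (u t) x0 - barrier \<gamma> M N (norm h1) (norm h2) (norm h3)"
  shows "\<delta> * (dif3 h1 h2 h3 (u t) x0 - barrier \<gamma> M N (norm h1) (norm h2) (norm h3))
      - \<epsilon> * (2 * (real CARD('n) * K) + 4 * real CARD('n) * C)
    \<le> dif3 h1 h2 h3 (\<lambda>y. f r y - elliptic_op a b c r (u t) y) x0"
proof -
  note bd = C2_boundsD[OF bounds[OF t]]
  define D where "D = (\<lambda>g. dif3 h1 h2 h3 g x0)"
  define \<Phi> where "\<Phi> = barrier \<gamma> M N (norm h1) (norm h2) (norm h3)"
  define MM :: "real ^ 'n ^ 'n" where "MM = (\<chi> i j. D (\<lambda>y. hess (u t) y $ i $ j))"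
  define g :: "real ^ 'n" where "g = (\<chi> i. D (\<lambda>y. grad (u t) y $ i))"
  have MM: "\<xi> \<bullet> (MM *v \<xi>) = D (\<lambda>y. \<xi> \<bullet> (hess (u t) y *v \<xi>))" for \<xi>
  proof -
    have "(\<lambda>y. \<xi> \<bullet> (hess (u t) y *v \<xi>)) = (\<lambda>y. \<Sum>i\<in>UNIV. \<Sum>j\<in>UNIV. (\<xi> $ i * \<xi> $ j) * hess (u t) y $ i $ j)"
      by (simp add: inner_vec_def matrix_vector_mult_def sum_distrib_left mult_ac)
    then show ?thesis
      by (simp add: D_def dif3_linear MM_def inner_vec_def matrix_vector_mult_def sum_distrib_left mult_ac)
  qed
  have g: "\<xi> \<bullet> g = D (\<lambda>y. \<xi> \<bullet> grad (u t) y)" for \<xi>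
    by (simp add: D_def dif3_linear g_def inner_vec_def)
  note line3 = line_C2_dif[OF line_C2_dif[OF line_C2_dif[OF line_C2_twice_diff[OF bd(1)]]], of h1 h2 h3]
  note line2 = line_C2_dif[OF line_C2_dif[OF line_C2_twice_diff[OF bd(1)]], of h2 h3]
  note condx = penalised_max_conditions[OF line3 \<epsilon> maxx]
  define e where "e = h1 /\<^sub>R norm h1"
  have ee: "e \<bullet> e = 1" using h(1) by (simp add: e_def dot_square_norm)
  have \<gamma>01: "0 < \<gamma>" "\<gamma> < 1" using \<gamma> \<alpha> \<alpha>1 by auto
  have concave: "e \<bullet> (MM *v e) \<le> - (M * (\<gamma> * (1 - \<gamma>)) * norm h1 powr \<alpha>)"
  proof -
    have Qneg: "dif h2 (dif h3 (\<lambda>y. (- \<xi>) \<bullet> (hess (u t) y *v (- \<xi>)))) y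
        = dif h2 (dif h3 (\<lambda>y. \<xi> \<bullet> (hess (u t) y *v \<xi>))) y" for \<xi> y
    proof -
      have "A *v (- \<xi>) = - (A *v \<xi>)" for A :: "real ^ 'n ^ 'n"
        using matrix_vector_mult_scaleR[of A "- 1" \<xi>] by simp
      then show ?thesis by simp
    qed
    have "e \<bullet> (MM *v e) \<le> M * (\<gamma> * (\<gamma> - 1) * norm h1 powr (\<gamma> - 2) * (norm h2 powr \<gamma> * norm h3 powr \<gamma>))"
      unfolding MM D_def e_def by (rule second_derivative_in_step[OF line2 Qneg h(1) maxh h(4)])
    also have "\<dots> = - (M * (\<gamma> * (1 - \<gamma>)) * (norm h1 powr (\<gamma> - 2) * (norm h2 powr \<gamma> * norm h3 powr \<gamma>)))"
      by (simp add: algebra_simps)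
    also have "\<dots> \<le> - (M * (\<gamma> * (1 - \<gamma>)) * norm h1 powr \<alpha>)"
      unfolding neg_le_iff_le using \<gamma>01 M h by (intro mult_left_mono smallest_step_power \<gamma> \<alpha>) auto
    finally show ?thesis .
  qed
  have diffusion: "(\<Sum>i\<in>UNIV. \<Sum>j\<in>UNIV. a r x0 $ i $ j * MM $ i $ j)
      \<le> 2 * \<epsilon> * (real CARD('n) * K) + \<delta> * (e \<bullet> (MM *v e))"
  proof -
    define A :: "real ^ 'n ^ 'n" where "A = (\<chi> i j. a r x0 $ i $ j - \<delta> * (e $ i * e $ j))"
    have quadA: "\<xi> \<bullet> (A *v \<xi>) = \<xi> \<bullet> (a r x0 *v \<xi>) - \<delta> * (e \<bullet> \<xi>)\<^sup>2" for \<xi>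
      by (simp add: A_def inner_vec_def matrix_vector_mult_def sum_distrib_left algebra_simps
          sum_subtractf power2_eq_square sum_product)
    have "(\<Sum>i\<in>UNIV. \<Sum>j\<in>UNIV. A $ i $ j * MM $ i $ j) \<le> 2 * \<epsilon> * (real CARD('n) * K)"
    proof (rule trace_upper_bound)
      show "transpose A = A"
        using a_sym[of r x0] by (simp add: A_def transpose_def vec_eq_iff mult.commute)
      show "0 \<le> \<xi> \<bullet> (A *v \<xi>)" for \<xi>
      proof -
        have "(e \<bullet> \<xi>)\<^sup>2 \<le> \<xi> \<bullet> \<xi>" using Cauchy_Schwarz_ineq[of e \<xi>] ee by simp
        then have "\<delta> * (e \<bullet> \<xi>)\<^sup>2 \<le> \<delta> * (\<xi> \<bullet> \<xi>)" using \<delta> by (intro mult_left_mono) auto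
        then show ?thesis using a_lower[of \<xi> r x0] unfolding quadA by linarith
      qed
      show "A $ i $ i \<le> K" for i
      proof -
        have "0 \<le> \<delta> * (e $ i * e $ i)" using \<delta> by simp
        then show ?thesis using a_diagonal(2)[of r x0 i] unfolding A_def vec_lambda_beta by linarith
      qed
      show "\<xi> \<bullet> (MM *v \<xi>) \<le> 2 * \<epsilon> * (\<xi> \<bullet> \<xi>)" for \<xi>
        unfolding MM D_def by (rule condx(2))
    qed (use \<epsilon> in simp)
    moreover have "(\<Sum>i\<in>UNIV. \<Sum>j\<in>UNIV. a r x0 $ i $ j * MM $ i $ j)
        = (\<Sum>i\<in>UNIV. \<Sum>j\<in>UNIV. A $ i $ j * MM $ i $ j) + \<delta> * (e \<bullet> (MM *v e))"
      by (simp add: A_def inner_vec_def matrix_vector_mult_def sum_distrib_left algebra_simps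
          sum_subtractf sum.distrib)
    ultimately show ?thesis by linarith
  qed
  have drift: "(\<Sum>i\<in>UNIV. b r x0 $ i * g $ i) \<le> \<epsilon> * (4 * real CARD('n) * C)"
    by (rule penalised_drift_bound[OF _ _ C(2) C(1)]) (use \<epsilon> condx(1) in \<open>auto simp: g D_def\<close>)
  have rest: "\<bar>D (frozen_rhs t r x0)\<bar> \<le> 8 * frozen_holder \<rho> * norm h1 powr \<alpha>"
  proof -
    have "\<bar>D (frozen_rhs t r x0)\<bar> \<le> 4 * (frozen_holder \<rho> * (2 * norm h1 powr \<alpha>))"
      unfolding D_def
    proof (rule dif3_abs_le)
      fix y assume y: "y \<in> {x0 + h2 + h3, x0 + h2 - h3, x0 - h2 + h3, x0 - h2 - h3}"
      have tri: "norm (p + q) \<le> norm p + norm q" "norm (p - q) \<le> norm p + norm q" for p q :: "real ^ 'n"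
        by (rule norm_triangle_ineq norm_triangle_ineq4)+
      have "y - x0 \<in> {h2 + h3, h2 - h3, - h2 + h3, - h2 - h3}" using y by auto
      then have "norm (y - x0) \<le> norm h2 + norm h3"
        using tri[of h2 h3] tri[of "- h2" h3] by (elim insertE emptyE) simp_all
      then have near: "norm ((y + h1) - x0) \<le> 3 * \<rho>" "norm ((y - h1) - x0) \<le> 3 * \<rho>"
        using tri[of "y - x0" h1] h by (auto simp: algebra_simps)
      have "(y + h1) - (y - h1) = 2 *\<^sub>R h1" by (simp add: scaleR_2)
      then have dist: "norm ((y + h1) - (y - h1)) = 2 * norm h1" by simp
      have "\<bar>frozen_rhs t r x0 (y + h1) - frozen_rhs t r x0 (y - h1)\<bar>
          \<le> frozen_holder \<rho> * norm ((y + h1) - (y - h1)) powr \<alpha>"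
        by (rule frozen_rhs_holder[OF t \<rho> near]) (use dist h \<rho> in simp)
      also have "\<dots> \<le> frozen_holder \<rho> * (2 * norm h1 powr \<alpha>)"
      proof (rule mult_left_mono[OF _ frozen_holder_nonneg[OF t]])
        have "2 powr \<alpha> \<le> 2 powr 1" using \<alpha>1 by (intro powr_mono) auto
        then show "norm ((y + h1) - (y - h1)) powr \<alpha> \<le> 2 * norm h1 powr \<alpha>"
          unfolding dist by (simp add: powr_mult mult_right_mono)
      qed
      finally show "\<bar>frozen_rhs t r x0 (y + h1) - frozen_rhs t r x0 (y - h1)\<bar>
        \<le> frozen_holder \<rho> * (2 * norm h1 powr \<alpha>)" .
    qed
    then show ?thesis by simp
  qed
  have split: "D (\<lambda>y. f r y - elliptic_op a b c r (u t) y) = D (frozen_rhs t r x0)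
      - (\<Sum>i\<in>UNIV. \<Sum>j\<in>UNIV. a r x0 $ i $ j * MM $ i $ j) - (\<Sum>i\<in>UNIV. b r x0 $ i * g $ i)
      + c r x0 * D (u t)"
  proof -
    have "(\<lambda>y. f r y - elliptic_op a b c r (u t) y) = (\<lambda>y. frozen_rhs t r x0 y
        - (\<Sum>i\<in>UNIV. \<Sum>j\<in>UNIV. a r x0 $ i $ j * hess (u t) y $ i $ j)
        - (\<Sum>i\<in>UNIV. b r x0 $ i * grad (u t) y $ i) + c r x0 * u t y)"
      by (simp add: elliptic_op_def frozen_rhs_def algebra_simps sum_subtractf)
    then show ?thesis by (simp add: D_def dif3_linear MM_def g_def)
  qed
  have \<Phi>0: "0 \<le> \<Phi>" unfolding \<Phi>_def by (intro barrier_nonneg M N) auto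
  have "\<delta> * (D (u t) - \<Phi>) \<le> c r x0 * (D (u t) - \<Phi>)"
    using pos by (intro mult_right_mono c_lower) (auto simp: D_def \<Phi>_def)
  also have "\<dots> \<le> c r x0 * D (u t)" using \<Phi>0 c_pos[of r x0] by (intro mult_left_mono) auto
  finally have zeroth: "\<delta> * (D (u t) - \<Phi>) \<le> c r x0 * D (u t)" .
  have "8 * frozen_holder \<rho> * norm h1 powr \<alpha> \<le> \<delta> * (M * (\<gamma> * (1 - \<gamma>))) * norm h1 powr \<alpha>"
    by (intro mult_right_mono M) auto
  moreover have "\<delta> * (e \<bullet> (MM *v e)) \<le> \<delta> * (- (M * (\<gamma> * (1 - \<gamma>)) * norm h1 powr \<alpha>))"
    using \<delta> by (intro mult_left_mono concave) auto
  ultimately have "\<delta> * (e \<bullet> (MM *v e)) \<le> - (8 * frozen_holder \<rho> * norm h1 powr \<alpha>)"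
    by (simp add: mult.assoc)
  then have "\<delta> * (D (u t) - \<Phi>) - (2 * \<epsilon> * (real CARD('n) * K) + \<epsilon> * (4 * real CARD('n) * C))
      \<le> D (\<lambda>y. f r y - elliptic_op a b c r (u t) y)"
    unfolding split using zeroth rest diffusion drift by linarith
  then show ?thesis by (simp add: D_def \<Phi>_def algebra_simps)
qed

text \<open>Differences commute and the barrier is symmetric, so the smallest step may be taken to be the
  first.\<close>

lemma operator_at_maximum:
  assumes t: "T \<le> ereal t" and \<rho>: "0 < \<rho>" "\<rho> \<le> 1 / 3" and \<gamma>: "\<gamma> = (2 + \<alpha>) / 3"
    and M: "M \<ge> 0" "8 * frozen_holder \<rho> \<le> \<delta> * (M * (\<gamma> * (1 - \<gamma>)))" and N: "N \<ge> 0"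
    and h: "h1 \<noteq> 0" "h2 \<noteq> 0" "h3 \<noteq> 0" "norm h1 < \<rho>" "norm h2 < \<rho>" "norm h3 < \<rho>"
    and \<epsilon>: "\<epsilon> > 0" and C: "C \<ge> 0" "\<And>x i. \<bar>b r x $ i\<bar> \<le> C * (1 + norm x)"
    and pos: "0 < dif3 h1 h2 h3 (u t) x0 - barrier \<gamma> M N (norm h1) (norm h2) (norm h3)"
    and max: "\<And>x h1' h2' h3'. norm h1' \<le> \<rho> \<Longrightarrow> norm h2' \<le> \<rho> \<Longrightarrow> norm h3' \<le> \<rho> \<Longrightarrow>
      dif3 h1' h2' h3' (u t) x - barrier \<gamma> M N (norm h1') (norm h2') (norm h3') - \<epsilon> * penalty x
        \<le> dif3 h1 h2 h3 (u t) x0 - barrier \<gamma> M N (norm h1) (norm h2) (norm h3) - \<epsilon> * penalty x0"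
  shows "\<delta> * (dif3 h1 h2 h3 (u t) x0 - barrier \<gamma> M N (norm h1) (norm h2) (norm h3))
      - \<epsilon> * (2 * (real CARD('n) * K) + 4 * real CARD('n) * C)
    \<le> dif3 h1 h2 h3 (\<lambda>y. f r y - elliptic_op a b c r (u t) y) x0"
proof -
  have swap: "dif3 k1 k2 k3 g = dif3 k2 k1 k3 g" "dif3 k1 k2 k3 g = dif3 k3 k2 k1 g"
    for k1 k2 k3 :: "real ^ 'n" and g by (simp_all add: dif_commute)
  have maxx: "dif3 h1 h2 h3 (u t) x - \<epsilon> * penalty x \<le> dif3 h1 h2 h3 (u t) x0 - \<epsilon> * penalty x0" for x
    using max[of h1 h2 h3 x] h by simp
  note ordered = operator_at_maximum_ordered[OF t \<rho> \<gamma> M N]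
  consider "norm h1 \<le> norm h2" "norm h1 \<le> norm h3" | "norm h2 \<le> norm h1" "norm h2 \<le> norm h3"
    | "norm h3 \<le> norm h2" "norm h3 \<le> norm h1" by linarith
  then show ?thesis
  proof cases
    case 1
    show ?thesis
    proof (rule ordered[OF h(1) 1 h(4-6) \<epsilon> C pos maxx])
      fix h' :: "real ^ 'n" assume "norm h' \<le> \<rho>"
      then show "dif3 h' h2 h3 (u t) x0 - barrier \<gamma> M N (norm h') (norm h2) (norm h3)
        \<le> dif3 h1 h2 h3 (u t) x0 - barrier \<gamma> M N (norm h1) (norm h2) (norm h3)"
        using max[of h' h2 h3 x0] h by simp
    qed
  next
    case 2
    have "\<delta> * (dif3 h2 h1 h3 (u t) x0 - barrier \<gamma> M N (norm h2) (norm h1) (norm h3))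
      - \<epsilon> * (2 * (real CARD('n) * K) + 4 * real CARD('n) * C)
    \<le> dif3 h2 h1 h3 (\<lambda>y. f r y - elliptic_op a b c r (u t) y) x0"
    proof (rule ordered[OF h(2) 2 h(5,4,6) \<epsilon> C])
      show "0 < dif3 h2 h1 h3 (u t) x0 - barrier \<gamma> M N (norm h2) (norm h1) (norm h3)"
        using pos by (simp only: swap(1)[of h2 h1] barrier_commute(1)[of _ _ _ "norm h2" "norm h1"])
      show "dif3 h2 h1 h3 (u t) x - \<epsilon> * penalty x \<le> dif3 h2 h1 h3 (u t) x0 - \<epsilon> * penalty x0" for x
        using maxx[of x] by (simp only: swap(1)[of h2 h1])
      fix h' :: "real ^ 'n" assume "norm h' \<le> \<rho>"
      then have "dif3 h1 h' h3 (u t) x0 - barrier \<gamma> M N (norm h1) (norm h') (norm h3)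
        \<le> dif3 h1 h2 h3 (u t) x0 - barrier \<gamma> M N (norm h1) (norm h2) (norm h3)"
        using max[of h1 h' h3 x0] h by simp
      then show "dif3 h' h1 h3 (u t) x0 - barrier \<gamma> M N (norm h') (norm h1) (norm h3)
        \<le> dif3 h2 h1 h3 (u t) x0 - barrier \<gamma> M N (norm h2) (norm h1) (norm h3)"
        by (simp only: swap(1)[of h' h1] swap(1)[of h2 h1] barrier_commute(1)[of _ _ _ "norm h2" "norm h1"]
            barrier_commute(1)[of _ _ _ "norm h'" "norm h1"])
    qed
    then show ?thesis by (simp only: swap(1)[of h2 h1] barrier_commute(1)[of _ _ _ "norm h2" "norm h1"])
  next
    case 3
    have "\<delta> * (dif3 h3 h2 h1 (u t) x0 - barrier \<gamma> M N (norm h3) (norm h2) (norm h1))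
      - \<epsilon> * (2 * (real CARD('n) * K) + 4 * real CARD('n) * C)
    \<le> dif3 h3 h2 h1 (\<lambda>y. f r y - elliptic_op a b c r (u t) y) x0"
    proof (rule ordered[OF h(3) 3 h(6,5,4) \<epsilon> C])
      show "0 < dif3 h3 h2 h1 (u t) x0 - barrier \<gamma> M N (norm h3) (norm h2) (norm h1)"
        using pos by (simp only: swap(2)[of h3 h2 h1] barrier_commute(2)[of _ _ _ "norm h3" "norm h2" "norm h1"])
      show "dif3 h3 h2 h1 (u t) x - \<epsilon> * penalty x \<le> dif3 h3 h2 h1 (u t) x0 - \<epsilon> * penalty x0" for x
        using maxx[of x] by (simp only: swap(2)[of h3 h2 h1])
      fix h' :: "real ^ 'n" assume "norm h' \<le> \<rho>"
      then have "dif3 h1 h2 h' (u t) x0 - barrier \<gamma> M N (norm h1) (norm h2) (norm h')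
        \<le> dif3 h1 h2 h3 (u t) x0 - barrier \<gamma> M N (norm h1) (norm h2) (norm h3)"
        using max[of h1 h2 h' x0] h by simp
      then show "dif3 h' h2 h1 (u t) x0 - barrier \<gamma> M N (norm h') (norm h2) (norm h1)
        \<le> dif3 h3 h2 h1 (u t) x0 - barrier \<gamma> M N (norm h3) (norm h2) (norm h1)"
        by (simp only: swap(2)[of h' h2 h1] swap(2)[of h3 h2 h1]
            barrier_commute(2)[of _ _ _ "norm h3" "norm h2" "norm h1"]
            barrier_commute(2)[of _ _ _ "norm h'" "norm h2" "norm h1"])
    qed
    then show ?thesis
      by (simp only: swap(2)[of h3 h2 h1] barrier_commute(2)[of _ _ _ "norm h3" "norm h2" "norm h1"])
  qed
qed

end

definition pm_sign :: "bool \<Rightarrow> real" where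
  "pm_sign p = (if p then 1 else - 1)"

lemma dif3_eq_sum:
  fixes g :: "'a::real_vector \<Rightarrow> real"
  shows "(\<Sum>(p, q, r)\<in>UNIV. pm_sign p * pm_sign q * pm_sign r
      * g (x + (pm_sign p *\<^sub>R h1 + pm_sign q *\<^sub>R h2 + pm_sign r *\<^sub>R h3))) = dif3 h1 h2 h3 g x"
proof -
  have U: "(UNIV :: (bool \<times> bool \<times> bool) set) = {True, False} \<times> {True, False} \<times> {True, False}"
    by auto
  show ?thesis
    unfolding U sum.cartesian_product[symmetric]
    by (simp add: pm_sign_def dif_def algebra_simps)
qed

context parabolic_problem
begin

text \<open>At a maximum with a positive value all steps are non-zero, because the triple difference vanishes
  with each of them, and all are shorter than \<open>\<rho>\<close>, because of the second term of the barrier.  So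
  the conditions at an interior maximum apply.  With \<open>- h1\<close> for \<open>h1\<close> the bound also holds from
  below.\<close>

theorem triple_difference_bound:
  assumes s: "T \<le> ereal s" and \<rho>: "0 < \<rho>" "\<rho> \<le> 1 / 3" and \<gamma>: "\<gamma> = (2 + \<alpha>) / 3"
    and M: "M \<ge> 0" "8 * frozen_holder \<rho> \<le> \<delta> * (M * (\<gamma> * (1 - \<gamma>)))"
    and h: "norm h1 \<le> \<rho>" "norm h2 \<le> \<rho>" "norm h3 \<le> \<rho>"
  shows "dif3 h1 h2 h3 (u s) x \<le> barrier \<gamma> M (8 * real CARD('n) ^ 2 * B2 / \<rho>) (norm h1) (norm h2) (norm h3)"
proof -
  define N where "N = 8 * real CARD('n) ^ 2 * B2 / \<rho>"
  define sg :: "bool \<times> bool \<times> bool \<Rightarrow> real" where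
    "sg = (\<lambda>(p, q, r). pm_sign p * pm_sign q * pm_sign r)"
  define off :: "bool \<times> bool \<times> bool \<Rightarrow> (real ^ 'n) \<times> (real ^ 'n) \<times> (real ^ 'n) \<Rightarrow> real ^ 'n" where
    "off = (\<lambda>(p, q, r) h. pm_sign p *\<^sub>R fst h + pm_sign q *\<^sub>R fst (snd h) + pm_sign r *\<^sub>R snd (snd h))"
  define \<Phi> where "\<Phi> = (\<lambda>h :: (real ^ 'n) \<times> (real ^ 'n) \<times> (real ^ 'n).
    barrier \<gamma> M N (norm (fst h)) (norm (fst (snd h))) (norm (snd (snd h))))"
  let ?Hc = "cball (0 :: real ^ 'n) \<rho> \<times> cball (0 :: real ^ 'n) \<rho> \<times> cball (0 :: real ^ 'n) \<rho>"
  have sum: "(\<Sum>k\<in>UNIV. sg k * g (x + off k h)) = dif3 (fst h) (fst (snd h)) (snd (snd h)) g x" for g x h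
    unfolding dif3_eq_sum[symmetric] by (simp add: sg_def off_def case_prod_beta)
  have "\<gamma> > 0" using \<gamma> \<alpha> by simp
  have N: "N \<ge> 0" using C2_bounds_nonneg[OF bounds[OF s]] \<rho> by (simp add: N_def)
  have "(\<Sum>k\<in>UNIV. sg k * u s (x + off k (h1, h2, h3))) \<le> \<Phi> (h1, h2, h3)"
  proof (rule comparison_principle[where Hc = ?Hc])
    show "compact ?Hc" by (intro compact_Times compact_cball)
    show "continuous_on ?Hc (off k)" for k
      unfolding off_def case_prod_beta by (intro continuous_intros)
    show "continuous_on ?Hc \<Phi>"
      unfolding \<Phi>_def barrier_def
      by (intro continuous_intros continuous_on_powr') (use \<open>\<gamma> > 0\<close> in auto)
    fix s S assume sS: "T \<le> ereal s" "s < S"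
    obtain C where C: "C \<ge> 0" "\<And>r x i. r \<in> {s..S} \<Longrightarrow> \<bar>b r x $ i\<bar> \<le> C * (1 + norm x)"
      by (rule coefficient_growth[of s S]) (rule that)
    define C' where "C' = 2 * (real CARD('n) * K) + 4 * real CARD('n) * C"
    have C': "C' \<ge> 0" using C(1) K by (simp add: C'_def)
    have "\<delta> * (dif3 (fst h0) (fst (snd h0)) (snd (snd h0)) (u t) x0 - \<Phi> h0) - \<epsilon> * C'
        \<le> dif3 (fst h0) (fst (snd h0)) (snd (snd h0)) (\<lambda>y. f r y - elliptic_op a b c r (u t) y) x0"
      if \<epsilon>: "\<epsilon> > 0" and t: "t \<in> {s..S}" and r: "r \<in> {s..S}" and h0: "h0 \<in> ?Hc"
        and pos: "0 < dif3 (fst h0) (fst (snd h0)) (snd (snd h0)) (u t) x0 - \<Phi> h0"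
        and max: "\<forall>x. \<forall>h\<in>?Hc. dif3 (fst h) (fst (snd h)) (snd (snd h)) (u t) x - \<Phi> h - \<epsilon> * penalty x
          \<le> dif3 (fst h0) (fst (snd h0)) (snd (snd h0)) (u t) x0 - \<Phi> h0 - \<epsilon> * penalty x0"
      for \<epsilon> t r x0 h0
    proof -
      obtain k1 k2 k3 where k: "h0 = (k1, k2, k3)" by (metis surj_pair)
      have Tt: "T \<le> ereal t" using t by (auto intro: order_trans[OF sS(1)])
      note bd = C2_boundsD[OF bounds[OF Tt]]
      have le: "norm k1 \<le> \<rho>" "norm k2 \<le> \<rho>" "norm k3 \<le> \<rho>" using h0 by (auto simp: k)
      have pos': "0 < dif3 k1 k2 k3 (u t) x0 - barrier \<gamma> M N (norm k1) (norm k2) (norm k3)"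
        using pos by (simp add: k \<Phi>_def)
      have bar0: "0 \<le> barrier \<gamma> M N (norm k1) (norm k2) (norm k3)" by (intro barrier_nonneg M N) auto
      have ne: "k1 \<noteq> 0" "k2 \<noteq> 0" "k3 \<noteq> 0" using pos' bar0 by auto
      have edge: "norm l \<noteq> \<rho>" if "dif3 p q l (u t) x0 = dif3 k1 k2 k3 (u t) x0"
          "norm p * norm q * norm l = norm k1 * norm k2 * norm k3" for p q l
      proof
        assume l: "norm l = \<rho>"
        have "dif3 p q l (u t) x0 \<le> 8 * real CARD('n) ^ 2 * B2 * norm p * norm q"
          using dif3_quadratic_bound[OF bd(1) bd(4), of p q l x0] by linarith
        also have "\<dots> = N * (norm p * norm q * norm l)" using \<rho> by (simp add: N_def l)
        also have "\<dots> \<le> barrier \<gamma> M N (norm k1) (norm k2) (norm k3)"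
          unfolding barrier_def that(2) using M by simp
        finally show False using pos' that(1) by linarith
      qed
      have lt: "norm k1 < \<rho>" "norm k2 < \<rho>" "norm k3 < \<rho>"
        using le edge[of k2 k3 k1] edge[of k1 k3 k2] edge[of k1 k2 k3]
        by (auto simp: dif_commute mult_ac less_le)
      have "\<delta> * (dif3 k1 k2 k3 (u t) x0 - barrier \<gamma> M N (norm k1) (norm k2) (norm k3)) - \<epsilon> * C'
        \<le> dif3 k1 k2 k3 (\<lambda>y. f r y - elliptic_op a b c r (u t) y) x0"
        unfolding C'_def
      proof (rule operator_at_maximum[OF Tt \<rho> \<gamma> M N ne lt \<epsilon> C(1) C(2)[OF r] pos'])
        fix x and h1' h2' h3' :: "real ^ 'n"
        assume "norm h1' \<le> \<rho>" "norm h2' \<le> \<rho>" "norm h3' \<le> \<rho>"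
        then show "dif3 h1' h2' h3' (u t) x - barrier \<gamma> M N (norm h1') (norm h2') (norm h3') - \<epsilon> * penalty x
          \<le> dif3 k1 k2 k3 (u t) x0 - barrier \<gamma> M N (norm k1) (norm k2) (norm k3) - \<epsilon> * penalty x0"
          using max[rule_format, of "(h1', h2', h3')" x] by (simp add: k \<Phi>_def)
      qed
      then show ?thesis by (simp add: k \<Phi>_def)
    qed
    then show "\<exists>C\<ge>0. \<forall>\<epsilon>>0. \<forall>t\<in>{s..S}. \<forall>r\<in>{s..S}. \<forall>x0. \<forall>h0\<in>?Hc.
        0 < (\<Sum>k\<in>UNIV. sg k * u t (x0 + off k h0)) - \<Phi> h0 \<longrightarrow>
        (\<forall>x. \<forall>h\<in>?Hc. (\<Sum>k\<in>UNIV. sg k * u t (x + off k h)) - \<Phi> h - \<epsilon> * penalty x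
          \<le> (\<Sum>k\<in>UNIV. sg k * u t (x0 + off k h0)) - \<Phi> h0 - \<epsilon> * penalty x0) \<longrightarrow>
        \<delta> * ((\<Sum>k\<in>UNIV. sg k * u t (x0 + off k h0)) - \<Phi> h0) - \<epsilon> * C
          \<le> (\<Sum>k\<in>UNIV. sg k * (f r (x0 + off k h0) - elliptic_op a b c r (u t) (x0 + off k h0)))"
      unfolding sum[where g = "\<lambda>y. f r y - elliptic_op a b c r (u t) y" for r t] sum
      using C' by (intro exI[of _ C'] conjI allI ballI impI)
  qed (use s h in auto)
  then show ?thesis unfolding sum by (simp add: \<Phi>_def N_def)
qed

end

section \<open>From triple differences to Hoelder continuity of the Hessian\<close>

lemma telescoping_bound:
  fixes A :: "'a::real_vector \<Rightarrow> real"
  assumes "\<And>z. \<bar>A (z + w) - A z\<bar> \<le> B"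
  shows "\<bar>A (x + real m *\<^sub>R w) - A x\<bar> \<le> real m * B"
proof (induction m)
  case (Suc m)
  have "x + real (Suc m) *\<^sub>R w = (x + real m *\<^sub>R w) + w" by (simp add: scaleR_add_left)
  then have "\<bar>A (x + real (Suc m) *\<^sub>R w) - A (x + real m *\<^sub>R w)\<bar> \<le> B"
    using assms[of "x + real m *\<^sub>R w"] by (simp only:)
  then show ?case using Suc.IH by (simp add: algebra_simps)
qed simp

text \<open>A triple difference as the increment of a forward second difference.\<close>

lemma dif3_corner:
  "dif3 w p q v (z + w + p + q)
    = (v (z + (w + w) + (p + p) + (q + q)) - v (z + (w + w) + (p + p)) - v (z + (w + w) + (q + q)) + v (z + (w + w)))
      - (v (z + (p + p) + (q + q)) - v (z + (p + p)) - v (z + (q + q)) + v z)"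
  by (simp add: dif_def algebra_simps)

text \<open>The distance \<open>l\<close> from \<open>x\<close> to \<open>y\<close> is divided into \<open>m\<close> steps of length \<open>s\<close>.  Second difference quotients
  with step \<open>s\<close> change along each of them by a triple difference over \<open>s\<^sup>2\<close>, and they differ from the
  Hessian by \<open>H (2 s)\<^sup>\<alpha>\<close>, which for large \<open>m\<close> is a small multiple of \<open>H l\<^sup>\<alpha>\<close>.  Thus \<open>H\<close> reappears in the
  bound, but with a factor that can be absorbed.\<close>

lemma hess_holder_from_triple_differences:
  fixes v :: "real ^ 'n \<Rightarrow> real" and m :: nat
  assumes v: "C2_bounds \<alpha> B0 B1 B2 H v" and \<alpha>: "0 < \<alpha>" "\<alpha> < 1" and \<rho>: "\<rho> > 0" and m: "m \<ge> 1"
    and \<gamma>: "\<gamma> = (2 + \<alpha>) / 3" and M: "M \<ge> 0" "N \<ge> 0"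
    and d3: "\<And>h1 h2 h3 x. norm h1 \<le> \<rho> \<Longrightarrow> norm h2 \<le> \<rho> \<Longrightarrow> norm h3 \<le> \<rho> \<Longrightarrow>
      dif3 h1 h2 h3 v x \<le> barrier \<gamma> M N (norm h1) (norm h2) (norm h3)"
  shows "\<bar>hess v x $ i $ j - hess v y $ i $ j\<bar>
    \<le> (2 * (2 / real m) powr \<alpha> * H + real m * (M + N * \<rho> powr (1 - \<alpha>)) + 2 * B2 * \<rho> powr (- \<alpha>)) * norm (x - y) powr \<alpha>"
proof -
  note bd = C2_boundsD[OF v] and nonneg = C2_bounds_nonneg[OF v]
  let ?R = "M + N * \<rho> powr (1 - \<alpha>)"
  define l where "l = norm (x - y)"
  have terms: "0 \<le> 2 * (2 / real m) powr \<alpha> * H" "0 \<le> real m * ?R" "0 \<le> 2 * B2 * \<rho> powr (- \<alpha>)"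
    using nonneg M by auto
  have cases: "\<bar>hess v x $ i $ j - hess v y $ i $ j\<bar> \<le> C * l powr \<alpha> \<Longrightarrow>
      C \<le> 2 * (2 / real m) powr \<alpha> * H + real m * ?R + 2 * B2 * \<rho> powr (- \<alpha>) \<Longrightarrow> ?thesis" for C
    unfolding l_def by (erule order_trans) (intro mult_right_mono, auto)
  show ?thesis
  proof (cases "l \<ge> \<rho>")
    case True
    have "\<bar>hess v x $ i $ j - hess v y $ i $ j\<bar> \<le> 2 * B2"
      using order_trans[OF abs_component_le bd(4), of x i j] order_trans[OF abs_component_le bd(4), of y i j] by linarith
    also have "\<dots> \<le> 2 * B2 * (\<rho> powr (- \<alpha>) * l powr \<alpha>)"
    proof -
      have "\<rho> powr \<alpha> \<le> l powr \<alpha>" using True \<rho> \<alpha> by (intro powr_mono2) auto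
      then have "1 \<le> \<rho> powr (- \<alpha>) * l powr \<alpha>" using \<rho> by (simp add: powr_minus field_simps)
      then have "2 * B2 * 1 \<le> 2 * B2 * (\<rho> powr (- \<alpha>) * l powr \<alpha>)" using nonneg by (intro mult_left_mono) auto
      then show ?thesis by simp
    qed
    finally show ?thesis by (intro cases[of "2 * B2 * \<rho> powr (- \<alpha>)"]) (use terms in \<open>auto simp: mult.assoc\<close>)
  next
    case False
    show ?thesis
    proof (cases "x = y")
      case False
      then have l: "l > 0" by (simp add: l_def)
      define s where "s = l / real m"
      have s: "s > 0" "s \<le> l" using l m by (auto simp: s_def divide_le_eq mult_le_cancel_left1)
      define w where "w = (1 / real m) *\<^sub>R (y - x)"
      have w: "norm w = s" using m by (simp add: w_def s_def l_def norm_minus_commute)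
      have y: "y = x + real m *\<^sub>R w" using m by (simp add: w_def)
      let ?p = "(s / 2) *\<^sub>R axis i 1 :: real ^ 'n" and ?q = "(s / 2) *\<^sub>R axis j 1 :: real ^ 'n"
      define A where "A = (\<lambda>z. v (z + s *\<^sub>R axis i 1 + s *\<^sub>R axis j 1) - v (z + s *\<^sub>R axis i 1) - v (z + s *\<^sub>R axis j 1) + v z)"
      have twice: "(1/2) *\<^sub>R w + (1/2) *\<^sub>R w = w" "?p + ?p = s *\<^sub>R axis i 1" "?q + ?q = s *\<^sub>R axis j 1"
        by (simp_all add: scaleR_add_left[symmetric])
      have Adif: "A (z + w) - A z = dif3 ((1/2) *\<^sub>R w) ?p ?q v (z + (1/2) *\<^sub>R w + ?p + ?q)" for z
        using dif3_corner[of "(1/2) *\<^sub>R w" ?p ?q v z] unfolding twice A_def by simp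
      have step: "\<bar>A (z + w) - A z\<bar> \<le> s\<^sup>2 * (?R * l powr \<alpha>)" for z
      proof -
        have norms: "norm ((1/2) *\<^sub>R w) = s / 2" "norm ?p = s / 2" "norm ?q = s / 2" using s w by auto
        have le: "s / 2 \<le> \<rho>" using s \<open>\<not> \<rho> \<le> l\<close> by simp
        have "\<bar>dif3 ((1/2) *\<^sub>R w) ?p ?q v z'\<bar> \<le> barrier \<gamma> M N (s / 2) (s / 2) (s / 2)" for z'
          using d3[of "(1/2) *\<^sub>R w" ?p ?q z'] d3[of "- ((1/2) *\<^sub>R w)" ?p ?q z'] le
          unfolding norm_minus_cancel norms by (simp add: dif_uminus)
        then have "\<bar>A (z + w) - A z\<bar> \<le> barrier \<gamma> M N (s / 2) (s / 2) (s / 2)" unfolding Adif .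
        also have "\<dots> \<le> barrier \<gamma> M N s s s"
          unfolding barrier_def using s M \<gamma> \<alpha> by (intro add_mono mult_left_mono mult_mono powr_mono2) auto
        also have "\<dots> = M * s powr (2 + \<alpha>) + N * s ^ 3"
        proof -
          have "2 + \<alpha> = \<gamma> + \<gamma> + \<gamma>" using \<gamma> by simp
          then have "s powr \<gamma> * s powr \<gamma> * s powr \<gamma> = s powr (2 + \<alpha>)" by (simp only: powr_add)
          then show ?thesis by (simp add: barrier_def power3_eq_cube)
        qed
        also have "\<dots> = s\<^sup>2 * (M * s powr \<alpha> + N * (s powr (1 - \<alpha>) * s powr \<alpha>))"
        proof -
          have "s powr (2 + \<alpha>) = s\<^sup>2 * s powr \<alpha>" using s by (simp add: powr_add powr_numeral)
          moreover have "s powr (1 - \<alpha>) * s powr \<alpha> = s" using s by (simp add: powr_add[symmetric])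
          ultimately show ?thesis by (simp add: power3_eq_cube power2_eq_square algebra_simps)
        qed
        also have "\<dots> \<le> s\<^sup>2 * (M * l powr \<alpha> + N * (\<rho> powr (1 - \<alpha>) * l powr \<alpha>))"
          using s M \<alpha> \<open>\<not> \<rho> \<le> l\<close> by (intro mult_left_mono add_mono mult_mono powr_mono2) auto
        finally show ?thesis by (simp add: algebra_simps)
      qed
      have "\<bar>A y - A x\<bar> \<le> real m * (s\<^sup>2 * (?R * l powr \<alpha>))"
        unfolding y by (rule telescoping_bound[of A w, OF step])
      then have quot: "\<bar>A y / s\<^sup>2 - A x / s\<^sup>2\<bar> \<le> real m * (?R * l powr \<alpha>)"
        using s by (simp add: diff_divide_distrib[symmetric] divide_le_eq mult_ac)
      have err: "\<bar>A z / s\<^sup>2 - hess v z $ i $ j\<bar> \<le> H * ((2 / real m) powr \<alpha> * l powr \<alpha>)" for z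
      proof -
        have "(2 * s) powr \<alpha> = (2 / real m) powr \<alpha> * l powr \<alpha>"
          using l by (simp add: s_def powr_mult[symmetric])
        then show ?thesis
          using second_difference_quotient_error[OF v \<alpha>(1) s(1), of z i j] by (simp add: A_def)
      qed
      have "\<bar>hess v x $ i $ j - hess v y $ i $ j\<bar>
          \<le> 2 * (H * ((2 / real m) powr \<alpha> * l powr \<alpha>)) + real m * (?R * l powr \<alpha>)"
        using quot err[of x] err[of y] by linarith
      also have "\<dots> = (2 * (2 / real m) powr \<alpha> * H + real m * ?R) * l powr \<alpha>" by (simp add: algebra_simps)
      finally show ?thesis by (rule cases) (use terms in auto)
    qed simp
  qed
qed

section \<open>Interpolation\<close>

lemma grad_interpolation:
  fixes v :: "real ^ 'n \<Rightarrow> real"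
  assumes v: "C2_bounds \<alpha> B0 B1 B2 H v" and s: "s > 0"
  shows "norm (grad v x) \<le> real CARD('n) * (2 * B0 / s + real CARD('n) ^ 2 * B2 * s)"
proof (rule norm_vector_le_entries)
  fix i
  let ?q = "(v (x + s *\<^sub>R axis i 1) - v x) / s"
  have "\<bar>v (x + s *\<^sub>R axis i 1) - v x\<bar> \<le> 2 * B0"
    using C2_boundsD(2)[OF v, of "x + s *\<^sub>R axis i 1"] C2_boundsD(2)[OF v, of x] by linarith
  then have "\<bar>?q\<bar> \<le> 2 * B0 / s" using s by (simp add: abs_div_pos[symmetric] divide_right_mono)
  then show "\<bar>grad v x $ i\<bar> \<le> 2 * B0 / s + real CARD('n) ^ 2 * B2 * s"
    using difference_quotient_error[OF v s, of x i] by linarith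
qed

lemma hess_interpolation:
  fixes v :: "real ^ 'n \<Rightarrow> real"
  assumes v: "C2_bounds \<alpha> B0 B1 B2 H v" and \<alpha>: "\<alpha> > 0" and s: "s > 0"
  shows "norm (hess v x) \<le> real CARD('n) ^ 2 * (2 * B1 / s + H * s powr \<alpha>)"
proof (rule norm_matrix_le_entries)
  fix i j
  let ?e = "axis j 1 :: real ^ 'n"
  note bd = C2_boundsD[OF v]
  obtain \<theta> where \<theta>: "0 < \<theta>" "\<theta> < 1" "axis i 1 \<bullet> grad v (x + s *\<^sub>R ?e) - axis i 1 \<bullet> grad v x
      = axis i 1 \<bullet> (hess v (x + \<theta> *\<^sub>R (s *\<^sub>R ?e)) *v (s *\<^sub>R ?e))"
    using mean_value_line_grad[OF bd(1)] by blast
  let ?z = "x + \<theta> *\<^sub>R (s *\<^sub>R ?e)"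
  have "\<bar>hess v ?z $ i $ j - hess v x $ i $ j\<bar> \<le> norm (hess v ?z - hess v x)"
    using abs_component_le[of "hess v ?z - hess v x" i j] by simp
  also have "\<dots> \<le> H * norm (?z - x) powr \<alpha>" by (rule bd(5))
  also have "\<dots> \<le> H * s powr \<alpha>"
    using \<theta> s \<alpha> C2_bounds_nonneg(4)[OF v] by (intro mult_left_mono powr_mono2) (auto simp: mult_le_cancel_right1)
  finally have near: "\<bar>hess v ?z $ i $ j - hess v x $ i $ j\<bar> \<le> H * s powr \<alpha>" .
  have "s * hess v ?z $ i $ j = grad v (x + s *\<^sub>R ?e) $ i - grad v x $ i"
    using \<theta>(3) axis_quadratic_entry[of i "hess v ?z" j]
    by (simp only: matrix_vector_mult_scaleR inner_scaleR_right) (simp add: inner_axis')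
  then have "s * \<bar>hess v ?z $ i $ j\<bar> = \<bar>grad v (x + s *\<^sub>R ?e) $ i - grad v x $ i\<bar>"
    using s by (metis abs_mult abs_of_pos)
  also have "\<dots> \<le> 2 * B1"
    using order_trans[OF component_le_norm_cart bd(3), of "x + s *\<^sub>R ?e" i] order_trans[OF component_le_norm_cart bd(3), of x i]
    by linarith
  finally have "\<bar>hess v ?z $ i $ j\<bar> \<le> 2 * B1 / s" using s by (simp add: le_divide_eq mult.commute)
  then show "\<bar>hess v x $ i $ j\<bar> \<le> 2 * B1 / s + H * s powr \<alpha>" using near by linarith
qed

section \<open>Absorption\<close>

lemma small_power:
  fixes \<alpha> \<epsilon> :: real
  assumes "\<alpha> > 0" "\<epsilon> > 0"
  obtains s where "s > 0" "s \<le> 1" "s powr \<alpha> \<le> \<epsilon>"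
proof
  let ?s = "min 1 (\<epsilon> powr (1 / \<alpha>))"
  show "?s > 0" "?s \<le> 1" using assms by auto
  have "?s powr \<alpha> \<le> (\<epsilon> powr (1 / \<alpha>)) powr \<alpha>" using assms by (intro powr_mono2) auto
  then show "?s powr \<alpha> \<le> \<epsilon>" using assms by (simp add: powr_powr)
qed

text \<open>The improvement of a bound is iterated from an arbitrary finite one; the dependence on the latter
  disappears in the limit.\<close>

lemma absorb_half:
  fixes g w :: "'z \<Rightarrow> real"
  assumes step: "\<And>B. (\<And>z. z \<in> Z \<Longrightarrow> g z \<le> B * w z) \<Longrightarrow> (\<And>z. z \<in> Z \<Longrightarrow> g z \<le> (B / 2 + c) * w z)"
    and start: "\<And>z. z \<in> Z \<Longrightarrow> g z \<le> B * w z" and z: "z \<in> Z"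
  shows "g z \<le> 2 * c * w z"
proof -
  have iter: "\<forall>z\<in>Z. g z \<le> (2 * c + (B - 2 * c) * (1 / 2) ^ n) * w z" for n
  proof (induction n)
    case (Suc n)
    have "g z \<le> ((2 * c + (B - 2 * c) * (1 / 2) ^ n) / 2 + c) * w z" if "z \<in> Z" for z
      by (rule step[OF _ that]) (use Suc.IH in blast)
    moreover have "(2 * c + (B - 2 * c) * (1 / 2) ^ n) / 2 + c = 2 * c + (B - 2 * c) * (1 / 2) ^ Suc n" by simp
    ultimately show ?case by metis
  qed (use start in auto)
  have "(\<lambda>n. (2 * c + (B - 2 * c) * (1 / 2) ^ n) * w z) \<longlonglongrightarrow> (2 * c + (B - 2 * c) * 0) * w z"
    by (intro tendsto_intros LIMSEQ_power_zero) simp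
  then have "g z \<le> (2 * c + (B - 2 * c) * 0) * w z"
    by (rule LIMSEQ_le_const) (use iter z in blast)
  then show ?thesis by simp
qed

text \<open>Lets every result on the problem be used again with improved bounds for the same solution.\<close>

lemma (in parabolic_problem) change_bounds:
  assumes "\<And>t. T \<le> ereal t \<Longrightarrow> C2_bounds \<alpha> B0' B1' B2' H' (u t)"
  shows "parabolic_problem \<delta> K \<alpha> T a b c f F\<^sub>0 F\<^sub>\<alpha> u B0' B1' B2' H'"
  by unfold_locales (use \<delta> K \<alpha> \<alpha>1 coeff rhs cont assms solves in auto)

lemma (in parabolic_problem) hess_holder_step:
  assumes t: "T \<le> ereal t" and \<rho>: "0 < \<rho>" "\<rho> \<le> 1 / 3" and m: "m \<ge> (1::nat)" and \<gamma>: "\<gamma> = (2 + \<alpha>) / 3"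
  defines "\<kappa> \<equiv> \<delta> * (\<gamma> * (1 - \<gamma>)) / 8"
  shows "norm (hess (u t) x - hess (u t) y) \<le> real CARD('n) ^ 2 *
    (2 * (2 / real m) powr \<alpha> * H + real m * (frozen_holder \<rho> / \<kappa> + 8 * real CARD('n) ^ 2 * B2 * \<rho> powr (- \<alpha>))
      + 2 * B2 * \<rho> powr (- \<alpha>)) * norm (x - y) powr \<alpha>"
proof -
  have \<gamma>01: "0 < \<gamma>" "\<gamma> < 1" using \<gamma> \<alpha> \<alpha>1 by auto
  have \<kappa>: "\<kappa> > 0" using \<delta> \<gamma>01 by (simp add: \<kappa>_def)
  define M where "M = frozen_holder \<rho> / \<kappa>"
  define N where "N = 8 * real CARD('n) ^ 2 * B2 / \<rho>"
  note nonneg = C2_bounds_nonneg[OF bounds[OF t]]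
  have M: "M \<ge> 0" using frozen_holder_nonneg[OF t] \<kappa> by (simp add: M_def)
  have N: "N \<ge> 0" using nonneg \<rho> by (simp add: N_def)
  have "\<delta> * (M * (\<gamma> * (1 - \<gamma>))) = 8 * (M * \<kappa>)" by (simp add: \<kappa>_def)
  then have M': "8 * frozen_holder \<rho> \<le> \<delta> * (M * (\<gamma> * (1 - \<gamma>)))" using \<kappa> by (simp add: M_def)
  have N\<rho>: "N * \<rho> powr (1 - \<alpha>) = 8 * real CARD('n) ^ 2 * B2 * \<rho> powr (- \<alpha>)"
    using \<rho> by (simp add: N_def powr_diff powr_minus field_simps)
  let ?E = "2 * (2 / real m) powr \<alpha> * H + real m * (M + N * \<rho> powr (1 - \<alpha>)) + 2 * B2 * \<rho> powr (- \<alpha>)"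
  have "norm (hess (u t) x - hess (u t) y) \<le> real CARD('n) ^ 2 * (?E * norm (x - y) powr \<alpha>)"
  proof (rule norm_matrix_le_entries)
    fix i j
    have "\<bar>hess (u t) x $ i $ j - hess (u t) y $ i $ j\<bar> \<le> ?E * norm (x - y) powr \<alpha>"
    proof (rule hess_holder_from_triple_differences[OF bounds[OF t] \<alpha> \<alpha>1 \<rho>(1) m \<gamma> M N])
      fix h1 h2 h3 x :: "real ^ 'n"
      assume h: "norm h1 \<le> \<rho>" "norm h2 \<le> \<rho>" "norm h3 \<le> \<rho>"
      show "dif3 h1 h2 h3 (u t) x \<le> barrier \<gamma> M N (norm h1) (norm h2) (norm h3)"
        unfolding N_def by (rule triple_difference_bound[OF t \<rho> \<gamma> M M' h])
    qed
    then show "\<bar>(hess (u t) x - hess (u t) y) $ i $ j\<bar> \<le> ?E * norm (x - y) powr \<alpha>" by simp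
  qed
  then show ?thesis unfolding N\<rho> M_def by (simp add: mult.assoc)
qed

text \<open>First \<open>m\<close> and then \<open>\<rho>\<close> are chosen, so that each of the two terms with \<open>H\<close> gets a coefficient of at
  most \<open>1 / 4\<close>.  Both choices involve the structural constants only.\<close>

lemma hess_holder_absorb:
  fixes \<delta> K \<alpha> :: real
  assumes "0 < \<delta>" "0 < K" "0 < \<alpha>" "\<alpha> < 1"
  obtains C where "C \<ge> 0" "\<And>T a b c f F\<^sub>0 F\<^sub>\<alpha> (u :: real \<Rightarrow> real ^ 'n \<Rightarrow> real) B0 B1 B2 H t x y.
    parabolic_problem \<delta> K \<alpha> T a b c f F\<^sub>0 F\<^sub>\<alpha> u B0 B1 B2 H \<Longrightarrow> T \<le> ereal t \<Longrightarrow>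
    norm (hess (u t) x - hess (u t) y) \<le> (H / 2 + C * (F\<^sub>\<alpha> + B0 + B1 + B2)) * norm (x - y) powr \<alpha>"
proof -
  define \<gamma> where "\<gamma> = (2 + \<alpha>) / 3"
  have \<gamma>01: "0 < \<gamma>" "\<gamma> < 1" using assms by (auto simp: \<gamma>_def)
  define \<kappa> where "\<kappa> = \<delta> * (\<gamma> * (1 - \<gamma>)) / 8"
  have \<kappa>: "\<kappa> > 0" using assms \<gamma>01 by (simp add: \<kappa>_def)
  define d where "d = real CARD('n)"
  have d: "d \<ge> 1" by (simp add: d_def Suc_le_eq)
  obtain s where s: "s > 0" "s powr \<alpha> \<le> 1 / (8 * d ^ 2)"
    using small_power[of \<alpha> "1 / (8 * d ^ 2)"] assms d by auto
  obtain m :: nat where m: "2 / s \<le> real m" using real_arch_simple by blast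
  have "0 < 2 / s" using s by simp
  then have m1: "m \<ge> 1" using m by (metis le_less_trans not_less not_less_eq of_nat_0 less_one le_zero_eq One_nat_def linorder_not_le)
  have "2 / real m \<le> s" using m m1 s by (simp add: divide_le_eq mult.commute)
  then have "(2 / real m) powr \<alpha> \<le> s powr \<alpha>" using assms by (intro powr_mono2) auto
  then have fine: "(2 / real m) powr \<alpha> \<le> 1 / (8 * d ^ 2)" using s by linarith
  obtain q where q: "q > 0" "q \<le> 1" "q powr \<alpha> \<le> \<kappa> / (4 * d ^ 4 * real m * K)"
    using small_power[of \<alpha> "\<kappa> / (4 * d ^ 4 * real m * K)"] assms d m1 \<kappa> by auto
  define \<rho> where "\<rho> = q / 3"
  have \<rho>: "0 < \<rho>" "\<rho> \<le> 1 / 3" "3 * \<rho> = q" using q by (auto simp: \<rho>_def)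
  define R where "R = \<rho> powr (- \<alpha>)"
  have R: "R \<ge> 0" by (simp add: R_def)
  define L where "L = 1 + d ^ 2 * K + d * K + d ^ 3 * K + 2 * K"
  have L: "L \<ge> 0" using assms d by (simp add: L_def)
  define C where "C = d ^ 2 * (real m * (L / \<kappa> + 8 * d ^ 2 * R) + 2 * R)"
  show thesis
  proof (rule that[of C])
    show "C \<ge> 0" using d L R \<kappa> by (simp add: C_def)
    fix T a b c f F\<^sub>0 F\<^sub>\<alpha> and u :: "real \<Rightarrow> real ^ 'n \<Rightarrow> real" and B0 B1 B2 H t x y
    assume pp: "parabolic_problem \<delta> K \<alpha> T a b c f F\<^sub>0 F\<^sub>\<alpha> u B0 B1 B2 H" and t: "T \<le> ereal t"
    interpret parabolic_problem \<delta> K \<alpha> T a b c f F\<^sub>0 F\<^sub>\<alpha> u B0 B1 B2 H by fact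
    note nonneg = C2_bounds_nonneg[OF bounds[OF t]] F\<alpha>_nonneg
    define S where "S = F\<^sub>\<alpha> + B0 + B1 + B2"
    have S: "F\<^sub>\<alpha> \<le> S" "B0 \<le> S" "B1 \<le> S" "B2 \<le> S" "0 \<le> S" using nonneg by (auto simp: S_def)
    have frozen: "frozen_holder \<rho> \<le> d ^ 2 * K * q powr \<alpha> * H + L * S"
    proof -
      have "frozen_holder \<rho> = d ^ 2 * K * q powr \<alpha> * H
          + (F\<^sub>\<alpha> + d ^ 2 * K * B2 + d * K * B1 + d ^ 3 * K * B2 + K * B0 + K * B1)"
        unfolding frozen_holder_def d_def[symmetric] \<rho>(3)
        by (simp add: algebra_simps power2_eq_square power3_eq_cube)
      also have "F\<^sub>\<alpha> + d ^ 2 * K * B2 + d * K * B1 + d ^ 3 * K * B2 + K * B0 + K * B1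
          \<le> S + d ^ 2 * K * S + d * K * S + d ^ 3 * K * S + K * S + K * S"
        using S d assms by (intro add_mono mult_left_mono) auto
      also have "\<dots> = L * S" by (simp add: L_def algebra_simps)
      finally show ?thesis by simp
    qed
    have "real m * (frozen_holder \<rho> / \<kappa>) \<le> real m * ((d ^ 2 * K * q powr \<alpha> * H + L * S) / \<kappa>)"
      using frozen \<kappa> by (intro mult_left_mono divide_right_mono) auto
    also have "\<dots> = real m * (d ^ 2 * K / \<kappa> * H) * q powr \<alpha> + real m * (L / \<kappa>) * S"
      using \<kappa> by (simp add: field_simps)
    also have "real m * (d ^ 2 * K / \<kappa> * H) * q powr \<alpha> \<le> real m * (d ^ 2 * K / \<kappa> * H) * (\<kappa> / (4 * d ^ 4 * real m * K))"
      using q nonneg assms \<kappa> d by (intro mult_left_mono) auto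
    also have "\<dots> = H / (4 * d ^ 2)"
      using \<kappa> d m1 assms by (simp add: field_simps power2_eq_square power4_eq_xxxx)
    finally have main: "real m * (frozen_holder \<rho> / \<kappa>) \<le> H / (4 * d ^ 2) + real m * (L / \<kappa>) * S" by simp
    have first: "2 * (2 / real m) powr \<alpha> * H \<le> 2 * (1 / (8 * d ^ 2)) * H"
      using fine nonneg by (intro mult_right_mono mult_left_mono) auto
    have "norm (hess (u t) x - hess (u t) y) \<le> d ^ 2 * (2 * (2 / real m) powr \<alpha> * H
        + real m * (frozen_holder \<rho> / \<kappa> + 8 * d ^ 2 * B2 * R) + 2 * B2 * R) * norm (x - y) powr \<alpha>"
      using hess_holder_step[OF t \<rho>(1,2) m1 \<gamma>_def, of x y] by (simp only: \<kappa>_def d_def R_def)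
    also have "\<dots> \<le> (H / 2 + C * S) * norm (x - y) powr \<alpha>"
    proof (intro mult_right_mono)
      have "real m * (8 * d ^ 2 * B2 * R) \<le> real m * (8 * d ^ 2 * S * R)" "2 * B2 * R \<le> 2 * S * R"
        using S R d by (intro mult_left_mono mult_right_mono; simp)+
      then have "2 * (2 / real m) powr \<alpha> * H + real m * (frozen_holder \<rho> / \<kappa> + 8 * d ^ 2 * B2 * R) + 2 * B2 * R
        \<le> 2 * (1 / (8 * d ^ 2)) * H + (H / (4 * d ^ 2) + real m * (L / \<kappa>) * S + real m * (8 * d ^ 2 * S * R)) + 2 * S * R"
        unfolding distrib_left using main first by (intro add_mono) auto
      then have "d ^ 2 * (2 * (2 / real m) powr \<alpha> * H + real m * (frozen_holder \<rho> / \<kappa> + 8 * d ^ 2 * B2 * R) + 2 * B2 * R)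
        \<le> d ^ 2 * (2 * (1 / (8 * d ^ 2)) * H + (H / (4 * d ^ 2) + real m * (L / \<kappa>) * S + real m * (8 * d ^ 2 * S * R)) + 2 * S * R)"
        by (intro mult_left_mono) auto
      also have "\<dots> = d ^ 2 * (2 * (1 / (8 * d ^ 2)) * H) + d ^ 2 * (H / (4 * d ^ 2)) + C * S"
        by (simp add: C_def algebra_simps)
      also have "\<dots> = H / 2 + C * S" using d by (simp add: field_simps)
      finally show "d ^ 2 * (2 * (2 / real m) powr \<alpha> * H + real m * (frozen_holder \<rho> / \<kappa> + 8 * d ^ 2 * B2 * R) + 2 * B2 * R)
        \<le> H / 2 + C * S" .
    qed simp
    finally show "norm (hess (u t) x - hess (u t) y) \<le> (H / 2 + C * (F\<^sub>\<alpha> + B0 + B1 + B2)) * norm (x - y) powr \<alpha>"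
      by (simp add: S_def)
  qed
qed

text \<open>The four bounds are removed in turn, from the highest derivative down: \<open>H\<close> by the previous lemma,
  then \<open>B2\<close> and \<open>B1\<close> by interpolation between their neighbours, while \<open>B0\<close> is replaced by
  \<open>F\<^sub>0\<close>.  Each step may use the bounds obtained before it, since these hold for every admissible
  choice of the lower ones.\<close>

lemma absorbed_bounds:
  fixes \<delta> K \<alpha> :: real
  assumes \<delta>: "0 < \<delta>" and K: "0 < K" and \<alpha>: "0 < \<alpha>" "\<alpha> < 1"
  obtains C1 C2 C3 where "C1 \<ge> 0" "C2 \<ge> 0" "C3 \<ge> 0"
    "\<And>T a b c f F\<^sub>0 F\<^sub>\<alpha> (u :: real \<Rightarrow> real ^ 'n \<Rightarrow> real) B0 B1 B2 H t.
      parabolic_problem \<delta> K \<alpha> T a b c f F\<^sub>0 F\<^sub>\<alpha> u B0 B1 B2 H \<Longrightarrow> T \<le> ereal t \<Longrightarrow>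
      \<exists>B1 B2. B1 = 2 * C3 * (F\<^sub>\<alpha> + F\<^sub>0) \<and> B2 = 2 * C2 * (F\<^sub>\<alpha> + F\<^sub>0 + B1) \<and>
        C2_bounds \<alpha> F\<^sub>0 B1 B2 (2 * C1 * (F\<^sub>\<alpha> + F\<^sub>0 + B1 + B2)) (u t)"
proof -
  obtain C1 where C1: "C1 \<ge> 0" "\<And>T a b c f F\<^sub>0 F\<^sub>\<alpha> (u :: real \<Rightarrow> real ^ 'n \<Rightarrow> real) B0 B1 B2 H t x y.
    parabolic_problem \<delta> K \<alpha> T a b c f F\<^sub>0 F\<^sub>\<alpha> u B0 B1 B2 H \<Longrightarrow> T \<le> ereal t \<Longrightarrow>
    norm (hess (u t) x - hess (u t) y) \<le> (H / 2 + C1 * (F\<^sub>\<alpha> + B0 + B1 + B2)) * norm (x - y) powr \<alpha>"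
    by (rule hess_holder_absorb[OF assms]) (rule that)
  define d where "d = real CARD('n)"
  have d: "d \<ge> 1" by (simp add: d_def Suc_le_eq)
  obtain s2 where s2: "s2 > 0" "s2 powr \<alpha> \<le> 1 / (4 * d ^ 2 * (C1 + 1))"
    using small_power[of \<alpha> "1 / (4 * d ^ 2 * (C1 + 1))"] \<alpha> d C1(1) by auto
  define C2 where "C2 = 2 * d ^ 2 / s2 + 1 / 2"
  have C2: "C2 \<ge> 0" using s2 by (simp add: C2_def)
  define s3 where "s3 = 1 / (4 * d ^ 3 * (C2 + 1))"
  have s3: "s3 > 0" using d C2 by (simp add: s3_def)
  define C3 where "C3 = 2 * d / s3 + 1 / 2"
  have C3: "C3 \<ge> 0" using s3 d by (simp add: C3_def)
  have cancel: "p * (1 / (4 * p * q)) * (2 * r) = r / (2 * q)" if "p > 0" "q > 0" for p q r :: real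
    using that by (simp add: field_simps)
  have small2: "d ^ 2 * s2 powr \<alpha> * (2 * C1) \<le> 1 / 2"
  proof -
    have "d ^ 2 * s2 powr \<alpha> * (2 * C1) \<le> d ^ 2 * (1 / (4 * d ^ 2 * (C1 + 1))) * (2 * C1)"
      using s2 C1(1) by (intro mult_right_mono mult_left_mono) auto
    also have "\<dots> = C1 / (2 * (C1 + 1))" by (rule cancel) (use d C1(1) in auto)
    also have "\<dots> \<le> 1 / 2" using C1(1) by (simp add: field_simps)
    finally show ?thesis .
  qed
  have small3: "d ^ 3 * s3 * (2 * C2) \<le> 1 / 2"
  proof -
    have "d ^ 3 * s3 * (2 * C2) = C2 / (2 * (C2 + 1))"
      unfolding s3_def by (rule cancel) (use d C2 in auto)
    also have "\<dots> \<le> 1 / 2" using C2 by (simp add: field_simps)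
    finally show ?thesis .
  qed
  show thesis
  proof (rule that[OF C1(1) C2 C3])
    fix T a b c f F\<^sub>0 F\<^sub>\<alpha> and u :: "real \<Rightarrow> real ^ 'n \<Rightarrow> real" and B0 B1 B2 H t
    assume pp: "parabolic_problem \<delta> K \<alpha> T a b c f F\<^sub>0 F\<^sub>\<alpha> u B0 B1 B2 H" and Tt: "T \<le> ereal t"
    interpret parabolic_problem \<delta> K \<alpha> T a b c f F\<^sub>0 F\<^sub>\<alpha> u B0 B1 B2 H by fact
    define S where "S = F\<^sub>\<alpha> + F\<^sub>0"
    have S: "S \<ge> 0" "F\<^sub>0 \<le> S" using F0_nonneg F\<alpha>_nonneg by (auto simp: S_def)
    define valid where "valid B1 B2 H \<longleftrightarrow> (\<forall>t. T \<le> ereal t \<longrightarrow> C2_bounds \<alpha> F\<^sub>0 B1 B2 H (u t))" for B1 B2 H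
    have valid0: "valid B1 B2 H"
      unfolding valid_def using bounds sup_bound by (auto simp: C2_bounds_def)
    have holder: "valid B1 B2 (2 * C1 * (S + B1 + B2))" if v: "valid B1 B2 H" for B1 B2 H
    proof -
      have "(case z of (t, x, y) \<Rightarrow> norm (hess (u t) x - hess (u t) y))
          \<le> 2 * (C1 * (S + B1 + B2)) * (case z of (t, x, y) \<Rightarrow> norm (x - y) powr \<alpha>)"
        if "z \<in> {(t, x, y). T \<le> ereal t}" for z
      proof (rule absorb_half[OF _ _ that, where B = H])
        show "(case z of (t, x, y) \<Rightarrow> norm (hess (u t) x - hess (u t) y))
            \<le> H * (case z of (t, x, y) \<Rightarrow> norm (x - y) powr \<alpha>)" if "z \<in> {(t, x, y). T \<le> ereal t}" for z
          using v that by (auto simp: valid_def C2_bounds_def)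
        fix B and z :: "real \<times> (real ^ 'n) \<times> (real ^ 'n)"
        assume B: "\<And>z. z \<in> {(t, x, y). T \<le> ereal t} \<Longrightarrow> (case z of (t, x, y) \<Rightarrow> norm (hess (u t) x - hess (u t) y))
            \<le> B * (case z of (t, x, y) \<Rightarrow> norm (x - y) powr \<alpha>)"
          and z: "z \<in> {(t, x, y). T \<le> ereal t}"
        have "C2_bounds \<alpha> F\<^sub>0 B1 B2 B (u t)" if "T \<le> ereal t" for t
          using v that B[of "(t, x, y)" for x y] by (auto simp: valid_def C2_bounds_def)
        note C1(2)[OF change_bounds[OF this]]
        then show "(case z of (t, x, y) \<Rightarrow> norm (hess (u t) x - hess (u t) y))
            \<le> (B / 2 + C1 * (S + B1 + B2)) * (case z of (t, x, y) \<Rightarrow> norm (x - y) powr \<alpha>)"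
          using z by (auto simp: S_def)
      qed
      from this[of "(t, x, y)" for t x y] show ?thesis using v by (auto simp: valid_def C2_bounds_def mult.assoc)
    qed
    have hessian: "valid B1 (2 * C2 * (S + B1)) H" if v: "valid B1 B2 H" for B1 B2 H
    proof -
      have B1: "B1 \<ge> 0"
        using v Tt C2_bounds_nonneg(2)[of \<alpha> F\<^sub>0 B1 B2 H "u t"] by (simp add: valid_def)
      have "(case z of (t, x) \<Rightarrow> norm (hess (u t) x)) \<le> 2 * (C2 * (S + B1)) * 1"
        if "z \<in> {(t, x). T \<le> ereal t}" for z
      proof (rule absorb_half[OF _ _ that, where B = B2])
        show "(case z of (t, x) \<Rightarrow> norm (hess (u t) x)) \<le> B2 * 1" if "z \<in> {(t, x). T \<le> ereal t}" for z
          using v that by (auto simp: valid_def C2_bounds_def)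
        fix B and z :: "real \<times> (real ^ 'n)"
        assume B: "\<And>z. z \<in> {(t, x). T \<le> ereal t} \<Longrightarrow> (case z of (t, x) \<Rightarrow> norm (hess (u t) x)) \<le> B * 1"
          and z: "z \<in> {(t, x). T \<le> ereal t}"
        have "valid B1 B H"
          using v B[of "(t, x)" for t x] by (auto simp: valid_def C2_bounds_def)
        note vH = holder[OF this]
        obtain t x where tx: "z = (t, x)" "T \<le> ereal t" using z by auto
        from vH tx(2) have "C2_bounds \<alpha> F\<^sub>0 B1 B (2 * C1 * (S + B1 + B)) (u t)" by (simp add: valid_def)
        from hess_interpolation[OF this \<alpha>(1) s2(1)]
        have "norm (hess (u t) x) \<le> d ^ 2 * (2 * B1 / s2 + 2 * C1 * (S + B1 + B) * s2 powr \<alpha>)"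
          by (simp add: d_def)
        also have "\<dots> = 2 * d ^ 2 / s2 * B1 + d ^ 2 * s2 powr \<alpha> * (2 * C1) * (S + B1 + B)"
          by (simp add: algebra_simps)
        also have "\<dots> \<le> 2 * d ^ 2 / s2 * (S + B1) + 1 / 2 * (S + B1 + B)"
        proof (intro add_mono mult_left_mono mult_right_mono small2)
          show "0 \<le> S + B1 + B"
            using S B1 C2_bounds_nonneg(3)[OF \<open>C2_bounds \<alpha> F\<^sub>0 B1 B (2 * C1 * (S + B1 + B)) (u t)\<close>] by simp
        qed (use S s2 in auto)
        also have "\<dots> = B / 2 + C2 * (S + B1)" by (simp add: C2_def algebra_simps add_divide_distrib)
        finally show "(case z of (t, x) \<Rightarrow> norm (hess (u t) x)) \<le> (B / 2 + C2 * (S + B1)) * 1" by (simp add: tx)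
      qed
      from this[of "(t, x)" for t x] show ?thesis using v by (auto simp: valid_def C2_bounds_def mult.assoc)
    qed
    have gradient: "valid (2 * C3 * S) B2 H" if v: "valid B1 B2 H" for B1 B2 H
    proof -
      have "(case z of (t, x) \<Rightarrow> norm (grad (u t) x)) \<le> 2 * (C3 * S) * 1"
        if "z \<in> {(t, x). T \<le> ereal t}" for z
      proof (rule absorb_half[OF _ _ that, where B = B1])
        show "(case z of (t, x) \<Rightarrow> norm (grad (u t) x)) \<le> B1 * 1" if "z \<in> {(t, x). T \<le> ereal t}" for z
          using v that by (auto simp: valid_def C2_bounds_def)
        fix B and z :: "real \<times> (real ^ 'n)"
        assume B: "\<And>z. z \<in> {(t, x). T \<le> ereal t} \<Longrightarrow> (case z of (t, x) \<Rightarrow> norm (grad (u t) x)) \<le> B * 1"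
          and z: "z \<in> {(t, x). T \<le> ereal t}"
        have "valid B B2 H"
          using v B[of "(t, x)" for t x] by (auto simp: valid_def C2_bounds_def)
        note vH = hessian[OF this]
        obtain t x where tx: "z = (t, x)" "T \<le> ereal t" using z by auto
        from vH tx(2) have cb: "C2_bounds \<alpha> F\<^sub>0 B (2 * C2 * (S + B)) H (u t)" by (simp add: valid_def)
        from grad_interpolation[OF this s3]
        have "norm (grad (u t) x) \<le> d * (2 * F\<^sub>0 / s3 + d ^ 2 * (2 * C2 * (S + B)) * s3)"
          by (simp add: d_def)
        also have "\<dots> = 2 * d / s3 * F\<^sub>0 + d ^ 3 * s3 * (2 * C2) * (S + B)"
          by (simp add: algebra_simps power2_eq_square power3_eq_cube)
        also have "\<dots> \<le> 2 * d / s3 * S + 1 / 2 * (S + B)"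
          using S d s3 C2_bounds_nonneg(2)[OF cb] by (intro add_mono mult_left_mono mult_right_mono small3) auto
        also have "\<dots> = B / 2 + C3 * S" by (simp add: C3_def algebra_simps add_divide_distrib)
        finally show "(case z of (t, x) \<Rightarrow> norm (grad (u t) x)) \<le> (B / 2 + C3 * S) * 1" by (simp add: tx)
      qed
      from this[of "(t, x)" for t x] show ?thesis using v by (auto simp: valid_def C2_bounds_def mult.assoc)
    qed
    from holder[OF hessian[OF gradient[OF valid0]]] Tt
    show "\<exists>B1 B2. B1 = 2 * C3 * (F\<^sub>\<alpha> + F\<^sub>0) \<and> B2 = 2 * C2 * (F\<^sub>\<alpha> + F\<^sub>0 + B1) \<and>
        C2_bounds \<alpha> F\<^sub>0 B1 B2 (2 * C1 * (F\<^sub>\<alpha> + F\<^sub>0 + B1 + B2)) (u t)"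
      by (auto simp: valid_def S_def)
  qed
qed

section \<open>The Schauder estimate\<close>

theorem parabolic_problem_estimate:
  fixes \<delta> K \<alpha> :: real
  assumes "0 < \<delta>" "0 < K" "0 < \<alpha>" "\<alpha> < 1"
  obtains N where "\<And>T a b c f F\<^sub>0 F\<^sub>\<alpha> (u :: real \<Rightarrow> real ^ 'n \<Rightarrow> real) B0 B1 B2 H t.
    parabolic_problem \<delta> K \<alpha> T a b c f F\<^sub>0 F\<^sub>\<alpha> u B0 B1 B2 H \<Longrightarrow> T \<le> ereal t \<Longrightarrow>
    norm_2\<alpha> \<alpha> (u t) \<le> ereal (N * (F\<^sub>0 + F\<^sub>\<alpha>))"
proof -
  obtain C1 C2 C3 where C: "C1 \<ge> 0" "C2 \<ge> 0" "C3 \<ge> 0"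
    and est: "\<And>T a b c f F\<^sub>0 F\<^sub>\<alpha> (u :: real \<Rightarrow> real ^ 'n \<Rightarrow> real) B0 B1 B2 H t.
      parabolic_problem \<delta> K \<alpha> T a b c f F\<^sub>0 F\<^sub>\<alpha> u B0 B1 B2 H \<Longrightarrow> T \<le> ereal t \<Longrightarrow>
      \<exists>B1 B2. B1 = 2 * C3 * (F\<^sub>\<alpha> + F\<^sub>0) \<and> B2 = 2 * C2 * (F\<^sub>\<alpha> + F\<^sub>0 + B1) \<and>
        C2_bounds \<alpha> F\<^sub>0 B1 B2 (2 * C1 * (F\<^sub>\<alpha> + F\<^sub>0 + B1 + B2)) (u t)"
    by (rule absorbed_bounds[OF assms]) (rule that)
  define N1 where "N1 = 2 * C3"
  define N2 where "N2 = 2 * C2 * (1 + N1)"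
  define N where "N = 1 + N1 + N2 + 2 * C1 * (1 + N1 + N2)"
  show thesis
  proof (rule that[of N])
    fix T a b c f F\<^sub>0 F\<^sub>\<alpha> and u :: "real \<Rightarrow> real ^ 'n \<Rightarrow> real" and B0 B1 B2 H t
    assume pp: "parabolic_problem \<delta> K \<alpha> T a b c f F\<^sub>0 F\<^sub>\<alpha> u B0 B1 B2 H" and t: "T \<le> ereal t"
    interpret parabolic_problem \<delta> K \<alpha> T a b c f F\<^sub>0 F\<^sub>\<alpha> u B0 B1 B2 H by fact
    define S where "S = F\<^sub>\<alpha> + F\<^sub>0"
    have "C2_bounds \<alpha> F\<^sub>0 (N1 * S) (N2 * S) (2 * C1 * (1 + N1 + N2) * S) (u t)"
      using est[OF pp t] by (simp add: N1_def N2_def S_def algebra_simps)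
    from norm_2\<alpha>_le[OF this]
    have "norm_2\<alpha> \<alpha> (u t) \<le> ereal (F\<^sub>0 + N1 * S + N2 * S + 2 * C1 * (1 + N1 + N2) * S)" .
    also have "\<dots> \<le> ereal (N * S)"
      using F\<alpha>_nonneg by (simp add: N_def S_def algebra_simps)
    finally show "norm_2\<alpha> \<alpha> (u t) \<le> ereal (N * (F\<^sub>0 + F\<^sub>\<alpha>))" by (simp add: S_def add.commute)
  qed
qed

theorem theorem2p4:
  fixes \<delta> K \<alpha> :: real
  assumes "0 < \<delta>" and "0 < K" and "0 < \<alpha>" and "\<alpha> < 1"
  shows "\<exists>N::real.
    \<forall>(T::ereal) (a :: real \<Rightarrow> real ^ 'n \<Rightarrow> real ^ 'n ^ 'n) b c f F\<^sub>0 F\<^sub>\<alpha>.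
      T < \<infinity> \<and> coeff_assms \<delta> K \<alpha> a b c \<and> rhs_assms \<alpha> c F\<^sub>0 F\<^sub>\<alpha> f \<longrightarrow>
        (\<forall>u \<in> parabolic_class \<alpha> T. solves_parabolic T a b c f u \<longrightarrow>
           (\<forall>t. T \<le> ereal t \<longrightarrow> norm_2\<alpha> \<alpha> (u t) \<le> ereal (N * (F\<^sub>0 + F\<^sub>\<alpha>)))) \<and>
        (time_independent a \<and> time_independent b \<and> time_independent c \<and> time_independent f \<longrightarrow>
           (\<forall>v \<in> C_2\<alpha> \<alpha>. (\<forall>t x. elliptic_op a b c t v x = f t x) \<longrightarrow>
              norm_2\<alpha> \<alpha> v \<le> ereal (N * (F\<^sub>0 + F\<^sub>\<alpha>))))"
proof -
  obtain N where N: "\<And>T a b c f F\<^sub>0 F\<^sub>\<alpha> (u :: real \<Rightarrow> real ^ 'n \<Rightarrow> real) B0 B1 B2 H t.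
    parabolic_problem \<delta> K \<alpha> T a b c f F\<^sub>0 F\<^sub>\<alpha> u B0 B1 B2 H \<Longrightarrow> T \<le> ereal t \<Longrightarrow>
    norm_2\<alpha> \<alpha> (u t) \<le> ereal (N * (F\<^sub>0 + F\<^sub>\<alpha>))"
    by (rule parabolic_problem_estimate[OF assms]) (rule that)
  show ?thesis
  proof (intro exI[of _ N] allI impI conjI ballI)
    fix T :: ereal and a :: "real \<Rightarrow> real ^ 'n \<Rightarrow> real ^ 'n ^ 'n" and b c f F\<^sub>0 F\<^sub>\<alpha> u t
    assume A: "T < \<infinity> \<and> coeff_assms \<delta> K \<alpha> a b c \<and> rhs_assms \<alpha> c F\<^sub>0 F\<^sub>\<alpha> f"
      and u: "u \<in> parabolic_class \<alpha> T" and sol: "solves_parabolic T a b c f u" and t: "T \<le> ereal t"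
    obtain M where M: "\<And>t. T \<le> ereal t \<Longrightarrow> norm_2\<alpha> \<alpha> (u t) \<le> ereal M"
      using u unfolding parabolic_class_def by blast
    have "parabolic_problem \<delta> K \<alpha> T a b c f F\<^sub>0 F\<^sub>\<alpha> u M M M M"
    proof
      show "continuous_on (time_space T) (\<lambda>(t, x). u t x)" using u by (simp add: parabolic_class_def)
      show "C2_bounds \<alpha> M M M M (u t)" if "T \<le> ereal t" for t
        using u that M[OF that] by (intro C2_bounds_from_norm) (auto simp: parabolic_class_def)
    qed (use assms A sol in auto)
    from N[OF this t] show "norm_2\<alpha> \<alpha> (u t) \<le> ereal (N * (F\<^sub>0 + F\<^sub>\<alpha>))" .
  next
    fix T :: ereal and a :: "real \<Rightarrow> real ^ 'n \<Rightarrow> real ^ 'n ^ 'n" and b c f F\<^sub>0 F\<^sub>\<alpha> v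
    assume A: "T < \<infinity> \<and> coeff_assms \<delta> K \<alpha> a b c \<and> rhs_assms \<alpha> c F\<^sub>0 F\<^sub>\<alpha> f"
      and v: "v \<in> C_2\<alpha> \<alpha>" and eq: "\<forall>t x. elliptic_op a b c t v x = f t x"
    have "norm_2\<alpha> \<alpha> v < \<infinity>" using v by (simp add: C_2\<alpha>_def)
    then obtain M where M: "norm_2\<alpha> \<alpha> v \<le> ereal M"
      by (cases "norm_2\<alpha> \<alpha> v") auto
    have "parabolic_problem \<delta> K \<alpha> (- \<infinity>) a b c f F\<^sub>0 F\<^sub>\<alpha> (\<lambda>t. v) M M M M"
    proof
      have "continuous_on UNIV v"
        using v by (auto simp: C_2\<alpha>_def continuous_on_eq_continuous_at intro: differentiable_imp_continuous_within)
      then have "continuous_on (time_space (- \<infinity>)) (\<lambda>z. v (snd z))"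
        by (rule continuous_on_compose2) (auto intro: continuous_intros)
      then show "continuous_on (time_space (- \<infinity>)) (\<lambda>(t, x). v x)" by (simp add: case_prod_beta)
      show "C2_bounds \<alpha> M M M M v" by (rule C2_bounds_from_norm[OF v M])
      show "solves_parabolic (- \<infinity>) a b c f (\<lambda>t. v)" using eq by (simp add: solves_parabolic_def)
    qed (use assms A in auto)
    from N[OF this, of 0] show "norm_2\<alpha> \<alpha> v \<le> ereal (N * (F\<^sub>0 + F\<^sub>\<alpha>))" by simp
  qed
qed

end
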